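(* Let $V$ be an interaction potential as in the context and let $\hat{\mathbb P}_N$ ($N\in\mathbb N$) be the associated $\delta$-pinned interface measures with pinning parameter $J$. For every $J\in\mathbb R$ there exist $m=m(J)>0$ and a constant $c_1=c_1(J)<\infty$ (both may also depend on $c_V$, but not on $N,i,j$) such that $$\mathrm{Cov}_{\hat{\mathbb P}_N}(\phi_i;\phi_j)\le c_1 e^{-m\|i-j\|}$$ for all $N\in\mathbb N$ and all $i,j\in\mathbb Z^2$.
   Context: Potential: $V:\mathbb R\to\mathbb R$ is even and smooth, and there is a constant $c_V\ge 1$ with $\frac1{c_V}\le V''(t)\le c_V$ for all $t\in\mathbb R$. Hamiltonian: formally $\mathcal H(\phi)=\sum_{i\sim j}V(\phi_i-\phi_j)$, the sum being over nearest-neighbour pairs (unordered) of $\mathbb Z^2$. In a finite box $\Lambda_N=[-N,\dots,N]^2\subset\mathbb Z^2$ with heights fixed to $0$ outside, the sum is restricted to pairs with at least one endpoint in $\Lambda_N$ (the other terms are constants absorbed in the normalization). Pinned measure: for $J\in\mathbb R$, $$\hat{\mathbb P}_N(d\phi)=\frac1{\hat{\mathbf Z}_N}e^{-\mathcal H(\phi)}\prod_{i\in\Lambda_N}\bigl(d\phi_i+e^J\delta_0(d\phi_i)\bigr)\prod_{j\in\mathbb Z^2\setminus\Lambda_N}\delta_0(d\phi_j),$$ where $d\phi_i$ is Lebesgue measure, $\delta_0$ is the Dirac mass at $0$, and $\hat{\mathbf Z}_N$ is the normalizing constant. $\|\cdot\|$ is the sup norm on $\mathbb Z^2$. *)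

theory Defs
  imports "HOL-Probability.Probability"
begin

definition smooth_real :: "(real \<Rightarrow> real) \<Rightarrow> bool" where
  "smooth_real f \<longleftrightarrow> (\<forall>n x. (deriv ^^ n) f differentiable (at x))"

definition interaction_potential :: "real \<Rightarrow> (real \<Rightarrow> real) \<Rightarrow> bool" where
  "interaction_potential cV V \<longleftrightarrow>
     1 \<le> cV \<and> (\<forall>t. V (- t) = V t) \<and> smooth_real V \<and>
     (\<forall>t. 1 / cV \<le> deriv (deriv V) t \<and> deriv (deriv V) t \<le> cV)"

type_synonym site = "int \<times> int"
type_synonym config = "site \<Rightarrow> real"

definition sup_norm :: "site \<Rightarrow> int" where
  "sup_norm i = max \<bar>fst i\<bar> \<bar>snd i\<bar>"

definition nn :: "site \<Rightarrow> site \<Rightarrow> bool" where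
  "nn i j \<longleftrightarrow> \<bar>fst i - fst j\<bar> + \<bar>snd i - snd j\<bar> = 1"

definition box :: "nat \<Rightarrow> site set" where
  "box N = {- int N..int N} \<times> {- int N..int N}"

definition nn_pairs :: "nat \<Rightarrow> (site \<times> site) set" where
  "nn_pairs N = {(i, j). nn i j \<and> (i \<in> box N \<or> j \<in> box N)}"

text \<open>The set \<open>nn_pairs N\<close> contains every bond in both orientations. As \<open>V\<close> is even, both
  contribute equally, and half of the sum is the sum over unordered pairs.\<close>

definition hamiltonian :: "(real \<Rightarrow> real) \<Rightarrow> nat \<Rightarrow> config \<Rightarrow> real" where
  "hamiltonian V N \<phi> = (1 / 2) * (\<Sum>(i, j)\<in>nn_pairs N. V (\<phi> i - \<phi> j))"

lemma finite_nn_pairs: "finite (nn_pairs N)"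
proof (rule finite_subset)
  show "nn_pairs N \<subseteq> box (Suc N) \<times> box (Suc N)"
    by (auto simp: nn_pairs_def nn_def box_def)
  show "finite (box (Suc N) \<times> box (Suc N))"
    by (simp add: box_def)
qed

text \<open>The single-site measure \<open>dx + e\<^sup>J \<delta>\<^sub>0(dx)\<close>.\<close>

definition pinned_line :: "real \<Rightarrow> real measure" where
  "pinned_line J = measure_of UNIV (sets borel)
     (\<lambda>A. emeasure lborel A + ennreal (exp J) * emeasure (return borel 0) A)"

lemma space_pinned_line [simp]: "space (pinned_line J) = UNIV"
  by (simp add: pinned_line_def)

lemma sets_pinned_line [simp, measurable_cong]: "sets (pinned_line J) = sets borel"
  using sets.sigma_sets_eq[of "borel :: real measure"] by (simp add: pinned_line_def)

lemma emeasure_pinned_line: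
  assumes "A \<in> sets borel"
  shows "emeasure (pinned_line J) A = emeasure lborel A + ennreal (exp J) * indicator A 0"
proof -
  let ?\<mu> = "\<lambda>A. emeasure lborel A + ennreal (exp J) * emeasure (return borel (0::real)) A"
  have "countably_additive (sets borel) ?\<mu>"
  proof (rule countably_additiveI)
    fix F :: "nat \<Rightarrow> real set"
    assume F: "range F \<subseteq> sets borel" "disjoint_family F" "\<Union> (range F) \<in> sets borel"
    have "(\<Sum>n. ?\<mu> (F n)) =
        (\<Sum>n. emeasure lborel (F n)) + ennreal (exp J) * (\<Sum>n. emeasure (return borel 0) (F n))"
      by (simp add: suminf_add[symmetric] ennreal_suminf_cmult)
    also have "\<dots> = ?\<mu> (\<Union> (range F))"
      using F by (subst (1 2) suminf_emeasure) simp_all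
    finally show "(\<Sum>n. ?\<mu> (F n)) = ?\<mu> (\<Union> (range F))" .
  qed
  moreover have "positive (sets (pinned_line J)) ?\<mu>"
    by (simp add: positive_def)
  ultimately have "emeasure (pinned_line J) A = ?\<mu> A"
    using assms by (intro emeasure_measure_of[OF pinned_line_def]) auto
  then show ?thesis
    using assms by simp
qed

text \<open>The product reference measure on full configurations: the finite product over the box,
  pushed forward under extension by \<open>0\<close>, which realises the Dirac masses outside the box.\<close>

definition zero_ext :: "nat \<Rightarrow> config \<Rightarrow> config" where
  "zero_ext N \<phi> = (\<lambda>i. if i \<in> box N then \<phi> i else 0)"

definition reference_measure :: "real \<Rightarrow> nat \<Rightarrow> config measure" where
  "reference_measure J N =
     distr (Pi\<^sub>M (box N) (\<lambda>_. pinned_line J)) (Pi\<^sub>M UNIV (\<lambda>_. borel)) (zero_ext N)"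

lemma measurable_zero_ext:
  "zero_ext N \<in> Pi\<^sub>M (box N) (\<lambda>_. pinned_line J) \<rightarrow>\<^sub>M Pi\<^sub>M UNIV (\<lambda>_. borel)"
proof (rule measurable_PiM_single')
  show "(\<lambda>\<phi>. zero_ext N \<phi> i) \<in> Pi\<^sub>M (box N) (\<lambda>_. pinned_line J) \<rightarrow>\<^sub>M borel" for i
    unfolding zero_ext_def by (cases "i \<in> box N") auto
qed auto

definition partition_function :: "(real \<Rightarrow> real) \<Rightarrow> real \<Rightarrow> nat \<Rightarrow> ennreal" where
  "partition_function V J N =
     (\<integral>\<^sup>+ \<phi>. ennreal (exp (- hamiltonian V N \<phi>)) \<partial>reference_measure J N)"

definition pinned_measure :: "(real \<Rightarrow> real) \<Rightarrow> real \<Rightarrow> nat \<Rightarrow> config measure" where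
  "pinned_measure V J N =
     density (reference_measure J N)
       (\<lambda>\<phi>. ennreal (exp (- hamiltonian V N \<phi>)) / partition_function V J N)"

definition covariance :: "'a measure \<Rightarrow> ('a \<Rightarrow> real) \<Rightarrow> ('a \<Rightarrow> real) \<Rightarrow> real" where
  "covariance M X Y =
     (LINT \<omega>|M. (X \<omega> - (LINT \<omega>'|M. X \<omega>')) * (Y \<omega> - (LINT \<omega>'|M. Y \<omega>')))"

end

theory Submission
  imports Defs
begin

text \<open>
  Expanding the product of \<open>d\<phi> + e\<^sup>J \<delta>\<^sub>0\<close> writes the measure as a mixture, over the set \<open>D\<close> of unpinned
  sites, of gradient fields on \<open>D\<close> with zero boundary condition, all of mean zero.

  For fixed \<open>D\<close>, tilting the field by \<open>exp (h \<phi>\<^sub>j)\<close> raises it, in the sense of stochastic domination, by at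
  most \<open>h \<psi>\<close>, whenever \<open>\<psi>\<close> is a supersolution with source at \<open>j\<close> for all conductances in
  \<open>[1 / c\<^sub>V, c\<^sub>V]\<close>: this is Holley's criterion, that is, the continuous four functions theorem. Letting \<open>h\<close>
  tend to \<open>0\<close> bounds the covariance by \<open>\<psi>\<^sub>i\<close>. An explicit \<open>\<psi>\<close> decays exponentially in the number of
  cells containing a pinned site that any walk from \<open>i\<close> to \<open>j\<close> must meet, up to a prefactor exponential in
  the distance from \<open>j\<close> to the pinned sites.

  The Prekopa-Leindler inequality gives a lower bound of order \<open>R\<^sup>-\<^sup>1\<^sup>/\<^sup>2\<close> for the density at \<open>0\<close> of the height at a
  site at distance \<open>R\<close> from the pinned sites. So a cell of side \<open>L\<^sup>2\<close> without pinned sites can be given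
  \<open>L\<^sup>2\<close> of them, each in about \<open>L\<^sup>2\<close> ways and at a price of order \<open>1 / L\<close>; therefore \<open>n\<close> given cells are
  all free of pinned sites with probability at most \<open>\<delta>\<^sup>n\<close>, where \<open>\<delta>\<close> is smaller than any prescribed
  exponential of the side. A Peierls sum over walks of cells then yields the claim.
\<close>

section \<open>Product measures extended by zero\<close>

text \<open>The usual route writes the covariance as the Green function of a random walk whose jump
  rates are \<open>V''\<close> along a diffusion. Only an upper bound is wanted, so the walk is
  replaced by a single function that is a supersolution whatever the conductances, and densities are
  compared directly. The price is a barrier tuned to the worst conductances: its base
  \<open>2 + 7 * cV\<^sup>2\<close> is large, a source at distance \<open>d\<close> from the pinned
  sites costs \<open>base ^ d\<close>, and the weight can decay only at a rate of order
  \<open>base ^ (- 2 K)\<close> per good cell of side \<open>K\<close>. A cell without pinned sites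
  must therefore be rarer than a fixed exponential of its side. One new pinned site gains only a
  power of \<open>L\<close>, which is why as many sites are pinned in a cell as its side is long.
  The price of a site, the root of a distance, comes from the energy along one path; in dimension
  two it is far from optimal, but the number of available sites makes up for it. Prefactor and decay
  depend on the same random set; an arithmetic-geometric mean inequality separates them, at the cost
  of a second moment of the prefactor.\<close>

abbreviation cfg :: "('i \<Rightarrow> real) measure" where
  "cfg \<equiv> Pi\<^sub>M UNIV (\<lambda>_. borel)"

definition zext :: "'i set \<Rightarrow> ('i \<Rightarrow> real) \<Rightarrow> 'i \<Rightarrow> real" where
  "zext D \<phi> = (\<lambda>x. if x \<in> D then \<phi> x else 0)"

text \<open>The image lives on configurations over all indices, so that the measures for different
  \<open>D\<close> share one space and can be summed and compared.\<close>

definition zprod :: "real measure \<Rightarrow> 'i set \<Rightarrow> ('i \<Rightarrow> real) measure" where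
  "zprod \<mu> D = distr (Pi\<^sub>M D (\<lambda>_. \<mu>)) cfg (zext D)"

lemma space_zprod [simp]: "space (zprod \<mu> D) = UNIV"
  by (simp add: zprod_def space_PiM)

lemma sets_zprod [simp, measurable_cong]: "sets (zprod \<mu> D) = sets cfg"
  by (simp add: zprod_def)

lemma measurable_zext:
  assumes "sets \<mu> = sets borel"
  shows "zext D \<in> Pi\<^sub>M D (\<lambda>_. \<mu>) \<rightarrow>\<^sub>M cfg"
proof (rule measurable_PiM_single')
  note assms [measurable_cong]
  show "(\<lambda>\<phi>. zext D \<phi> i) \<in> Pi\<^sub>M D (\<lambda>_. \<mu>) \<rightarrow>\<^sub>M borel" for i
    unfolding zext_def by (cases "i \<in> D") auto
qed auto

lemma measurable_cfg_update [measurable]: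
  assumes "f \<in> M \<rightarrow>\<^sub>M cfg" "g \<in> M \<rightarrow>\<^sub>M borel"
  shows "(\<lambda>w. (f w)(k := g w)) \<in> M \<rightarrow>\<^sub>M cfg"
proof (rule measurable_PiM_single')
  note assms [measurable]
  show "(\<lambda>w. ((f w)(k := g w)) i) \<in> M \<rightarrow>\<^sub>M borel" for i
    by (cases "i = k") auto
qed auto

lemma measurable_update_line:
  "f \<in> borel_measurable cfg \<Longrightarrow> (\<lambda>t. f (x(k := t))) \<in> borel_measurable borel"
  by (erule measurable_compose[rotated]) (intro measurable_cfg_update, simp_all add: space_PiM)

lemma measurable_cfgI:
  assumes "\<And>i. (\<lambda>w. f w i) \<in> M \<rightarrow>\<^sub>M borel"
  shows "f \<in> M \<rightarrow>\<^sub>M cfg"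
  using assms by (intro measurable_PiM_single') auto

lemma nn_integral_zprod_empty:
  assumes "sets \<mu> = sets borel" "f \<in> borel_measurable cfg"
  shows "(\<integral>\<^sup>+\<phi>. f \<phi> \<partial>zprod \<mu> {}) = f (\<lambda>_. 0)"
proof -
  have "(\<integral>\<^sup>+\<phi>. f \<phi> \<partial>zprod \<mu> {}) = (\<integral>\<^sup>+\<phi>. f (zext {} \<phi>) \<partial>Pi\<^sub>M {} (\<lambda>_. \<mu>))"
    unfolding zprod_def using assms by (intro nn_integral_distr measurable_zext) simp_all
  then show ?thesis
    by (simp add: PiM_empty nn_integral_count_space_finite zext_def)
qed

lemma nn_integral_zprod_insert:
  assumes "sigma_finite_measure \<mu>" and s: "sets \<mu> = sets borel"
    and D: "finite D" "k \<notin> D" and f: "f \<in> borel_measurable cfg"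
  shows "(\<integral>\<^sup>+\<phi>. f \<phi> \<partial>zprod \<mu> (insert k D)) = (\<integral>\<^sup>+t. (\<integral>\<^sup>+\<phi>. f (\<phi>(k := t)) \<partial>zprod \<mu> D) \<partial>\<mu>)"
proof -
  interpret product_sigma_finite "\<lambda>_. \<mu>"
    using assms by (simp add: product_sigma_finite_def)
  note s [measurable_cong] f [measurable]
  note mz = measurable_zext[OF s]
  have "(\<integral>\<^sup>+\<phi>. f \<phi> \<partial>zprod \<mu> (insert k D)) =
      (\<integral>\<^sup>+\<phi>. f (zext (insert k D) \<phi>) \<partial>Pi\<^sub>M (insert k D) (\<lambda>_. \<mu>))"
    unfolding zprod_def using f by (intro nn_integral_distr mz) simp
  also have "\<dots> = (\<integral>\<^sup>+t. (\<integral>\<^sup>+\<phi>. f (zext (insert k D) (\<phi>(k := t))) \<partial>Pi\<^sub>M D (\<lambda>_. \<mu>)) \<partial>\<mu>)"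
    using D by (rule product_nn_integral_insert_rev) (rule measurable_compose[OF mz f])
  also have "\<dots> = (\<integral>\<^sup>+t. (\<integral>\<^sup>+\<phi>. f ((zext D \<phi>)(k := t)) \<partial>Pi\<^sub>M D (\<lambda>_. \<mu>)) \<partial>\<mu>)"
    by (intro nn_integral_cong arg_cong[where f = f]) (auto simp: zext_def)
  also have "\<dots> = (\<integral>\<^sup>+t. (\<integral>\<^sup>+\<phi>. f (\<phi>(k := t)) \<partial>zprod \<mu> D) \<partial>\<mu>)"
    unfolding zprod_def by (subst nn_integral_distr[OF mz]) auto
  finally show ?thesis .
qed

text \<open>A push-forward can lose sigma-finiteness. Here restriction to \<open>D\<close> undoes
  \<open>zext D\<close>, so a countable cover by sets of finite measure can be pulled back along the
  restriction.\<close>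

lemma sigma_finite_zprod:
  assumes "sigma_finite_measure \<mu>" and s: "sets \<mu> = sets borel" and D: "finite (D :: 'i set)"
  shows "sigma_finite_measure (zprod \<mu> D)"
proof -
  interpret product_sigma_finite "\<lambda>_::'i. \<mu>"
    using assms by (simp add: product_sigma_finite_def)
  interpret S: sigma_finite_measure "Pi\<^sub>M D (\<lambda>_. \<mu>)"
    using D by (rule sigma_finite)
  have r: "(\<lambda>\<phi>. restrict \<phi> D) \<in> cfg \<rightarrow>\<^sub>M Pi\<^sub>M D (\<lambda>_. \<mu>)"
    by (intro measurable_restrict) (subst measurable_cong_sets[OF refl s], simp)
  let ?P = "Pi\<^sub>M D (\<lambda>_. \<mu>)"
  obtain A where A: "countable A" "A \<subseteq> sets ?P" "\<Union>A = space ?P" "\<And>a. a \<in> A \<Longrightarrow> emeasure ?P a \<noteq> \<infinity>"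
    using S.sigma_finite_countable by metis
  define B where "B a = {\<phi>. restrict \<phi> D \<in> a}" for a :: "('i \<Rightarrow> real) set"
  have B: "B a \<in> sets cfg" if "a \<in> A" for a
    using measurable_sets[OF r, of a] that A(2) by (auto simp: B_def space_PiM vimage_def)
  have "emeasure (zprod \<mu> D) (B a) = emeasure ?P a" if a: "a \<in> A" for a
  proof -
    have sub: "a \<subseteq> space ?P"
      using a A(2) sets.sets_into_space by blast
    have res: "restrict (zext D x) D = x" if "x \<in> space ?P" for x
      using that by (auto simp: space_PiM zext_def restrict_def PiE_def extensional_def fun_eq_iff)
    have "zext D -` B a \<inter> space ?P = a"
      using sub res by (auto simp: B_def)
    then show ?thesis
      unfolding zprod_def using emeasure_distr[OF measurable_zext[OF s] B[OF a]] by simp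
  qed
  moreover have "(\<Union>a\<in>A. B a) = UNIV"
  proof -
    have "restrict \<phi> D \<in> space ?P" for \<phi> :: "'i \<Rightarrow> real"
      using sets_eq_imp_space_eq[OF s] by (auto simp: space_PiM)
    then show ?thesis
      using A(3) unfolding B_def by fastforce
  qed
  ultimately show ?thesis
    using B A(1,4) by (intro sigma_finite_measure.intro exI[of _ "B ` A"]) auto
qed

lemma measurable_nn_integral_zprod:
  assumes "sigma_finite_measure \<mu>" and s: "sets \<mu> = sets borel" and "finite D"
    and f: "f \<in> borel_measurable cfg"
  shows "(\<lambda>\<phi>. \<integral>\<^sup>+t. f (\<phi>(k := t)) \<partial>\<mu>) \<in> borel_measurable cfg"
    and "(\<lambda>t. \<integral>\<^sup>+\<phi>. f (\<phi>(k := t)) \<partial>zprod \<mu> D) \<in> borel_measurable borel"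
proof -
  interpret sigma_finite_measure \<mu> by fact
  interpret Z: sigma_finite_measure "zprod \<mu> D" using assms by (intro sigma_finite_zprod)
  note s [measurable_cong] f [measurable]
  show "(\<lambda>\<phi>. \<integral>\<^sup>+t. f (\<phi>(k := t)) \<partial>\<mu>) \<in> borel_measurable cfg" by measurable
  show "(\<lambda>t. \<integral>\<^sup>+\<phi>. f (\<phi>(k := t)) \<partial>zprod \<mu> D) \<in> borel_measurable borel" by measurable
qed

text \<open>With the new coordinate innermost, a one-dimensional inequality can be applied under the
  integral over the other coordinates; the inductions over \<open>D\<close> rely on this
  order.\<close>

lemma nn_integral_zprod_insert':
  assumes "sigma_finite_measure \<mu>" and s: "sets \<mu> = sets borel"
    and D: "finite D" "k \<notin> D" and f: "f \<in> borel_measurable cfg"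
  shows "(\<integral>\<^sup>+\<phi>. f \<phi> \<partial>zprod \<mu> (insert k D)) = (\<integral>\<^sup>+\<phi>. (\<integral>\<^sup>+t. f (\<phi>(k := t)) \<partial>\<mu>) \<partial>zprod \<mu> D)"
proof -
  interpret sigma_finite_measure \<mu> by fact
  interpret Z: sigma_finite_measure "zprod \<mu> D" using assms by (intro sigma_finite_zprod)
  interpret pair_sigma_finite "zprod \<mu> D" \<mu> ..
  note s [measurable_cong] f [measurable]
  show ?thesis
    unfolding nn_integral_zprod_insert[OF assms] by (rule Fubini') measurable
qed

abbreviation vol :: "'i set \<Rightarrow> ('i \<Rightarrow> real) measure" where
  "vol \<equiv> zprod lborel"

lemmas vol_empty = nn_integral_zprod_empty[of lborel, simplified]
lemmas vol_insert = nn_integral_zprod_insert[OF lborel.sigma_finite_measure_axioms sets_lborel]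
lemmas vol_insert' = nn_integral_zprod_insert'[OF lborel.sigma_finite_measure_axioms sets_lborel]
lemmas vol_measurable = measurable_nn_integral_zprod[OF lborel.sigma_finite_measure_axioms sets_lborel]

lemma vol_shift:
  assumes "finite D" "\<And>k. k \<notin> D \<Longrightarrow> s k = 0" "f \<in> borel_measurable cfg"
  shows "(\<integral>\<^sup>+\<phi>. f (\<lambda>k. \<phi> k + s k) \<partial>vol D) = (\<integral>\<^sup>+\<phi>. f \<phi> \<partial>vol D)"
  using assms
proof (induction D arbitrary: s f rule: finite_induct)
  case empty
  have m: "(\<lambda>\<phi>. (\<lambda>k. \<phi> k + s k)) \<in> cfg \<rightarrow>\<^sub>M cfg" by (rule measurable_cfgI) simp
  show ?case
    using empty(1) vol_empty[OF empty(2)] vol_empty[OF measurable_compose[OF m empty(2)]] by simp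
next
  case (insert x D)
  note f = insert.prems(2)
  have m: "(\<lambda>\<phi>. (\<lambda>k. \<phi> k + s k)) \<in> cfg \<rightarrow>\<^sub>M cfg" by (rule measurable_cfgI) simp
  \<comment> \<open>The induction hypothesis wants a shift vanishing off \<open>D\<close>, so the
    shift at \<open>x\<close> is split off and removed by translation on the line.\<close>
  let ?s = "s(x := 0)"
  have mt: "(\<lambda>\<phi>. f (\<phi>(x := t))) \<in> borel_measurable cfg" for t
    by (rule measurable_compose[OF _ f]) measurable
  have "(\<integral>\<^sup>+\<phi>. f (\<lambda>k. \<phi> k + s k) \<partial>vol (insert x D)) =
      (\<integral>\<^sup>+t. (\<integral>\<^sup>+\<phi>. f (\<lambda>k. (\<phi>(x := t)) k + s k) \<partial>vol D) \<partial>lborel)"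
    using insert by (intro vol_insert measurable_compose[OF m f]) auto
  also have "\<dots> = (\<integral>\<^sup>+t. (\<integral>\<^sup>+\<phi>. (\<lambda>\<phi>. f (\<phi>(x := t + s x))) (\<lambda>k. \<phi> k + ?s k) \<partial>vol D) \<partial>lborel)"
    by (intro nn_integral_cong arg_cong[where f = f]) auto
  also have "\<dots> = (\<integral>\<^sup>+t. (\<integral>\<^sup>+\<phi>. f (\<phi>(x := t + s x)) \<partial>vol D) \<partial>lborel)"
    using insert mt by (subst insert.IH) auto
  also have "\<dots> = (\<integral>\<^sup>+t. (\<integral>\<^sup>+\<phi>. f (\<phi>(x := t)) \<partial>vol D) \<partial>lborel)"
    using nn_integral_real_affine[OF vol_measurable(2)[OF insert.hyps(1) f, of x], of 1 "s x"]
    by (simp add: add.commute fun_upd_def)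
  also have "\<dots> = (\<integral>\<^sup>+\<phi>. f \<phi> \<partial>vol (insert x D))"
    using insert by (intro vol_insert[symmetric]) auto
  finally show ?case .
qed

lemma vol_uminus:
  assumes "finite D" "f \<in> borel_measurable cfg"
  shows "(\<integral>\<^sup>+\<phi>. f (\<lambda>k. - \<phi> k) \<partial>vol D) = (\<integral>\<^sup>+\<phi>. f \<phi> \<partial>vol D)"
  using assms
proof (induction D arbitrary: f rule: finite_induct)
  case empty
  have m: "(\<lambda>\<phi>. (\<lambda>k. - \<phi> k)) \<in> cfg \<rightarrow>\<^sub>M cfg" by (rule measurable_cfgI) simp
  show ?case
    using vol_empty[OF empty] vol_empty[OF measurable_compose[OF m empty]] by simp
next
  case (insert x D)
  note f = insert.prems(1)
  have m: "(\<lambda>\<phi>. (\<lambda>k. - \<phi> k)) \<in> cfg \<rightarrow>\<^sub>M cfg" by (rule measurable_cfgI) simp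
  have mt: "(\<lambda>\<phi>. f (\<phi>(x := t))) \<in> borel_measurable cfg" for t
    by (rule measurable_compose[OF _ f]) measurable
  have "(\<integral>\<^sup>+\<phi>. f (\<lambda>k. - \<phi> k) \<partial>vol (insert x D)) =
      (\<integral>\<^sup>+t. (\<integral>\<^sup>+\<phi>. f (\<lambda>k. - (\<phi>(x := t)) k) \<partial>vol D) \<partial>lborel)"
    using insert by (intro vol_insert measurable_compose[OF m f]) auto
  also have "\<dots> = (\<integral>\<^sup>+t. (\<integral>\<^sup>+\<phi>. (\<lambda>\<phi>. f (\<phi>(x := - t))) (\<lambda>k. - \<phi> k) \<partial>vol D) \<partial>lborel)"
    by (intro nn_integral_cong arg_cong[where f = f]) auto
  also have "\<dots> = (\<integral>\<^sup>+t. (\<integral>\<^sup>+\<phi>. f (\<phi>(x := - t)) \<partial>vol D) \<partial>lborel)"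
    using insert mt by (subst insert.IH) auto
  also have "\<dots> = (\<integral>\<^sup>+t. (\<integral>\<^sup>+\<phi>. f (\<phi>(x := t)) \<partial>vol D) \<partial>lborel)"
    using nn_integral_real_affine[OF vol_measurable(2)[OF insert.hyps(1) f, of x], of "-1" 0] by (simp add: fun_upd_def)
  also have "\<dots> = (\<integral>\<^sup>+\<phi>. f \<phi> \<partial>vol (insert x D))"
    using insert by (intro vol_insert[symmetric]) auto
  finally show ?case .
qed

lemma AE_vol_support:
  assumes "finite D" "k \<notin> D"
  shows "AE \<phi> in vol D. \<phi> k = 0"
  unfolding zprod_def
  by (subst AE_distr_iff[OF measurable_zext]) (auto simp: zext_def assms)

section \<open>Four functions and Prekopa-Leindler inequalities\<close>

lemma ennreal_add_le_add_of_mult_le: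
  fixes a b c d :: ennreal
  assumes "a \<le> c" "b \<le> c" "a * b \<le> c * d"
  shows "a + b \<le> c + d"
proof (cases "c = 0 \<or> c = \<infinity> \<or> d = \<infinity>")
  case True
  then show ?thesis using assms by auto
next
  case False
  have fin: "x < top" if "x \<le> c" for x
    using that False by (metis infinity_ennreal_def le_less_trans less_top)
  obtain c' where c: "c = ennreal c'" "0 \<le> c'" using fin[of c] by (cases c) auto
  obtain d' where d: "d = ennreal d'" "0 \<le> d'" using False by (cases d) auto
  obtain a' where a: "a = ennreal a'" "0 \<le> a'" using fin[of a] assms by (cases a) auto
  obtain b' where b: "b = ennreal b'" "0 \<le> b'" using fin[of b] assms by (cases b) auto
  have "a' \<le> c'" "b' \<le> c'" "a' * b' \<le> c' * d'" "0 < c'"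
    using assms False a b c d by (auto simp: ennreal_mult[symmetric] zero_less_iff_neq_zero)
  \<comment> \<open>Expanded, this bounds \<open>c' * (a' + b')\<close> by
    \<open>c' * c' + a' * b'\<close>, hence by \<open>c' * (c' + d')\<close>.\<close>
  then have "0 \<le> (c' - a') * (c' - b')" by simp
  then have "c' * (a' + b') \<le> c' * (c' + d')"
    using \<open>a' * b' \<le> c' * d'\<close> by (simp add: algebra_simps)
  then have "a' + b' \<le> c' + d'" using \<open>0 < c'\<close> by simp
  then show ?thesis using a b c d by (simp flip: ennreal_plus)
qed

text \<open>Symmetrising the double integral in \<open>s\<close> and \<open>t\<close> reduces the
  claim to each pair of points separately, where it is the four functions theorem on a two-point
  chain.\<close>

lemma four_functions_line:
  fixes f1 f2 f3 f4 :: "real \<Rightarrow> ennreal"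
  assumes [measurable]: "f1 \<in> borel_measurable borel" "f2 \<in> borel_measurable borel"
      "f3 \<in> borel_measurable borel" "f4 \<in> borel_measurable borel"
    and le: "\<And>s t. f1 s * f2 t \<le> f3 (max s t) * f4 (min s t)"
  shows "(\<integral>\<^sup>+s. f1 s \<partial>lborel) * (\<integral>\<^sup>+s. f2 s \<partial>lborel) \<le> (\<integral>\<^sup>+s. f3 s \<partial>lborel) * (\<integral>\<^sup>+s. f4 s \<partial>lborel)"
proof -
  have prod: "(\<integral>\<^sup>+s. (\<integral>\<^sup>+t. f s * g t + f t * g s \<partial>lborel) \<partial>lborel) =
      2 * ((\<integral>\<^sup>+s. f s \<partial>lborel) * (\<integral>\<^sup>+s. g s \<partial>lborel))"
    if [measurable]: "f \<in> borel_measurable borel" "g \<in> borel_measurable borel" for f g :: "real \<Rightarrow> ennreal"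
    by (simp add: nn_integral_add nn_integral_cmult nn_integral_multc mult_2)
  have main: "f1 s * f2 t + f1 t * f2 s \<le> f3 s * f4 t + f3 t * f4 s" if "s \<le> t" for s t
  proof -
    have "f1 s * f2 t + f1 t * f2 s \<le> f3 t * f4 s + f3 s * f4 t"
    proof (rule ennreal_add_le_add_of_mult_le)
      show "f1 s * f2 t \<le> f3 t * f4 s" "f1 t * f2 s \<le> f3 t * f4 s"
        using le[of s t] le[of t s] that by (simp_all add: max_def min_def split: if_splits)
      have "(f1 s * f2 s) * (f1 t * f2 t) \<le> (f3 s * f4 s) * (f3 t * f4 t)"
        using le[of s s] le[of t t] by (intro mult_mono[of "f1 s * f2 s" _ "f1 t * f2 t"]) auto
      then show "f1 s * f2 t * (f1 t * f2 s) \<le> f3 t * f4 s * (f3 s * f4 t)"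
        by (simp add: ac_simps)
    qed
    then show ?thesis by (simp add: add.commute)
  qed
  have "f1 s * f2 t + f1 t * f2 s \<le> f3 s * f4 t + f3 t * f4 s" for s t
    using main[of s t] main[of t s] by (cases "s \<le> t") (auto simp: add.commute)
  then have "2 * ((\<integral>\<^sup>+s. f1 s \<partial>lborel) * (\<integral>\<^sup>+s. f2 s \<partial>lborel)) \<le>
      2 * ((\<integral>\<^sup>+s. f3 s \<partial>lborel) * (\<integral>\<^sup>+s. f4 s \<partial>lborel))"
    unfolding prod[OF assms(1,2), symmetric] prod[OF assms(3,4), symmetric]
    by (intro nn_integral_mono)
  then show ?thesis
    by (subst (asm) ennreal_mult_le_mult_iff) auto
qed

section \<open>Lebesgue measure of sumsets on the line\<close>

lemma emeasure_lborel_eq_SUP_atMost: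
  fixes A :: "real set"
  assumes A: "A \<in> sets borel" "A \<noteq> {}"
  shows "emeasure lborel A = (SUP a\<in>A. emeasure lborel (A \<inter> {..a}))"
proof (rule antisym)
  show "(SUP a\<in>A. emeasure lborel (A \<inter> {..a})) \<le> emeasure lborel A"
    using A by (intro SUP_least emeasure_mono) auto
  \<comment> \<open>\<open>r\<close> exhausts \<open>A\<close> from below, each \<open>r n\<close>
    staying below some point of \<open>A\<close>. The cases: \<open>A\<close> has a maximum, is
    bounded above without one, or is unbounded above.\<close>
  obtain r where r: "incseq r" "\<And>n. \<exists>a\<in>A. r n \<le> a" "\<And>x. x \<in> A \<Longrightarrow> \<exists>n. x \<le> r n"
  proof (cases "\<exists>m\<in>A. \<forall>a\<in>A. a \<le> m")
    case True
    then obtain m where "m \<in> A" "\<And>a. a \<in> A \<Longrightarrow> a \<le> m" by blast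
    then show thesis by (intro that[of "\<lambda>_::nat. m"]) auto
  next
    case False
    show thesis
    proof (cases "bdd_above A")
      case True
      have less: "x < Sup A" if "x \<in> A" for x
        using False True that by (metis cSup_upper le_less_trans not_le)
      have "\<exists>n. x \<le> Sup A - 1 / real (Suc n)" if "x \<in> A" for x
      proof -
        obtain n where "inverse (real (Suc n)) < Sup A - x"
          using reals_Archimedean[of "Sup A - x"] less[OF \<open>x \<in> A\<close>] by (metis diff_gt_0_iff_gt)
        then show ?thesis by (intro exI[of _ n]) (simp add: field_simps)
      qed
      moreover have "\<exists>a\<in>A. Sup A - 1 / real (Suc n) \<le> a" for n
        using less_cSup_iff[OF A(2) True, of "Sup A - 1 / real (Suc n)"] by (auto intro: less_imp_le)
      moreover have "incseq (\<lambda>n. Sup A - 1 / real (Suc n))"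
        by (auto simp: incseq_def field_simps)
      ultimately show thesis by (intro that)
    next
      case False
      then have "\<exists>a\<in>A. real n \<le> a" for n
        unfolding bdd_above_def by (meson linear order_trans not_le)
      moreover have "\<exists>n. x \<le> real n" for x by (rule real_arch_simple)
      ultimately show thesis by (intro that[of real]) (auto simp: incseq_def)
    qed
  qed
  have "emeasure lborel A = emeasure lborel (\<Union>n. A \<inter> {..r n})"
    using r(3) by (intro arg_cong[where f = "emeasure lborel"]) auto
  also have "\<dots> = (SUP n. emeasure lborel (A \<inter> {..r n}))"
    using A r(1) by (intro SUP_emeasure_incseq[symmetric]) (auto simp: incseq_def intro: order_trans)
  also have "\<dots> \<le> (SUP a\<in>A. emeasure lborel (A \<inter> {..a}))"
  proof (rule SUP_mono)
    fix n
    obtain a where "a \<in> A" "r n \<le> a" using r(2) by blast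
    then show "\<exists>a\<in>A. emeasure lborel (A \<inter> {..r n}) \<le> emeasure lborel (A \<inter> {..a})"
      using A by (intro bexI[of _ a] emeasure_mono) auto
  qed
  finally show "emeasure lborel A \<le> (SUP a\<in>A. emeasure lborel (A \<inter> {..a}))" .
qed

lemma emeasure_lborel_affine:
  fixes A :: "real set"
  assumes "A \<in> sets borel" "\<bar>c\<bar> = 1"
  shows "emeasure lborel ((\<lambda>x. t + c * x) -` A) = emeasure lborel A"
proof -
  have [measurable]: "(\<lambda>x. t + c * x) -` A \<in> sets borel"
    using measurable_sets_borel[of "\<lambda>x. t + c * x" borel A] assms by simp
  have "emeasure lborel A = ennreal \<bar>c\<bar> * (\<integral>\<^sup>+x. indicator A (t + c * x) \<partial>lborel)"
    using nn_integral_real_affine[of "indicator A" c t] assms by auto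
  also have "(\<integral>\<^sup>+x. indicator A (t + c * x) \<partial>lborel) = (\<integral>\<^sup>+x. indicator ((\<lambda>x. t + c * x) -` A) x \<partial>lborel)"
    by (intro nn_integral_cong) (simp add: indicator_def)
  finally show ?thesis using assms by simp
qed

lemma emeasure_lborel_eq_SUP_atLeast:
  fixes A :: "real set"
  assumes A: "A \<in> sets borel" "A \<noteq> {}"
  shows "emeasure lborel A = (SUP a\<in>A. emeasure lborel (A \<inter> {a..}))"
proof -
  let ?u = "\<lambda>x::real. 0 + - 1 * x"
  have m: "?u -` A \<in> sets borel"
    using measurable_sets_borel[of ?u borel A] A by simp
  have "emeasure lborel A = emeasure lborel (?u -` A)"
    using A by (intro emeasure_lborel_affine[symmetric]) auto
  also have "\<dots> = (SUP a\<in>?u -` A. emeasure lborel (?u -` A \<inter> {..a}))"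
  proof (intro emeasure_lborel_eq_SUP_atMost m)
    obtain a where "a \<in> A" using A(2) by blast
    then have "- a \<in> ?u -` A" by simp
    then show "?u -` A \<noteq> {}" by blast
  qed
  also have "\<dots> = (SUP a\<in>?u -` A. emeasure lborel (A \<inter> {- a..}))"
  proof (intro SUP_cong refl)
    fix a
    have "?u -` A \<inter> {..a} = ?u -` (A \<inter> {- a..})" by auto
    then show "emeasure lborel (?u -` A \<inter> {..a}) = emeasure lborel (A \<inter> {- a..})"
      using A by (simp only:) (rule emeasure_lborel_affine, auto)
  qed
  also have "\<dots> = (SUP a\<in>A. emeasure lborel (A \<inter> {a..}))"
  proof -
    have "A = uminus ` (?u -` A)" by (auto simp: image_iff intro: bexI[of _ "- _"])
    then show ?thesis by (metis (no_types, lifting) SUP_cong image_image)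
  qed
  finally show ?thesis .
qed

text \<open>Keep the part of \<open>A\<close> up to one of its points \<open>a\<close> and the part
  of \<open>B\<close> from one of its points \<open>b\<close> on: translated by \<open>b\<close> and
  by \<open>a\<close>, they lie in \<open>C\<close> and meet at most in \<open>a + b\<close>.
  Suprema over \<open>a\<close> and \<open>b\<close> take the place of an approximation by compact
  sets. \<open>C\<close> may be any Borel set containing the sums, as the sumset itself need not be
  Borel.\<close>

lemma brunn_minkowski_line:
  fixes A B C :: "real set"
  assumes A: "A \<in> sets borel" "A \<noteq> {}" and B: "B \<in> sets borel" "B \<noteq> {}" and C: "C \<in> sets borel"
    and sub: "\<And>a b. a \<in> A \<Longrightarrow> b \<in> B \<Longrightarrow> a + b \<in> C"
  shows "emeasure lborel A + emeasure lborel B \<le> emeasure lborel C"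
proof -
  have "emeasure lborel (A \<inter> {..a}) + emeasure lborel (B \<inter> {b..}) \<le> emeasure lborel C"
    if ab: "a \<in> A" "b \<in> B" for a b
  proof -
    define S where "S = (\<lambda>x. - b + 1 * x) -` (A \<inter> {..a})"
    define T where "T = (\<lambda>x. - a + 1 * x) -` (B \<inter> {b..})"
    have [measurable]: "S \<in> sets borel" "T \<in> sets borel"
      unfolding S_def T_def using A B by (auto intro!: measurable_sets_borel[where M = borel])
    have "S \<subseteq> C" "T \<subseteq> C" "S \<inter> T \<subseteq> {a + b}"
      using sub[of "_ - b" b] sub[of a "_ - a"] ab by (fastforce simp: S_def T_def)+
    have "emeasure lborel (A \<inter> {..a}) + emeasure lborel (B \<inter> {b..}) = emeasure lborel S + emeasure lborel T"
      unfolding S_def T_def using A B by (subst (1 2) emeasure_lborel_affine) auto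
    also have "\<dots> = emeasure lborel (S - {a + b}) + emeasure lborel T"
      by (subst emeasure_Diff_null_set) auto
    also have "\<dots> = emeasure lborel ((S - {a + b}) \<union> T)"
      using \<open>S \<inter> T \<subseteq> {a + b}\<close> by (intro plus_emeasure) auto
    also have "\<dots> \<le> emeasure lborel C"
      using \<open>S \<subseteq> C\<close> \<open>T \<subseteq> C\<close> C by (intro emeasure_mono) auto
    finally show ?thesis .
  qed
  then have "(SUP a\<in>A. SUP b\<in>B. emeasure lborel (A \<inter> {..a}) + emeasure lborel (B \<inter> {b..})) \<le> emeasure lborel C"
    by (intro SUP_least)
  moreover have "emeasure lborel A + emeasure lborel B =
      (SUP a\<in>A. SUP b\<in>B. emeasure lborel (A \<inter> {..a}) + emeasure lborel (B \<inter> {b..}))"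
    unfolding emeasure_lborel_eq_SUP_atMost[OF A] emeasure_lborel_eq_SUP_atLeast[OF B]
      ennreal_SUP_add_left[OF A(2), symmetric] ennreal_SUP_add_right[OF B(2), symmetric] ..
  ultimately show ?thesis by simp
qed

section \<open>The Prekopa-Leindler inequality on the line\<close>

lemma layer_cake_min_1:
  fixes u :: "real \<Rightarrow> ennreal"
  assumes [measurable]: "u \<in> borel_measurable borel"
  shows "(\<integral>\<^sup>+c. emeasure lborel {x. ennreal c < u x} * indicator {0<..<1} c \<partial>lborel) = (\<integral>\<^sup>+x. min 1 (u x) \<partial>lborel)"
proof -
  let ?i = "\<lambda>c x. indicator {x. ennreal c < u x} x * indicator {0<..<1::real} c :: ennreal"
  have "(\<integral>\<^sup>+c. emeasure lborel {x. ennreal c < u x} * indicator {0<..<1} c \<partial>lborel) =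
      (\<integral>\<^sup>+c. (\<integral>\<^sup>+x. ?i c x \<partial>lborel) \<partial>lborel)"
    by (intro nn_integral_cong) (simp add: nn_integral_multc)
  also have "\<dots> = (\<integral>\<^sup>+x. (\<integral>\<^sup>+c. ?i c x \<partial>lborel) \<partial>lborel)"
    by (intro lborel_pair.Fubini') (simp add: indicator_def, measurable)
  also have "\<dots> = (\<integral>\<^sup>+x. min 1 (u x) \<partial>lborel)"
  proof (intro nn_integral_cong)
    fix x
    have "(\<integral>\<^sup>+c. ?i c x \<partial>lborel) = (\<integral>\<^sup>+c. indicator {c. 0 < c \<and> c < 1 \<and> ennreal c < u x} c \<partial>lborel)"
      by (intro nn_integral_cong) (auto simp: indicator_def)
    also have "\<dots> = emeasure lborel {c. 0 < c \<and> c < 1 \<and> ennreal c < u x}"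
      by simp
    also have "\<dots> = min 1 (u x)"
    proof (cases "u x")
      case (real r)
      have "{c. 0 < c \<and> c < 1 \<and> ennreal c < u x} = {0<..<min 1 r}"
        using real by (auto simp: ennreal_less_iff)
      then show ?thesis using real by (simp add: min_def ennreal_le_1 flip: ennreal_1)
    next
      case top
      have "{c. 0 < c \<and> c < 1 \<and> ennreal c < u x} = {0<..<1}"
        using top by auto
      then show ?thesis using top by simp
    qed
    finally show "(\<integral>\<^sup>+c. ?i c x \<partial>lborel) = min 1 (u x)" .
  qed
  finally show ?thesis .
qed

lemma ennreal_mult_le_half_sum_square:
  fixes a b c :: ennreal
  assumes "a + b \<le> 2 * c"
  shows "a * b \<le> c * c"
proof (cases "c = \<infinity>")
  case True
  then show ?thesis by (cases "a = 0 \<or> b = 0") auto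
next
  case False
  then obtain c' where c: "c = ennreal c'" "0 \<le> c'" by (cases c) auto
  have "2 * c < top" using c by (simp add: ennreal_mult_less_top)
  then have "a + b < top" using assms by (rule le_less_trans[rotated])
  then obtain a' b' where ab: "a = ennreal a'" "0 \<le> a'" "b = ennreal b'" "0 \<le> b'"
    by (cases a; cases b) auto
  have "ennreal (a' + b') \<le> ennreal (2 * c')"
    using assms ab c by (simp add: ennreal_mult)
  then have "a' + b' \<le> 2 * c'" using c by simp
  then have "(a' + b')\<^sup>2 \<le> (2 * c')\<^sup>2" using ab by (intro power_mono) auto
  then have "a' * b' \<le> c' * c'"
    using zero_le_power2[of "a' - b'"] by (simp add: power2_eq_square algebra_simps)
  then show ?thesis using ab c by (simp flip: ennreal_mult)
qed

text \<open>With both suprema equal to 1, the superlevel sets of \<open>f\<close> and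
  \<open>g\<close> are nonempty at every level below 1, and their sums lie in that of
  \<open>?k\<close>. The sumset bound is integrated over the levels in \<open>(0, 1)\<close>. This
  additive form is stronger than the multiplicative one.\<close>

lemma prekopa_leindler_line_normalized:
  fixes f g h :: "real \<Rightarrow> ennreal"
  assumes [measurable]: "f \<in> borel_measurable borel" "g \<in> borel_measurable borel" "h \<in> borel_measurable borel"
    and le: "\<And>s t. f s * g t \<le> h ((s + t) / 2) * h ((s + t) / 2)"
    and f: "\<And>s. f s \<le> 1" "\<And>c::real. 0 < c \<Longrightarrow> c < 1 \<Longrightarrow> \<exists>s. c < f s"
    and g: "\<And>s. g s \<le> 1" "\<And>c::real. 0 < c \<Longrightarrow> c < 1 \<Longrightarrow> \<exists>s. c < g s"
  shows "(\<integral>\<^sup>+s. f s \<partial>lborel) + (\<integral>\<^sup>+s. g s \<partial>lborel) \<le> 2 * (\<integral>\<^sup>+s. h s \<partial>lborel)"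
proof -
  \<comment> \<open>Halving the argument turns midpoints into sums; scaling back produces the factor
    2.\<close>
  let ?k = "\<lambda>z. h (z / 2)"
  let ?L = "\<lambda>u c. emeasure lborel {x. ennreal c < u x} * indicator {0<..<1::real} c"
  have "?L f c + ?L g c \<le> ?L ?k c" for c
  proof (cases "0 < c \<and> c < 1")
    case True
    have "emeasure lborel {x. ennreal c < f x} + emeasure lborel {x. ennreal c < g x}
        \<le> emeasure lborel {x. ennreal c < ?k x}"
    proof (rule brunn_minkowski_line)
      fix a b assume ab: "a \<in> {x. ennreal c < f x}" "b \<in> {x. ennreal c < g x}"
      obtain x where x: "f a = ennreal x" "0 \<le> x"
        using f(1)[of a] by (cases "f a") (auto simp: top_unique)
      obtain y where y: "g b = ennreal y" "0 \<le> y"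
        using g(1)[of b] by (cases "g b") (auto simp: top_unique)
      have "c < x" "c < y" using ab x y True by (auto simp: ennreal_less_iff)
      show "a + b \<in> {x. ennreal c < ?k x}"
      proof (rule ccontr)
        assume "a + b \<notin> {x. ennreal c < ?k x}"
        then have "h ((a + b) / 2) * h ((a + b) / 2) \<le> ennreal c * ennreal c"
          by (intro mult_mono) auto
        with le[of a b] have "f a * g b \<le> ennreal c * ennreal c" by (rule order_trans)
        then have "x * y \<le> c * c" using x y True by (simp flip: ennreal_mult)
        then show False using mult_strict_mono[of c x c y] \<open>c < x\<close> \<open>c < y\<close> True by linarith
      qed
    qed (use f(2)[of c] g(2)[of c] True in auto)
    then show ?thesis using True by simp
  qed simp
  then have "(\<integral>\<^sup>+c. ?L f c + ?L g c \<partial>lborel) \<le> (\<integral>\<^sup>+c. ?L ?k c \<partial>lborel)"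
    by (intro nn_integral_mono)
  also have "\<dots> \<le> (\<integral>\<^sup>+z. ?k z \<partial>lborel)"
    unfolding layer_cake_min_1[of ?k, simplified] by (intro nn_integral_mono) auto
  also have "\<dots> = 2 * (\<integral>\<^sup>+s. h s \<partial>lborel)"
    using nn_integral_real_affine[of ?k 2 0] by simp
  finally have "(\<integral>\<^sup>+c. ?L f c + ?L g c \<partial>lborel) \<le> 2 * (\<integral>\<^sup>+s. h s \<partial>lborel)" .
  moreover have "(\<integral>\<^sup>+c. ?L f c + ?L g c \<partial>lborel) = (\<integral>\<^sup>+s. f s \<partial>lborel) + (\<integral>\<^sup>+s. g s \<partial>lborel)"
  proof -
    have "(\<integral>\<^sup>+c. ?L f c + ?L g c \<partial>lborel) = (\<integral>\<^sup>+c. ?L f c \<partial>lborel) + (\<integral>\<^sup>+c. ?L g c \<partial>lborel)"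
      by (intro nn_integral_add) measurable
    also have "\<dots> = (\<integral>\<^sup>+s. min 1 (f s) \<partial>lborel) + (\<integral>\<^sup>+s. min 1 (g s) \<partial>lborel)"
      by (simp add: layer_cake_min_1)
    also have "\<dots> = (\<integral>\<^sup>+s. f s \<partial>lborel) + (\<integral>\<^sup>+s. g s \<partial>lborel)"
      using f(1) g(1) by (auto simp: min_absorb2)
    finally show ?thesis .
  qed
  ultimately show ?thesis by simp
qed

text \<open>Dividing \<open>f\<close> and \<open>g\<close> by their suprema \<open>F\<close> and
  \<open>G\<close>, and \<open>h\<close> by the root of \<open>F * G\<close>, preserves the
  hypothesis. Boundedness makes the suprema finite.\<close>

lemma prekopa_leindler_line_bounded:
  fixes f g h :: "real \<Rightarrow> ennreal"
  assumes [measurable]: "f \<in> borel_measurable borel" "g \<in> borel_measurable borel" "h \<in> borel_measurable borel"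
    and le: "\<And>s t. f s * g t \<le> h ((s + t) / 2) * h ((s + t) / 2)"
    and bdd: "\<And>s. f s \<le> ennreal M" "\<And>s. g s \<le> ennreal M"
  shows "(\<integral>\<^sup>+s. f s \<partial>lborel) * (\<integral>\<^sup>+s. g s \<partial>lborel) \<le> (\<integral>\<^sup>+s. h s \<partial>lborel) * (\<integral>\<^sup>+s. h s \<partial>lborel)"
proof -
  have sup: "\<exists>F. (SUP s. u s) = ennreal F \<and> 0 < F" if "\<And>s. u s \<le> ennreal M" "\<not> (\<forall>s. u s = 0)"
    for u :: "real \<Rightarrow> ennreal"
  proof -
    have "(SUP s. u s) \<le> ennreal M" using that(1) by (intro SUP_least)
    then obtain F where F: "(SUP s. u s) = ennreal F" "0 \<le> F"
      by (cases "SUP s. u s") (auto simp: top_unique)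
    have "F \<noteq> 0"
    proof
      assume "F = 0"
      then have "u s \<le> 0" for s using SUP_upper[of s UNIV u] F by simp
      then show False using that(2) by simp
    qed
    then show ?thesis using F by (intro exI[of _ F]) auto
  qed
  show ?thesis
  proof (cases "(\<forall>s. f s = 0) \<or> (\<forall>s. g s = 0)")
    case True
    then show ?thesis by auto
  next
    case False
    obtain F where F: "(SUP s. f s) = ennreal F" "0 < F" using sup[of f] bdd False by blast
    obtain G where G: "(SUP s. g s) = ennreal G" "0 < G" using sup[of g] bdd False by blast
    let ?a = "ennreal (1 / F)" let ?b = "ennreal (1 / G)" let ?c = "ennreal (1 / sqrt (F * G))"
    have abc: "?a * ?b = ?c * ?c"
      using F G by (simp add: ennreal_mult[symmetric] real_sqrt_mult[symmetric])
    have norm: "u s * ennreal (1 / U) \<le> 1" "0 < c \<Longrightarrow> c < 1 \<Longrightarrow> \<exists>s. ennreal c < u s * ennreal (1 / U)"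
      if U: "(SUP s. u s) = ennreal U" "0 < U" for u :: "real \<Rightarrow> ennreal" and U s and c :: real
    proof -
      have "u s * ennreal (1 / U) \<le> ennreal U * ennreal (1 / U)"
        using SUP_upper[of s UNIV u] U by (intro mult_right_mono) auto
      then show "u s * ennreal (1 / U) \<le> 1" using U by (simp flip: ennreal_mult)
      assume c: "0 < c" "c < 1"
      then have "ennreal (c * U) < (SUP s. u s)" using U by (simp add: ennreal_less_iff)
      then obtain t where t: "ennreal (c * U) < u t" by (auto simp: less_SUP_iff)
      have "ennreal c = ennreal (c * U) * ennreal (1 / U)"
        using U c by (simp add: ennreal_mult[symmetric])
      also have "\<dots> < u t * ennreal (1 / U)"
        using t U by (intro ennreal_mult_strict_right_mono) auto
      finally show "\<exists>s. ennreal c < u s * ennreal (1 / U)" by blast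
    qed
    have "(\<integral>\<^sup>+s. f s * ?a \<partial>lborel) + (\<integral>\<^sup>+s. g s * ?b \<partial>lborel) \<le> 2 * (\<integral>\<^sup>+s. h s * ?c \<partial>lborel)"
    proof (rule prekopa_leindler_line_normalized)
      show "f s * ?a * (g t * ?b) \<le> h ((s + t) / 2) * ?c * (h ((s + t) / 2) * ?c)" for s t
      proof -
        have "f s * ?a * (g t * ?b) = f s * g t * (?a * ?b)" by (simp only: ac_simps)
        also have "\<dots> \<le> h ((s + t) / 2) * h ((s + t) / 2) * (?c * ?c)"
          unfolding abc by (intro mult_right_mono le) simp
        finally show ?thesis by (simp only: ac_simps)
      qed
    qed (use norm F G in auto)
    then have "(\<integral>\<^sup>+s. f s * ?a \<partial>lborel) * (\<integral>\<^sup>+s. g s * ?b \<partial>lborel) \<le>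
        (\<integral>\<^sup>+s. h s * ?c \<partial>lborel) * (\<integral>\<^sup>+s. h s * ?c \<partial>lborel)"
      by (rule ennreal_mult_le_half_sum_square)
    then have "(?a * ?b) * ((\<integral>\<^sup>+s. f s \<partial>lborel) * (\<integral>\<^sup>+s. g s \<partial>lborel)) \<le>
        (?c * ?c) * ((\<integral>\<^sup>+s. h s \<partial>lborel) * (\<integral>\<^sup>+s. h s \<partial>lborel))"
      by (simp add: nn_integral_multc ac_simps)
    moreover have "?c * ?c \<noteq> 0" "?c * ?c \<noteq> top"
      using F G by (auto simp: ennreal_mult_eq_top_iff)
    ultimately show ?thesis
      unfolding abc by (simp add: ennreal_mult_le_mult_iff)
  qed
qed

lemma nn_integral_eq_SUP_min:
  fixes f :: "'a \<Rightarrow> ennreal"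
  assumes [measurable]: "f \<in> borel_measurable M"
  shows "(\<integral>\<^sup>+s. f s \<partial>M) = (SUP n::nat. \<integral>\<^sup>+s. min (f s) (ennreal (real n)) \<partial>M)"
proof -
  have "f s = (SUP n::nat. min (f s) (ennreal (real n)))" for s
  proof (rule antisym)
    show "f s \<le> (SUP n::nat. min (f s) (ennreal (real n)))"
    proof (cases "f s")
      case (real r)
      obtain n where "r \<le> real n" using real_arch_simple by blast
      then have "f s \<le> min (f s) (ennreal (real n))" using real by (auto intro: ennreal_leI)
      then show ?thesis by (rule order_trans) (rule SUP_upper, simp)
    next
      case top
      then show ?thesis
        by (simp add: ennreal_of_nat_eq_real_of_nat[symmetric] ennreal_SUP_of_nat_eq_top)
    qed
  qed (auto intro: SUP_least)
  then have "(\<integral>\<^sup>+s. f s \<partial>M) = (\<integral>\<^sup>+s. (SUP n::nat. min (f s) (ennreal (real n))) \<partial>M)"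
    by simp
  also have "\<dots> = (SUP n::nat. \<integral>\<^sup>+s. min (f s) (ennreal (real n)) \<partial>M)"
    by (intro nn_integral_monotone_convergence_SUP)
       (auto simp: incseq_def le_fun_def min_def intro: order_trans ennreal_leI)
  finally show ?thesis .
qed

lemma prekopa_leindler_line:
  fixes f g h :: "real \<Rightarrow> ennreal"
  assumes [measurable]: "f \<in> borel_measurable borel" "g \<in> borel_measurable borel" "h \<in> borel_measurable borel"
    and le: "\<And>s t. f s * g t \<le> h ((s + t) / 2) * h ((s + t) / 2)"
  shows "(\<integral>\<^sup>+s. f s \<partial>lborel) * (\<integral>\<^sup>+s. g s \<partial>lborel) \<le> (\<integral>\<^sup>+s. h s \<partial>lborel) * (\<integral>\<^sup>+s. h s \<partial>lborel)"
proof -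
  have "(\<integral>\<^sup>+s. min (f s) (ennreal (real n)) \<partial>lborel) * (\<integral>\<^sup>+s. min (g s) (ennreal (real m)) \<partial>lborel) \<le>
      (\<integral>\<^sup>+s. h s \<partial>lborel) * (\<integral>\<^sup>+s. h s \<partial>lborel)" for n m :: nat
  proof (rule prekopa_leindler_line_bounded[where M = "max (real n) (real m)"])
    show "min (f s) (ennreal (real n)) * min (g t) (ennreal (real m)) \<le> h ((s + t) / 2) * h ((s + t) / 2)" for s t
      by (rule order_trans[OF mult_mono le]) auto
  qed (auto intro!: min.coboundedI2 ennreal_leI)
  then have "(SUP m::nat. SUP n::nat. (\<integral>\<^sup>+s. min (f s) (ennreal (real n)) \<partial>lborel) *
      (\<integral>\<^sup>+s. min (g s) (ennreal (real m)) \<partial>lborel)) \<le> (\<integral>\<^sup>+s. h s \<partial>lborel) * (\<integral>\<^sup>+s. h s \<partial>lborel)"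
    by (intro SUP_least)
  then show ?thesis
    unfolding nn_integral_eq_SUP_min[of f lborel, simplified] nn_integral_eq_SUP_min[of g lborel, simplified]
      SUP_mult_left_ennreal SUP_mult_right_ennreal .
qed

section \<open>Passage to several coordinates\<close>

lemma four_functions_vol:
  fixes f1 f2 f3 f4 :: "('i \<Rightarrow> real) \<Rightarrow> ennreal"
  assumes "finite D" "f1 \<in> borel_measurable cfg" "f2 \<in> borel_measurable cfg"
      "f3 \<in> borel_measurable cfg" "f4 \<in> borel_measurable cfg"
    and "\<And>x y. (\<And>k. k \<notin> D \<Longrightarrow> x k = 0) \<Longrightarrow> (\<And>k. k \<notin> D \<Longrightarrow> y k = 0) \<Longrightarrow>
      f1 x * f2 y \<le> f3 (\<lambda>k. max (x k) (y k)) * f4 (\<lambda>k. min (x k) (y k))"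
  shows "(\<integral>\<^sup>+x. f1 x \<partial>vol D) * (\<integral>\<^sup>+x. f2 x \<partial>vol D) \<le> (\<integral>\<^sup>+x. f3 x \<partial>vol D) * (\<integral>\<^sup>+x. f4 x \<partial>vol D)"
  using assms
proof (induction D arbitrary: f1 f2 f3 f4 rule: finite_induct)
  case empty
  show ?case
    using empty.prems(5)[of "\<lambda>_. 0" "\<lambda>_. 0"] by (simp add: vol_empty empty.prems(1-4))
next
  case (insert k D)
  note f = insert.prems(1-4)
  show ?case
    unfolding f[THEN vol_insert'[OF insert.hyps]]
  \<comment> \<open>With all other coordinates frozen, the one-dimensional inequality is exactly the
    pointwise hypothesis for the functions obtained by integrating out \<open>k\<close>.\<close>
  proof (rule insert.IH)
    fix x y :: "'i \<Rightarrow> real"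
    assume x: "\<And>i. i \<notin> D \<Longrightarrow> x i = 0" and y: "\<And>i. i \<notin> D \<Longrightarrow> y i = 0"
    show "(\<integral>\<^sup>+t. f1 (x(k := t)) \<partial>lborel) * (\<integral>\<^sup>+t. f2 (y(k := t)) \<partial>lborel) \<le>
        (\<integral>\<^sup>+t. f3 ((\<lambda>i. max (x i) (y i))(k := t)) \<partial>lborel) *
        (\<integral>\<^sup>+t. f4 ((\<lambda>i. min (x i) (y i))(k := t)) \<partial>lborel)"
    proof (rule four_functions_line)
      fix s t
      have "(\<lambda>i. max (x i) (y i))(k := max s t) = (\<lambda>i. max ((x(k := s)) i) ((y(k := t)) i))"
        "(\<lambda>i. min (x i) (y i))(k := min s t) = (\<lambda>i. min ((x(k := s)) i) ((y(k := t)) i))" by auto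
      then show "f1 (x(k := s)) * f2 (y(k := t)) \<le>
          f3 ((\<lambda>i. max (x i) (y i))(k := max s t)) * f4 ((\<lambda>i. min (x i) (y i))(k := min s t))"
        using insert.prems(5)[of "x(k := s)" "y(k := t)"] x y by (simp add: fun_upd_def)
    qed (intro measurable_update_line f)+
  qed (intro vol_measurable(1)[OF insert.hyps(1)] f)+
qed

lemma prekopa_leindler_vol:
  fixes f g h :: "('i \<Rightarrow> real) \<Rightarrow> ennreal"
  assumes "finite D" "f \<in> borel_measurable cfg" "g \<in> borel_measurable cfg" "h \<in> borel_measurable cfg"
    and "\<And>x y. (\<And>k. k \<notin> D \<Longrightarrow> x k = 0) \<Longrightarrow> (\<And>k. k \<notin> D \<Longrightarrow> y k = 0) \<Longrightarrow>
      f x * g y \<le> h (\<lambda>k. (x k + y k) / 2) * h (\<lambda>k. (x k + y k) / 2)"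
  shows "(\<integral>\<^sup>+x. f x \<partial>vol D) * (\<integral>\<^sup>+x. g x \<partial>vol D) \<le> (\<integral>\<^sup>+x. h x \<partial>vol D) * (\<integral>\<^sup>+x. h x \<partial>vol D)"
  using assms
proof (induction D arbitrary: f g h rule: finite_induct)
  case empty
  show ?case
    using empty.prems(4)[of "\<lambda>_. 0" "\<lambda>_. 0"] by (simp add: vol_empty empty.prems(1-3))
next
  case (insert k D)
  note f = insert.prems(1-3)
  show ?case
    unfolding f[THEN vol_insert'[OF insert.hyps]]
  proof (rule insert.IH)
    fix x y :: "'i \<Rightarrow> real"
    assume x: "\<And>i. i \<notin> D \<Longrightarrow> x i = 0" and y: "\<And>i. i \<notin> D \<Longrightarrow> y i = 0"
    show "(\<integral>\<^sup>+t. f (x(k := t)) \<partial>lborel) * (\<integral>\<^sup>+t. g (y(k := t)) \<partial>lborel) \<le>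
        (\<integral>\<^sup>+t. h ((\<lambda>i. (x i + y i) / 2)(k := t)) \<partial>lborel) *
        (\<integral>\<^sup>+t. h ((\<lambda>i. (x i + y i) / 2)(k := t)) \<partial>lborel)"
    proof (rule prekopa_leindler_line)
      fix s t
      have "(\<lambda>i. (x i + y i) / 2)(k := (s + t) / 2) = (\<lambda>i. ((x(k := s)) i + (y(k := t)) i) / 2)" by auto
      then show "f (x(k := s)) * g (y(k := t)) \<le>
          h ((\<lambda>i. (x i + y i) / 2)(k := (s + t) / 2)) * h ((\<lambda>i. (x i + y i) / 2)(k := (s + t) / 2))"
        using insert.prems(4)[of "x(k := s)" "y(k := t)"] x y by (simp add: fun_upd_def)
    qed (intro measurable_update_line f)+
  qed (intro vol_measurable(1)[OF insert.hyps(1)] f)+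
qed

section \<open>Expansion over the unpinned sites\<close>

lemma nn_integral_pinned_line:
  assumes "f \<in> borel_measurable borel"
  shows "(\<integral>\<^sup>+t. f t \<partial>pinned_line J) = (\<integral>\<^sup>+t. f t \<partial>lborel) + ennreal (exp J) * f 0"
  using assms
proof (induction f rule: borel_measurable_induct)
  case (cong f g)
  then have "f = g" by auto
  then show ?case using cong by simp
next
  case (set A)
  then show ?case by (simp add: emeasure_pinned_line)
next
  case (mult u c)
  then show ?case
    by (simp add: nn_integral_cmult measurable_cong_sets[OF sets_pinned_line refl] distrib_left ac_simps)
next
  case (add u v)
  then show ?case
    by (simp add: nn_integral_add measurable_cong_sets[OF sets_pinned_line refl] distrib_left ac_simps)
next
  case (seq U)
  have m: "U i \<in> borel_measurable (pinned_line J)" for i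
    using seq by (simp add: measurable_cong_sets[OF sets_pinned_line refl])
  have inc: "incseq (\<lambda>i. ennreal (exp J) * U i 0)" "incseq (\<lambda>i. \<integral>\<^sup>+t. U i t \<partial>lborel)"
    using \<open>incseq U\<close> by (auto simp: incseq_def le_fun_def intro!: mult_left_mono nn_integral_mono)
  have "(\<integral>\<^sup>+t. (SUP i. U i t) \<partial>pinned_line J) = (SUP i. \<integral>\<^sup>+t. U i t \<partial>pinned_line J)"
    using seq m by (intro nn_integral_monotone_convergence_SUP)
  also have "\<dots> = (SUP i. (\<integral>\<^sup>+t. U i t \<partial>lborel) + ennreal (exp J) * U i 0)"
    using seq by simp
  also have "\<dots> = (SUP i. \<integral>\<^sup>+t. U i t \<partial>lborel) + (SUP i. ennreal (exp J) * U i 0)"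
    using inc by (intro ennreal_SUP_add)
  also have "\<dots> = (\<integral>\<^sup>+t. (SUP i. U i t) \<partial>lborel) + ennreal (exp J) * (SUP i. U i 0)"
    using seq by (simp add: nn_integral_monotone_convergence_SUP SUP_mult_left_ennreal)
  finally show ?case by (simp add: SUP_apply[abs_def] image_comp)
qed

lemma sigma_finite_pinned_line: "sigma_finite_measure (pinned_line J)"
proof
  have "emeasure (pinned_line J) {- real n..real n} \<noteq> \<infinity>" for n
    by (simp add: emeasure_pinned_line ennreal_mult_eq_top_iff split: split_indicator)
  moreover have "(\<Union>n. {- real n..real n}) = UNIV"
  proof -
    have "\<exists>n. x \<in> {- real n..real n}" for x
      using real_arch_simple[of "\<bar>x\<bar>"] by (metis abs_le_iff atLeastAtMost_iff minus_le_iff)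
    then show ?thesis by blast
  qed
  ultimately show "\<exists>A. countable A \<and> A \<subseteq> sets (pinned_line J) \<and> \<Union> A = space (pinned_line J) \<and>
      (\<forall>a\<in>A. emeasure (pinned_line J) a \<noteq> \<infinity>)"
    by (intro exI[of _ "range (\<lambda>n::nat. {- real n..real n})"]) auto
qed

lemma nn_integral_vol_update_zero:
  assumes "finite D" "k \<notin> D" "f \<in> borel_measurable cfg"
  shows "(\<integral>\<^sup>+\<phi>. f (\<phi>(k := 0)) \<partial>vol D) = (\<integral>\<^sup>+\<phi>. f \<phi> \<partial>vol D)"
  using AE_vol_support[OF assms(1,2)]
  by (intro nn_integral_cong_AE) (auto elim!: eventually_mono simp: fun_upd_idem)

lemma nn_integral_pinned_expansion:
  assumes "finite B" "f \<in> borel_measurable cfg"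
  shows "(\<integral>\<^sup>+\<phi>. f \<phi> \<partial>zprod (pinned_line J) B) =
    (\<Sum>D\<in>Pow B. ennreal (exp (J * real (card (B - D)))) * (\<integral>\<^sup>+\<phi>. f \<phi> \<partial>vol D))"
  using assms
proof (induction B arbitrary: f rule: finite_induct)
  case empty
  then show ?case by (simp add: vol_empty nn_integral_zprod_empty)
next
  case (insert k B)
  note f = insert.prems
  let ?w = "\<lambda>B D. ennreal (exp (J * real (card (B - D))))"
  let ?F = "\<lambda>\<phi>. \<integral>\<^sup>+t. f (\<phi>(k := t)) \<partial>lborel" and ?G = "\<lambda>\<phi>. f (\<phi>(k := 0))"
  have F: "?F \<in> borel_measurable cfg" by (intro vol_measurable(1)[OF insert.hyps(1)] f)
  have G: "?G \<in> borel_measurable cfg"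
    by (rule measurable_compose[OF _ f]) measurable
  have "(\<integral>\<^sup>+\<phi>. f \<phi> \<partial>zprod (pinned_line J) (insert k B)) =
      (\<integral>\<^sup>+\<phi>. ?F \<phi> + ennreal (exp J) * ?G \<phi> \<partial>zprod (pinned_line J) B)"
    unfolding nn_integral_zprod_insert'[OF sigma_finite_pinned_line sets_pinned_line insert.hyps f]
      nn_integral_pinned_line[OF measurable_update_line[OF f]] ..
  also have "\<dots> = (\<Sum>D\<in>Pow B. ?w B D * (\<integral>\<^sup>+\<phi>. ?F \<phi> + ennreal (exp J) * ?G \<phi> \<partial>vol D))"
  proof (rule insert.IH)
    note F [measurable] G [measurable]
    show "(\<lambda>\<phi>. ?F \<phi> + ennreal (exp J) * ?G \<phi>) \<in> borel_measurable cfg" by measurable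
  qed
  \<comment> \<open>Each \<open>D\<close> yields two subsets of \<open>insert k B\<close>: one with
    \<open>k\<close> unpinned, and one with \<open>k\<close> pinned at the extra factor
    \<open>exp J\<close>.\<close>
  also have "\<dots> = (\<Sum>D\<in>Pow B. ?w (insert k B) (insert k D) * (\<integral>\<^sup>+\<phi>. f \<phi> \<partial>vol (insert k D)) +
      ?w (insert k B) D * (\<integral>\<^sup>+\<phi>. f \<phi> \<partial>vol D))"
  proof (intro sum.cong refl)
    fix D assume "D \<in> Pow B"
    then have D: "finite D" "k \<notin> D" using insert.hyps finite_subset by auto
    have "insert k B - insert k D = B - D" using insert.hyps(2) by auto
    moreover have "?w (insert k B) D = ?w B D * ennreal (exp J)"
      using insert.hyps D by (simp add: insert_Diff_if ennreal_mult[symmetric] exp_add[symmetric] algebra_simps)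
    moreover have "(\<integral>\<^sup>+\<phi>. ?F \<phi> + ennreal (exp J) * ?G \<phi> \<partial>vol D) =
        (\<integral>\<^sup>+\<phi>. f \<phi> \<partial>vol (insert k D)) + ennreal (exp J) * (\<integral>\<^sup>+\<phi>. f \<phi> \<partial>vol D)"
      using F G vol_insert'[OF D f] nn_integral_vol_update_zero[OF D f]
      by (simp add: nn_integral_add nn_integral_cmult fun_upd_def)
    ultimately show "?w B D * (\<integral>\<^sup>+\<phi>. ?F \<phi> + ennreal (exp J) * ?G \<phi> \<partial>vol D) =
        ?w (insert k B) (insert k D) * (\<integral>\<^sup>+\<phi>. f \<phi> \<partial>vol (insert k D)) +
        ?w (insert k B) D * (\<integral>\<^sup>+\<phi>. f \<phi> \<partial>vol D)"
      by (simp add: distrib_left mult.assoc)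
  qed
  also have "\<dots> = (\<Sum>D\<in>insert k ` Pow B. ?w (insert k B) D * (\<integral>\<^sup>+\<phi>. f \<phi> \<partial>vol D)) +
      (\<Sum>D\<in>Pow B. ?w (insert k B) D * (\<integral>\<^sup>+\<phi>. f \<phi> \<partial>vol D))"
  proof -
    have "inj_on (insert k) (Pow B)"
      using insert.hyps(2) by (intro inj_onI) (auto simp: insert_eq_iff)
    then show ?thesis by (simp add: sum.distrib sum.reindex)
  qed
  also have "\<dots> = (\<Sum>D\<in>Pow (insert k B). ?w (insert k B) D * (\<integral>\<^sup>+\<phi>. f \<phi> \<partial>vol D))"
    unfolding Pow_insert using insert.hyps by (subst sum.union_disjoint) (auto simp: add.commute)
  finally show ?case .
qed

lemma reference_measure_eq_zprod: "reference_measure J N = zprod (pinned_line J) (Defs.box N)"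
  unfolding reference_measure_def zprod_def zero_ext_def[abs_def] zext_def[abs_def] ..

section \<open>Distance to the pinned sites\<close>

definition l1 :: "site \<Rightarrow> site \<Rightarrow> nat" where
  "l1 x y = nat (\<bar>fst x - fst y\<bar> + \<bar>snd x - snd y\<bar>)"

definition exit_dist :: "site set \<Rightarrow> site \<Rightarrow> nat" where
  "exit_dist D x = (LEAST n. \<exists>y. y \<notin> D \<and> l1 x y = n)"

lemma exit_dist_le: "y \<notin> D \<Longrightarrow> exit_dist D x \<le> l1 x y"
  unfolding exit_dist_def by (rule Least_le) blast

lemma exit_dist_attained:
  assumes "finite D"
  obtains y where "y \<notin> D" "exit_dist D x = l1 x y"
proof -
  have "infinite (UNIV :: site set)" by (simp add: infinite_UNIV_char_0 finite_prod)
  then obtain y0 where "y0 \<notin> D" using assms by (metis ex_new_if_finite)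
  then have "\<exists>n. \<exists>y. y \<notin> D \<and> l1 x y = n" by blast
  then have "\<exists>y. y \<notin> D \<and> l1 x y = exit_dist D x" unfolding exit_dist_def by (rule LeastI_ex)
  then show thesis using that by metis
qed

lemma exit_dist_pos:
  assumes "finite D" "x \<in> D"
  shows "0 < exit_dist D x"
proof -
  obtain y where y: "y \<notin> D" "exit_dist D x = l1 x y" using exit_dist_attained assms(1) by blast
  then have "x \<noteq> y" using assms by auto
  then show ?thesis using y by (cases x; cases y) (auto simp: l1_def)
qed

lemma l1_descent:
  assumes "x \<noteq> y"
  obtains l where "nn x l" "Suc (l1 l y) \<le> l1 x y"
proof -
  have "\<exists>l. nn x l \<and> Suc (l1 l y) \<le> l1 x y"
  proof (cases "fst x = fst y")
    case True
    then have "snd x \<noteq> snd y" using assms by (auto simp: prod_eq_iff)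
    then show ?thesis using True
      by (intro exI[of _ "(fst x, snd x - sgn (snd x - snd y))"])
         (cases "snd x < snd y"; auto simp: nn_def l1_def sgn_if)
  next
    case False
    then show ?thesis
      by (intro exI[of _ "(fst x - sgn (fst x - fst y), snd x)"])
         (cases "fst x < fst y"; auto simp: nn_def l1_def sgn_if)
  qed
  then show thesis using that by blast
qed

lemma exit_dist_descent:
  assumes "finite D" "x \<in> D"
  obtains l where "nn x l" "Suc (exit_dist D l) \<le> exit_dist D x"
proof -
  obtain y where y: "y \<notin> D" "exit_dist D x = l1 x y" using exit_dist_attained assms(1) by blast
  have "x \<noteq> y" using y assms by auto
  obtain l where "nn x l" "Suc (l1 l y) \<le> l1 x y" using l1_descent[OF \<open>x \<noteq> y\<close>] .
  then show thesis using that[of l] exit_dist_le[OF y(1), of l] y(2) by linarith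
qed

lemma nn_sym: "nn i j \<Longrightarrow> nn j i"
  by (auto simp: nn_def abs_minus_commute)

lemma nn_neighbours: "{l. nn k l} = {(fst k + 1, snd k), (fst k - 1, snd k), (fst k, snd k + 1), (fst k, snd k - 1)}"
  by (cases k) (auto simp: nn_def)

lemma finite_neighbours [simp]: "finite {l. nn k l}"
  by (simp add: nn_neighbours)

lemma card_neighbours: "card {l. nn k l} = 4"
  by (simp add: nn_neighbours)

text \<open>Every bond counts twice, as in \<open>nn_pairs\<close>. Combined with the factor 1/2 in
  the Hamiltonian this turns the \<open>4 * cV\<close> of \<open>V_midpoint\<close> into
  \<open>8 * cV\<close>.\<close>

definition bond_energy :: "nat \<Rightarrow> config \<Rightarrow> real" where
  "bond_energy N z = (\<Sum>(a, b)\<in>nn_pairs N. (z a - z b)\<^sup>2)"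

text \<open>Cauchy-Schwarz along a shortest path to the pinned sites. Counting only bonds that start
  no farther out than \<open>x\<close> ensures that the bond from \<open>x\<close> to its successor
  \<open>l\<close> is new in each induction step.\<close>

lemma exit_dist_energy_aux:
  assumes D: "finite D" "D \<subseteq> Defs.box N" and z: "\<And>k. k \<notin> D \<Longrightarrow> z k = 0"
  shows "(z x)\<^sup>2 \<le> real (exit_dist D x) *
    (\<Sum>(a, b)\<in>{(a, b) \<in> nn_pairs N. exit_dist D a \<le> exit_dist D x}. (z a - z b)\<^sup>2)"
proof (induction "exit_dist D x" arbitrary: x rule: less_induct)
  case less
  let ?E = "\<lambda>n. \<Sum>(a, b)\<in>{(a, b) \<in> nn_pairs N. exit_dist D a \<le> n}. (z a - z b)\<^sup>2"
  have fin: "finite {(a, b) \<in> nn_pairs N. exit_dist D a \<le> n}" for n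
    by (rule finite_subset[OF _ finite_nn_pairs[of N]]) auto
  show ?case
  proof (cases "x \<in> D")
    case False
    then show ?thesis using z by (auto intro!: mult_nonneg_nonneg sum_nonneg)
  next
    case True
    obtain l where l: "nn x l" "Suc (exit_dist D l) \<le> exit_dist D x"
      using exit_dist_descent[OF D(1) True] .
    define m where "m = exit_dist D x - 1"
    have m: "exit_dist D x = Suc m" "exit_dist D l \<le> m" using l by (auto simp: m_def)
    have "(z l)\<^sup>2 \<le> real (exit_dist D l) * ?E (exit_dist D l)"
      using less[of l] m by simp
    also have "\<dots> \<le> real m * ?E m"
      using m(2) fin by (intro mult_mono sum_mono2 sum_nonneg) auto
    finally have zl: "(z l)\<^sup>2 \<le> real m * ?E m" .
    have "?E m + (z x - z l)\<^sup>2 = (\<Sum>(a, b)\<in>insert (x, l) {(a, b) \<in> nn_pairs N. exit_dist D a \<le> m}. (z a - z b)\<^sup>2)"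
      using fin[of m] m by (subst sum.insert) auto
    also have "\<dots> \<le> ?E (Suc m)"
    proof (rule sum_mono2[OF fin])
      have "(x, l) \<in> nn_pairs N" using l(1) True D(2) by (auto simp: nn_pairs_def)
      then show "insert (x, l) {(a, b) \<in> nn_pairs N. exit_dist D a \<le> m} \<subseteq> {(a, b) \<in> nn_pairs N. exit_dist D a \<le> Suc m}"
        using m by auto
    qed auto
    finally have E: "?E m + (z x - z l)\<^sup>2 \<le> ?E (Suc m)" .
    \<comment> \<open>In terms of the step \<open>u\<close> and the height \<open>v\<close> at
      \<open>l\<close>, this is
      \<open>(u + v)\<^sup>2 \<le> (1 + m) * (u\<^sup>2 + v\<^sup>2 / m)\<close>; for
      \<open>m = 0\<close> the height at \<open>l\<close> vanishes.\<close>
    have "(z x)\<^sup>2 \<le> real (Suc m) * (?E m + (z x - z l)\<^sup>2)"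
    proof (cases "m = 0")
      case True
      then have "z l = 0" using zl by simp
      then show ?thesis using True by (auto intro!: sum_nonneg)
    next
      case False
      let ?m = "real m" and ?u = "z x - z l" and ?v = "z l"
      have "?v\<^sup>2 / ?m \<le> ?E m" using zl False by (simp add: field_simps)
      moreover have "0 \<le> (?m * ?u - ?v)\<^sup>2 / ?m" by simp
      moreover have "(?m * ?u - ?v)\<^sup>2 / ?m = ?m * ?u\<^sup>2 - 2 * ?u * ?v + ?v\<^sup>2 / ?m"
        using False by (simp add: power2_eq_square field_simps)
      moreover have "(z x)\<^sup>2 = ?u\<^sup>2 + 2 * ?u * ?v + ?v\<^sup>2" by (simp add: power2_eq_square algebra_simps)
      moreover have "?v\<^sup>2 = ?m * (?v\<^sup>2 / ?m)" using False by simp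
      moreover have "?m * (?v\<^sup>2 / ?m) \<le> ?m * ?E m" using \<open>?v\<^sup>2 / ?m \<le> ?E m\<close> by (intro mult_left_mono) auto
      ultimately have "(z x)\<^sup>2 \<le> ?u\<^sup>2 + ?m * ?u\<^sup>2 + ?E m + ?m * ?E m" by linarith
      then show ?thesis by (simp add: algebra_simps)
    qed
    also have "\<dots> \<le> real (Suc m) * ?E (Suc m)" using E by (intro mult_left_mono) auto
    finally show ?thesis using m(1) by simp
  qed
qed

lemma exit_dist_energy:
  assumes "finite D" "D \<subseteq> Defs.box N" "\<And>k. k \<notin> D \<Longrightarrow> z k = 0"
  shows "(z x)\<^sup>2 \<le> real (exit_dist D x) * bond_energy N z"
proof -
  have "(\<Sum>(a, b)\<in>{(a, b) \<in> nn_pairs N. exit_dist D a \<le> exit_dist D x}. (z a - z b)\<^sup>2) \<le> bond_energy N z"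
    unfolding bond_energy_def by (intro sum_mono2 finite_nn_pairs) auto
  then show ?thesis
    using exit_dist_energy_aux[OF assms, where x = x] by (meson mult_left_mono of_nat_0_le_iff order_trans)
qed

section \<open>The energy\<close>

locale pair_potential =
  fixes cV :: real and V :: "real \<Rightarrow> real"
  assumes pot: "interaction_potential cV V"
begin

lemma cV: "1 \<le> cV" "0 < cV"
  using pot by (auto simp: interaction_potential_def)

lemma V_even: "V (- t) = V t"
  using pot by (auto simp: interaction_potential_def)

lemma deriv_V: "(V has_real_derivative deriv V t) (at t)"
  and deriv2_V: "(deriv V has_real_derivative deriv (deriv V) t) (at t)"
proof -
  have "(deriv ^^ n) V differentiable (at t)" for n
    using pot by (simp add: interaction_potential_def smooth_real_def)
  from this[of 0] this[of 1] show "(V has_real_derivative deriv V t) (at t)"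
    "(deriv V has_real_derivative deriv (deriv V) t) (at t)"
    by (simp_all add: DERIV_deriv_iff_real_differentiable)
qed

lemmas deriv_V_chain [derivative_intros] = DERIV_chain2[OF deriv_V]

lemma deriv_V_odd: "deriv V (- t) = - deriv V t"
proof -
  have "((\<lambda>t. V (- t)) has_real_derivative - deriv V (- t)) (at t)"
    by (auto intro!: derivative_eq_intros)
  then have "(V has_real_derivative - deriv V (- t)) (at t)" by (simp add: V_even)
  then show ?thesis using DERIV_unique[OF deriv_V] by fastforce
qed

text \<open>A value of \<open>V''\<close> from the mean value theorem serves as the conductance of a
  bond; only its bounds are kept. The points may come in either order.\<close>

lemma deriv_V_increment:
  obtains c where "1 / cV \<le> c" "c \<le> cV" "deriv V b - deriv V a = c * (b - a)"
proof -
  have *: "\<exists>z. deriv V b - deriv V a = deriv (deriv V) z * (b - a)" if "a < b" for a b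
    using MVT2[OF that, of "deriv V" "deriv (deriv V)"] deriv2_V by (metis mult.commute)
  have "\<exists>z. deriv V b - deriv V a = deriv (deriv V) z * (b - a)"
  proof (cases a b rule: linorder_cases)
    case greater
    then obtain z where "deriv V a - deriv V b = deriv (deriv V) z * (a - b)" using * by blast
    then show ?thesis by (intro exI[of _ z]) (simp add: algebra_simps)
  qed (use * in auto)
  then show thesis using pot that unfolding interaction_potential_def by blast
qed

lemma deriv_V_mono: "a \<le> b \<Longrightarrow> deriv V a \<le> deriv V b"
proof -
  assume "a \<le> b"
  obtain c where "1 / cV \<le> c" "deriv V b - deriv V a = c * (b - a)" using deriv_V_increment .
  moreover have "0 < 1 / cV" using cV by simp
  ultimately have "0 \<le> deriv V b - deriv V a" using \<open>a \<le> b\<close> by (simp del: zero_less_divide_1_iff)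
  then show ?thesis by simp
qed

text \<open>\<open>F\<close> is nondecreasing for \<open>t \<ge> 0\<close> because \<open>V'\<close>
  grows at rate at least \<open>1 / cV\<close>; its values at 0 and at half the distance of
  \<open>a\<close> and \<open>b\<close> are compared.\<close>

lemma V_midpoint: "(a - b)\<^sup>2 / (4 * cV) \<le> V a + V b - 2 * V ((a + b) / 2)"
proof -
  define m where "m = (a + b) / 2"
  define F where "F = (\<lambda>t. V (m + t) + V (m - t) - t\<^sup>2 / cV)"
  have main: "F 0 \<le> F s" if "0 \<le> s" for s
  proof (rule DERIV_nonneg_imp_nondecreasing[OF that])
    fix t :: real assume t: "0 \<le> t"
    obtain c where c: "1 / cV \<le> c" "deriv V (m + t) - deriv V (m - t) = c * (m + t - (m - t))"
      using deriv_V_increment .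
    have "1 / cV * (2 * t) \<le> c * (2 * t)" using c t by (intro mult_right_mono) auto
    moreover have "(F has_real_derivative deriv V (m + t) - deriv V (m - t) - 2 * t / cV) (at t)"
      unfolding F_def using cV by (auto intro!: derivative_eq_intros)
    ultimately show "\<exists>y. (F has_real_derivative y) (at t) \<and> 0 \<le> y" using c by auto
  qed
  have "F 0 \<le> F (\<bar>a - b\<bar> / 2)" by (rule main) simp
  moreover have "V (m + \<bar>a - b\<bar> / 2) + V (m - \<bar>a - b\<bar> / 2) = V a + V b"
    by (cases "a \<le> b") (auto simp: m_def abs_if field_simps)
  ultimately show ?thesis
    by (simp add: F_def m_def power_divide)
qed

lemma measurable_V [measurable]: "V \<in> borel_measurable borel"
  using deriv_V by (intro borel_measurable_continuous_onI) (auto intro: DERIV_continuous_on)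

lemma measurable_hamiltonian [measurable]: "hamiltonian V N \<in> borel_measurable cfg"
  unfolding hamiltonian_def[abs_def] split_beta by measurable

lemma hamiltonian_uminus: "hamiltonian V N (\<lambda>k. - \<phi> k) = hamiltonian V N \<phi>"
proof -
  have "V (- a - - b) = V (a - b)" for a b using V_even[of "a - b"] by simp
  then show ?thesis by (simp add: hamiltonian_def)
qed

lemma hamiltonian_midpoint:
  "hamiltonian V N x + hamiltonian V N y - 2 * hamiltonian V N (\<lambda>k. (x k + y k) / 2) \<ge>
    bond_energy N (\<lambda>k. x k - y k) / (8 * cV)"
proof -
  have "bond_energy N (\<lambda>k. x k - y k) / (8 * cV) =
      1 / 2 * (\<Sum>(i, j)\<in>nn_pairs N. ((x i - y i) - (x j - y j))\<^sup>2 / (4 * cV))"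
    by (simp add: bond_energy_def split_beta sum_divide_distrib[symmetric])
  also have "\<dots> \<le> 1 / 2 * (\<Sum>(i, j)\<in>nn_pairs N. V (x i - x j) + V (y i - y j) - 2 * V ((x i + y i) / 2 - (x j + y j) / 2))"
  proof (intro mult_left_mono sum_mono, clarify)
    fix a b c d :: int
    let ?i = "(a, b)" and ?j = "(c, d)"
    have eq1: "((x ?i - y ?i) - (x ?j - y ?j))\<^sup>2 = ((x ?i - x ?j) - (y ?i - y ?j))\<^sup>2" by (simp add: algebra_simps)
    have eq2: "(x ?i + y ?i) / 2 - (x ?j + y ?j) / 2 = ((x ?i - x ?j) + (y ?i - y ?j)) / 2" by (simp add: field_simps)
    show "((x ?i - y ?i) - (x ?j - y ?j))\<^sup>2 / (4 * cV) \<le>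
        V (x ?i - x ?j) + V (y ?i - y ?j) - 2 * V ((x ?i + y ?i) / 2 - (x ?j + y ?j) / 2)"
      unfolding eq1 eq2 by (rule V_midpoint)
  qed simp
  also have "\<dots> = hamiltonian V N x + hamiltonian V N y - 2 * hamiltonian V N (\<lambda>k. (x k + y k) / 2)"
    by (simp add: hamiltonian_def split_beta sum.distrib sum_subtractf sum_distrib_left algebra_simps)
  finally show ?thesis by simp
qed

text \<open>By evenness \<open>\<phi>\<close> and its negative have the same energy, and their
  midpoint is 0.\<close>

lemma hamiltonian_lower:
  "hamiltonian V N (\<lambda>_. 0) + bond_energy N \<phi> / (4 * cV) \<le> hamiltonian V N \<phi>"
proof -
  have "bond_energy N (\<lambda>k. \<phi> k - - \<phi> k) = 4 * bond_energy N \<phi>"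
  proof -
    have "(\<phi> a - - \<phi> a - (\<phi> b - - \<phi> b))\<^sup>2 = 4 * (\<phi> a - \<phi> b)\<^sup>2" for a b
      by (simp add: power2_eq_square algebra_simps)
    then show ?thesis by (simp add: bond_energy_def sum_distrib_left split_beta)
  qed
  then show ?thesis
    using hamiltonian_midpoint[where x = \<phi> and y = "\<lambda>k. - \<phi> k" and N = N] by (simp add: hamiltonian_uminus)
qed

lemma sum_nn_pairs_antisym:
  assumes "\<And>k l. G l k = - G k l"
  shows "1 / 2 * (\<Sum>(k, l)\<in>nn_pairs N. G k l * (e k - e l :: real)) = (\<Sum>(k, l)\<in>nn_pairs N. G k l * e k)"
proof -
  have "bij_betw prod.swap (nn_pairs N) (nn_pairs N)"
    by (rule bij_betw_byWitness[where f' = prod.swap]) (auto simp: nn_pairs_def intro: nn_sym)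
  then have "(\<Sum>(k, l)\<in>nn_pairs N. G k l * e l) = (\<Sum>p\<in>nn_pairs N. (\<lambda>(k, l). G k l * e l) (prod.swap p))"
    by (rule sum.reindex_bij_betw[symmetric])
  also have "\<dots> = - (\<Sum>(k, l)\<in>nn_pairs N. G k l * e k)"
  proof -
    have "(\<lambda>(k, l). G k l * e l) (prod.swap p) = - (\<lambda>(k, l). G k l * e k) p" for p
      using assms by (cases p) (metis (no_types, lifting) case_prod_conv mult_minus_left swap_simp)
    then show ?thesis by (simp only: sum_negf)
  qed
  finally have "(\<Sum>(k, l)\<in>nn_pairs N. G k l * e l) = - (\<Sum>(k, l)\<in>nn_pairs N. G k l * e k)" .
  then show ?thesis by (simp add: split_beta right_diff_distrib sum_subtractf)
qed

lemma sum_nn_pairs_support: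
  assumes "finite D" "D \<subseteq> Defs.box N" "\<And>k. k \<notin> D \<Longrightarrow> e k = (0 :: real)"
  shows "(\<Sum>(k, l)\<in>nn_pairs N. G k l * e k) = (\<Sum>k\<in>D. e k * (\<Sum>l | nn k l. G k l))"
proof -
  have "(\<Sum>k\<in>D. e k * (\<Sum>l | nn k l. G k l)) = (\<Sum>k\<in>D. \<Sum>l | nn k l. G k l * e k)"
    by (simp add: sum_distrib_left mult.commute)
  also have "\<dots> = (\<Sum>(k, l)\<in>(SIGMA k:D. {l. nn k l}). G k l * e k)"
    using assms(1) by (intro sum.Sigma) auto
  also have "\<dots> = (\<Sum>(k, l)\<in>nn_pairs N. G k l * e k)"
  proof (intro sum.mono_neutral_left finite_nn_pairs)
    have "\<And>k. e k \<noteq> 0 \<Longrightarrow> k \<in> D" using assms(3) by blast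
    then show "\<forall>p\<in>nn_pairs N - (SIGMA k:D. {l. nn k l}). (case p of (k, l) \<Rightarrow> G k l * e k) = 0"
      by (auto simp: nn_pairs_def)
  qed (use assms(2) in \<open>auto simp: nn_pairs_def\<close>)
  finally show ?thesis by simp
qed

text \<open>Holley's condition for the shifted field against the tilted one. It only needs \<open>s\<close> to be a
  supersolution for every choice of conductances in the ellipticity range.\<close>

lemma hamiltonian_holley:
  assumes D: "finite D" "D \<subseteq> Defs.box N"
    and s: "\<And>k. k \<notin> D \<Longrightarrow> s k = 0"
    and super: "\<And>k c. k \<in> D \<Longrightarrow> (\<And>l. 1 / cV \<le> c l \<and> c l \<le> cV) \<Longrightarrow>
      (if k = j then h else 0) \<le> (\<Sum>l | nn k l. c l * (s k - s l))"
    and x: "\<And>k. k \<notin> D \<Longrightarrow> x k = 0" and y: "\<And>k. k \<notin> D \<Longrightarrow> y k = 0"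
  shows "hamiltonian V N (\<lambda>k. max (x k) (y k) - s k) + (hamiltonian V N (\<lambda>k. min (x k) (y k)) - h * min (x j) (y j))
    \<le> (hamiltonian V N x - h * x j) + hamiltonian V N (\<lambda>k. y k - s k)"
proof -
  \<comment> \<open>With \<open>e\<close> the positive part of \<open>x - y\<close>, one has
    \<open>x = min x y + e\<close> and \<open>max x y = y + e\<close>. Adding \<open>t * e\<close>
    moves both configurations at once, and the claim becomes \<open>F 0 \<le> F 1\<close>.\<close>
  define e where "e k = x k - min (x k) (y k)" for k
  have e: "\<And>k. k \<notin> D \<Longrightarrow> e k = 0" "\<And>k. 0 \<le> e k" "\<And>k. e k \<noteq> 0 \<Longrightarrow> min (x k) (y k) = y k"
    using x y by (auto simp: e_def min_def)
  define g1 where "g1 t k l = min (x k) (y k) - min (x l) (y l) + t * (e k - e l)" for t k l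
  define g2 where "g2 t k l = (y k - s k) - (y l - s l) + t * (e k - e l)" for t k l
  define F where "F t = 1 / 2 * (\<Sum>(k, l)\<in>nn_pairs N. V (g1 t k l) - V (g2 t k l)) - h * (t * e j)" for t
  have "F 0 \<le> F 1"
  proof (rule DERIV_nonneg_imp_nondecreasing[where f = F])
    fix t :: real
    let ?G = "\<lambda>k l. deriv V (g1 t k l) - deriv V (g2 t k l)"
    have "(F has_real_derivative 1 / 2 * (\<Sum>(k, l)\<in>nn_pairs N. ?G k l * (e k - e l)) - h * e j) (at t)"
      unfolding F_def g1_def g2_def split_beta
      by (auto intro!: derivative_eq_intros sum.cong simp: algebra_simps)
    moreover have "h * e j \<le> 1 / 2 * (\<Sum>(k, l)\<in>nn_pairs N. ?G k l * (e k - e l))"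
    proof -
      have anti: "?G l k = - ?G k l" for k l
        using deriv_V_odd[of "g1 t k l"] deriv_V_odd[of "g2 t k l"] by (simp add: g1_def g2_def algebra_simps)
      have *: "(if k = j then h else 0) * e k \<le> e k * (\<Sum>l | nn k l. ?G k l)" if k: "k \<in> D" for k
      proof (cases "e k = 0")
        case False
        \<comment> \<open>Where \<open>e k\<close> is nonzero the minimum at \<open>k\<close> is
          \<open>y k\<close>, while at \<open>l\<close> it is at most \<open>y l\<close>. So the
          gradient \<open>g1\<close> exceeds \<open>g2\<close> by at least
          \<open>s k - s l\<close>.\<close>
        have "\<exists>c. 1 / cV \<le> c \<and> c \<le> cV \<and> c * (s k - s l) \<le> ?G k l" for l
        proof -
          obtain c where c: "1 / cV \<le> c" "c \<le> cV"
            "deriv V (g2 t k l + (s k - s l)) - deriv V (g2 t k l) = c * (g2 t k l + (s k - s l) - g2 t k l)"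
            using deriv_V_increment .
          have "g2 t k l + (s k - s l) \<le> g1 t k l"
            using e(3)[OF False] by (simp add: g1_def g2_def)
          then have "deriv V (g2 t k l + (s k - s l)) \<le> deriv V (g1 t k l)" by (rule deriv_V_mono)
          then show ?thesis using c by auto
        qed
        then obtain c where c: "\<And>l. 1 / cV \<le> c l \<and> c l \<le> cV" "\<And>l. c l * (s k - s l) \<le> ?G k l" by metis
        have "(if k = j then h else 0) \<le> (\<Sum>l | nn k l. c l * (s k - s l))" using super[OF k c(1)] .
        also have "\<dots> \<le> (\<Sum>l | nn k l. ?G k l)" using c(2) by (intro sum_mono)
        finally show ?thesis using e(2)[of k] by (simp add: mult.commute mult_left_mono)
      qed simp
      have "h * e j = (\<Sum>k\<in>D. (if k = j then h else 0) * e k)"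
        using D(1) e(1)[of j] by (auto simp: if_distrib[where f = "\<lambda>c. c * _"] sum.delta cong: if_cong)
      also have "\<dots> \<le> (\<Sum>k\<in>D. e k * (\<Sum>l | nn k l. ?G k l))" using * by (intro sum_mono)
      also have "\<dots> = (\<Sum>(k, l)\<in>nn_pairs N. ?G k l * e k)"
        using sum_nn_pairs_support[where G = ?G and e = e] D e(1) by simp
      also have "\<dots> = 1 / 2 * (\<Sum>(k, l)\<in>nn_pairs N. ?G k l * (e k - e l))"
        using sum_nn_pairs_antisym[of ?G, OF anti] by simp
      finally show ?thesis .
    qed
    ultimately show "\<exists>d. (F has_real_derivative d) (at t) \<and> 0 \<le> d" by force
  qed simp
  moreover have "F 0 = hamiltonian V N (\<lambda>k. min (x k) (y k)) - hamiltonian V N (\<lambda>k. y k - s k)"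
    by (simp add: F_def g1_def g2_def hamiltonian_def split_beta sum_subtractf algebra_simps)
  moreover have "F 1 = hamiltonian V N x - hamiltonian V N (\<lambda>k. max (x k) (y k) - s k) - h * e j"
  proof -
    have "g1 1 k l = x k - x l" for k l by (simp add: g1_def e_def)
    moreover have "g2 1 k l = max (x k) (y k) - s k - (max (x l) (y l) - s l)" for k l
      by (auto simp: g2_def e_def max_def min_def)
    ultimately show ?thesis
      by (simp add: F_def hamiltonian_def split_beta sum_subtractf right_diff_distrib)
  qed
  ultimately show ?thesis by (simp add: e_def algebra_simps)
qed

end

section \<open>Fields with fixed unpinned sites\<close>

lemma nn_integral_vol_prod:
  fixes q :: "real \<Rightarrow> ennreal"
  assumes "finite D" and q [measurable]: "q \<in> borel_measurable borel"
  shows "(\<integral>\<^sup>+\<phi>. (\<Prod>x\<in>D. q (\<phi> x)) \<partial>vol D) = (\<integral>\<^sup>+t. q t \<partial>lborel) ^ card D"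
  using assms(1)
proof (induction D rule: finite_induct)
  case empty
  show ?case using vol_empty[of "\<lambda>_. 1"] by simp
next
  case (insert k D)
  have "(\<integral>\<^sup>+\<phi>. (\<Prod>x\<in>insert k D. q (\<phi> x)) \<partial>vol (insert k D)) =
      (\<integral>\<^sup>+\<phi>. (\<integral>\<^sup>+t. (\<Prod>x\<in>insert k D. q ((\<phi>(k := t)) x)) \<partial>lborel) \<partial>vol D)"
    using insert.hyps by (intro vol_insert') auto
  also have "\<dots> = (\<integral>\<^sup>+\<phi>. (\<integral>\<^sup>+t. q t * (\<Prod>x\<in>D. q (\<phi> x)) \<partial>lborel) \<partial>vol D)"
  proof (intro nn_integral_cong)
    fix \<phi> :: "'a \<Rightarrow> real" and t
    have "(\<Prod>x\<in>D. q ((\<phi>(k := t)) x)) = (\<Prod>x\<in>D. q (\<phi> x))"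
      using insert.hyps by (intro prod.cong) auto
    then show "(\<Prod>x\<in>insert k D. q ((\<phi>(k := t)) x)) = q t * (\<Prod>x\<in>D. q (\<phi> x))"
      using insert.hyps by simp
  qed
  also have "\<dots> = (\<integral>\<^sup>+t. q t \<partial>lborel) ^ card (insert k D)"
    using insert by (simp add: nn_integral_multc nn_integral_cmult)
  finally show ?case .
qed

lemma nn_integral_gaussian:
  assumes "0 < a"
  shows "(\<integral>\<^sup>+t. ennreal (exp (- (a * t\<^sup>2))) \<partial>lborel) = ennreal (sqrt (pi / a))"
proof -
  define \<sigma> where "\<sigma> = sqrt (1 / (2 * a))"
  have \<sigma>: "0 < \<sigma>" "\<sigma>\<^sup>2 = 1 / (2 * a)" using assms by (auto simp: \<sigma>_def)
  have "normal_density 0 \<sigma> t = 1 / sqrt (pi / a) * exp (- (a * t\<^sup>2))" for t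
    unfolding normal_density_def \<sigma>(2) using assms by simp
  then have "exp (- (a * t\<^sup>2)) = sqrt (pi / a) * normal_density 0 \<sigma> t" for t
    using assms by simp
  then have "(\<integral>\<^sup>+t. ennreal (exp (- (a * t\<^sup>2))) \<partial>lborel) =
      (\<integral>\<^sup>+t. ennreal (sqrt (pi / a)) * ennreal (normal_density 0 \<sigma> t) \<partial>lborel)"
    using assms by (simp add: ennreal_mult'')
  also have "\<dots> = ennreal (sqrt (pi / a)) * (\<integral>\<^sup>+t. ennreal (normal_density 0 \<sigma> t) \<partial>lborel)"
    by (intro nn_integral_cmult) simp
  also have "(\<integral>\<^sup>+t. ennreal (normal_density 0 \<sigma> t) \<partial>lborel) = ennreal (\<integral>t. normal_density 0 \<sigma> t \<partial>lborel)"
    using \<sigma> by (intro nn_integral_eq_integral integrable_normal_density) auto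
  finally show ?thesis using \<sigma> by (simp add: integral_normal_density)
qed

lemma ennreal_le_of_square_le:
  fixes x y :: ennreal
  assumes "x * x \<le> y * y"
  shows "x \<le> y"
proof (cases x; cases y)
  fix a b assume "x = ennreal a" "0 \<le> a" "y = ennreal b" "0 \<le> b"
  then show ?thesis
    using assms by (auto simp: ennreal_mult[symmetric] power2_eq_square intro: power2_le_imp_le)
qed (use assms in \<open>auto simp: top_unique ennreal_mult[symmetric] ennreal_mult_eq_top_iff\<close>)

context pair_potential
begin

abbreviation weight :: "nat \<Rightarrow> config \<Rightarrow> ennreal" where
  "weight N \<phi> \<equiv> ennreal (exp (- hamiltonian V N \<phi>))"

text \<open>Left unnormalised: the total masses for different \<open>D\<close> are themselves the
  weights of the mixture.\<close>

definition gibbs :: "nat \<Rightarrow> site set \<Rightarrow> config measure" where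
  "gibbs N D = density (vol D) (weight N)"

lemma space_gibbs [simp]: "space (gibbs N D) = UNIV"
  and sets_gibbs [simp, measurable_cong]: "sets (gibbs N D) = sets cfg"
  by (simp_all add: gibbs_def)

lemma nn_integral_gibbs:
  "f \<in> borel_measurable cfg \<Longrightarrow> (\<integral>\<^sup>+\<phi>. f \<phi> \<partial>gibbs N D) = (\<integral>\<^sup>+\<phi>. weight N \<phi> * f \<phi> \<partial>vol D)"
  unfolding gibbs_def by (intro nn_integral_density) auto

definition partition_sum :: "nat \<Rightarrow> site set \<Rightarrow> ennreal" where
  "partition_sum N D = (\<integral>\<^sup>+\<phi>. weight N \<phi> \<partial>vol D)"

lemma emeasure_gibbs: "emeasure (gibbs N D) UNIV = partition_sum N D"
  using nn_integral_gibbs[of "\<lambda>_. 1" N D] by (simp add: partition_sum_def)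

lemma AE_gibbs_support:
  assumes "finite D" "k \<notin> D"
  shows "AE \<phi> in gibbs N D. \<phi> k = 0"
  unfolding gibbs_def using AE_vol_support[OF assms] by (subst AE_density) auto

text \<open>The quadratic lower bound on the energy gives Gaussian tails. The exponent 3 serves
  \<open>integrable_gibbs\<close>, where \<open>i\<close> and \<open>j\<close> may coincide.\<close>

lemma nn_integral_exp_gibbs_finite:
  assumes D: "finite D" "D \<subseteq> Defs.box N"
  shows "(\<integral>\<^sup>+\<phi>. ennreal (exp (3 * (\<Sum>x\<in>D. \<bar>\<phi> x\<bar>))) \<partial>gibbs N D) < \<infinity>"
proof -
  \<comment> \<open>The added ones keep \<open>M\<close> and \<open>K\<close> positive for empty
    \<open>D\<close>.\<close>
  define M where "M = 1 + (\<Sum>x\<in>D. real (exit_dist D x))"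
  have M: "real (exit_dist D x) \<le> M" "0 < M" if "x \<in> D" for x
    using member_le_sum[OF that, of "\<lambda>x. real (exit_dist D x)"] D(1)
    by (auto simp: M_def add_pos_nonneg sum_nonneg)
  have "0 < M" by (auto simp: M_def add_pos_nonneg sum_nonneg)
  define K where "K = 4 * cV * (real (card D) + 1) * M"
  have K: "0 < K" using \<open>0 < M\<close> cV by (simp add: K_def)
  \<comment> \<open>Half of the quadratic decay \<open>1 / K\<close> absorbs the linear exponent,
    the other half remains for integrability.\<close>
  define a where "a = 1 / (2 * K)"
  have a: "0 < a" using K by (simp add: a_def)
  define C where "C = - hamiltonian V N (\<lambda>_. 0) + real (card D) * (9 * K / 2)"
  have bound: "3 * (\<Sum>x\<in>D. \<bar>\<phi> x\<bar>) - hamiltonian V N \<phi> \<le> C - (\<Sum>x\<in>D. a * (\<phi> x)\<^sup>2)"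
    if \<phi>: "\<And>k. k \<notin> D \<Longrightarrow> \<phi> k = 0" for \<phi>
  proof -
    have be: "0 \<le> bond_energy N \<phi>" by (auto simp: bond_energy_def intro: sum_nonneg)
    have "(\<Sum>x\<in>D. (\<phi> x)\<^sup>2) \<le> (\<Sum>x\<in>D. M * bond_energy N \<phi>)"
    proof (intro sum_mono)
      fix x assume "x \<in> D"
      have "(\<phi> x)\<^sup>2 \<le> real (exit_dist D x) * bond_energy N \<phi>" by (rule exit_dist_energy[OF D \<phi>])
      also have "\<dots> \<le> M * bond_energy N \<phi>" using M(1)[OF \<open>x \<in> D\<close>] be by (intro mult_right_mono)
      finally show "(\<phi> x)\<^sup>2 \<le> M * bond_energy N \<phi>" .
    qed
    also have "\<dots> \<le> (real (card D) + 1) * (M * bond_energy N \<phi>)"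
      using be \<open>0 < M\<close> by (simp add: algebra_simps)
    also have "\<dots> = bond_energy N \<phi> / (4 * cV) * K" using cV by (simp add: K_def)
    finally have "(\<Sum>x\<in>D. (\<phi> x)\<^sup>2) / K \<le> bond_energy N \<phi> / (4 * cV)"
      by (simp only: pos_divide_le_eq[OF K])
    then have 1: "(\<Sum>x\<in>D. (\<phi> x)\<^sup>2) / K \<le> hamiltonian V N \<phi> - hamiltonian V N (\<lambda>_. 0)"
      using hamiltonian_lower[of N \<phi>] by simp
    have "3 * \<bar>t\<bar> \<le> 9 * K / 2 + a * t\<^sup>2" for t
    proof -
      have "0 \<le> (\<bar>t\<bar> / K - 3)\<^sup>2 * (K / 2)" using K by simp
      also have "\<dots> = a * t\<^sup>2 + 9 * K / 2 - 3 * \<bar>t\<bar>"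
        using K by (simp add: a_def power2_eq_square field_simps)
      finally show ?thesis by simp
    qed
    then have "(\<Sum>x\<in>D. 3 * \<bar>\<phi> x\<bar>) \<le> (\<Sum>x\<in>D. 9 * K / 2 + a * (\<phi> x)\<^sup>2)" by (intro sum_mono)
    then have 2: "3 * (\<Sum>x\<in>D. \<bar>\<phi> x\<bar>) \<le> real (card D) * (9 * K / 2) + (\<Sum>x\<in>D. a * (\<phi> x)\<^sup>2)"
      by (simp add: sum_distrib_left sum.distrib)
    have "2 * (\<Sum>x\<in>D. a * (\<phi> x)\<^sup>2) = (\<Sum>x\<in>D. (\<phi> x)\<^sup>2) / K"
      using K by (simp add: a_def sum_distrib_left[symmetric] sum_divide_distrib[symmetric])
    then show ?thesis using 1 2 by (simp add: C_def)
  qed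
  have supp: "AE \<phi> in vol D. \<forall>k. k \<notin> D \<longrightarrow> \<phi> k = 0"
    unfolding AE_all_countable using AE_vol_support[OF D(1)] by auto
  have "(\<integral>\<^sup>+\<phi>. ennreal (exp (3 * (\<Sum>x\<in>D. \<bar>\<phi> x\<bar>))) \<partial>gibbs N D) =
      (\<integral>\<^sup>+\<phi>. weight N \<phi> * ennreal (exp (3 * (\<Sum>x\<in>D. \<bar>\<phi> x\<bar>))) \<partial>vol D)"
    by (intro nn_integral_gibbs) measurable
  also have "\<dots> \<le> (\<integral>\<^sup>+\<phi>. ennreal (exp C) * (\<Prod>x\<in>D. ennreal (exp (- (a * (\<phi> x)\<^sup>2)))) \<partial>vol D)"
    using supp
  proof (intro nn_integral_mono_AE, eventually_elim)
    fix \<phi> :: config assume "\<forall>k. k \<notin> D \<longrightarrow> \<phi> k = 0"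
    then have "3 * (\<Sum>x\<in>D. \<bar>\<phi> x\<bar>) - hamiltonian V N \<phi> \<le> C - (\<Sum>x\<in>D. a * (\<phi> x)\<^sup>2)"
      by (intro bound) auto
    then have "exp (- hamiltonian V N \<phi>) * exp (3 * (\<Sum>x\<in>D. \<bar>\<phi> x\<bar>)) \<le> exp C * exp (- (\<Sum>x\<in>D. a * (\<phi> x)\<^sup>2))"
      by (simp flip: exp_add)
    also have "exp (- (\<Sum>x\<in>D. a * (\<phi> x)\<^sup>2)) = (\<Prod>x\<in>D. exp (- (a * (\<phi> x)\<^sup>2)))"
      using D(1) by (simp add: exp_sum flip: sum_negf)
    finally show "weight N \<phi> * ennreal (exp (3 * (\<Sum>x\<in>D. \<bar>\<phi> x\<bar>))) \<le>
        ennreal (exp C) * (\<Prod>x\<in>D. ennreal (exp (- (a * (\<phi> x)\<^sup>2))))"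
      by (simp add: prod_ennreal ennreal_mult[symmetric] prod_nonneg ennreal_leI)
  qed
  also have "\<dots> = ennreal (exp C) * (\<integral>\<^sup>+\<phi>. (\<Prod>x\<in>D. ennreal (exp (- (a * (\<phi> x)\<^sup>2)))) \<partial>vol D)"
    by (intro nn_integral_cmult) measurable
  also have "(\<integral>\<^sup>+\<phi>. (\<Prod>x\<in>D. ennreal (exp (- (a * (\<phi> x)\<^sup>2)))) \<partial>vol D) = ennreal (sqrt (pi / a)) ^ card D"
    using nn_integral_vol_prod[OF D(1), of "\<lambda>t. ennreal (exp (- (a * t\<^sup>2)))"] nn_integral_gaussian[OF a] by simp
  also have "ennreal (exp C) * ennreal (sqrt (pi / a)) ^ card D < \<infinity>"
    using a by (simp add: ennreal_power ennreal_mult[symmetric])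
  finally show ?thesis .
qed

text \<open>\<open>G\<close> is the unnormalised density of the height at \<open>s\<close>. It is
  even, so Prekopa-Leindler at the heights \<open>t\<close> and \<open>- t\<close>, with the strict
  convexity of the energy, puts a Gaussian times \<open>G 0\<close> above it. \<open>G 0\<close> is
  the partition sum with \<open>s\<close> pinned.\<close>

lemma partition_sum_remove:
  assumes D: "finite D" "D \<subseteq> Defs.box N" and s: "s \<in> D" and R: "exit_dist D s \<le> R"
  shows "partition_sum N D \<le> ennreal (sqrt (4 * pi * cV * real R)) * partition_sum N (D - {s})"
proof -
  define E where "E = D - {s}"
  have E: "finite E" "s \<notin> E" "D = insert s E" using D s by (auto simp: E_def)
  have R0: "0 < R" using exit_dist_pos[OF D(1) s] R by simp
  \<comment> \<open>The two configurations differ by \<open>2 * t\<close> at \<open>s\<close>, so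
    their difference has bond energy at least \<open>4 * t\<^sup>2 / R\<close>. Divided by
    \<open>8 * cV\<close> this is twice \<open>\<beta> * t\<^sup>2\<close>, one for each factor of
    \<open>?h\<close>.\<close>
  define \<beta> where "\<beta> = 1 / (4 * cV * real R)"
  have \<beta>: "0 < \<beta>" using cV R0 by (simp add: \<beta>_def)
  define G where "G t = (\<integral>\<^sup>+\<phi>. weight N (\<phi>(s := t)) \<partial>vol E)" for t
  have wm: "(\<lambda>\<phi>. weight N (\<phi>(s := t))) \<in> borel_measurable cfg" for t by measurable
  have G_sym: "G (- t) = G t" for t
  proof -
    have "G (- t) = (\<integral>\<^sup>+\<phi>. weight N (\<lambda>k. - (\<phi>(s := t)) k) \<partial>vol E)"
      unfolding G_def using vol_uminus[OF E(1) wm[of "- t"]]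
      by (simp add: fun_upd_def if_distrib cong: if_cong)
    then show ?thesis unfolding G_def hamiltonian_uminus .
  qed
  have G_le: "G t \<le> ennreal (exp (- (\<beta> * t\<^sup>2))) * G 0" for t
  proof -
    let ?h = "\<lambda>\<phi>. ennreal (exp (- (\<beta> * t\<^sup>2))) * weight N (\<phi>(s := 0))"
    have "G t * G (- t) \<le> (\<integral>\<^sup>+\<phi>. ?h \<phi> \<partial>vol E) * (\<integral>\<^sup>+\<phi>. ?h \<phi> \<partial>vol E)"
      unfolding G_def
    proof (rule prekopa_leindler_vol[OF E(1) wm wm])
      show "?h \<in> borel_measurable cfg" by measurable
      fix x y :: config
      assume x: "\<And>k. k \<notin> E \<Longrightarrow> x k = 0" and y: "\<And>k. k \<notin> E \<Longrightarrow> y k = 0"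
      let ?x = "x(s := t)" and ?y = "y(s := - t)" and ?m = "(\<lambda>k. (x k + y k) / 2)(s := 0)"
      have m: "(\<lambda>k. (?x k + ?y k) / 2) = ?m" by auto
      have "((\<lambda>k. ?x k - ?y k) s)\<^sup>2 \<le> real (exit_dist D s) * bond_energy N (\<lambda>k. ?x k - ?y k)"
        using x y E(3) by (intro exit_dist_energy[OF D]) auto
      also have "\<dots> \<le> real R * bond_energy N (\<lambda>k. ?x k - ?y k)"
        using R by (intro mult_right_mono) (auto simp: bond_energy_def intro: sum_nonneg)
      finally have "4 * t\<^sup>2 \<le> real R * bond_energy N (\<lambda>k. ?x k - ?y k)"
        by (simp add: power2_eq_square algebra_simps)
      then have "2 * (\<beta> * t\<^sup>2) \<le> bond_energy N (\<lambda>k. ?x k - ?y k) / (8 * cV)"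
        using cV R0 by (simp add: \<beta>_def field_simps)
      also have "\<dots> \<le> hamiltonian V N ?x + hamiltonian V N ?y - 2 * hamiltonian V N ?m"
        using hamiltonian_midpoint[where x = ?x and y = ?y and N = N] unfolding m .
      finally have "exp (- hamiltonian V N ?x + - hamiltonian V N ?y) \<le>
          exp (- (\<beta> * t\<^sup>2) + - hamiltonian V N ?m + (- (\<beta> * t\<^sup>2) + - hamiltonian V N ?m))"
        by simp
      then show "weight N ?x * weight N ?y \<le> ?h (\<lambda>k. (x k + y k) / 2) * ?h (\<lambda>k. (x k + y k) / 2)"
        by (simp add: ennreal_mult[symmetric] exp_add[symmetric] ennreal_leI)
    qed
    also have "(\<integral>\<^sup>+\<phi>. ?h \<phi> \<partial>vol E) = ennreal (exp (- (\<beta> * t\<^sup>2))) * G 0"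
      unfolding G_def by (intro nn_integral_cmult) measurable
    finally show ?thesis unfolding G_sym by (rule ennreal_le_of_square_le)
  qed
  have "partition_sum N D = (\<integral>\<^sup>+t. G t \<partial>lborel)"
    unfolding partition_sum_def E(3) G_def by (rule vol_insert[OF E(1,2)]) measurable
  also have "\<dots> \<le> (\<integral>\<^sup>+t. ennreal (exp (- (\<beta> * t\<^sup>2))) * G 0 \<partial>lborel)"
    by (intro nn_integral_mono G_le)
  also have "\<dots> = ennreal (sqrt (pi / \<beta>)) * G 0"
    using nn_integral_gaussian[OF \<beta>] by (simp add: nn_integral_multc)
  also have "G 0 = partition_sum N E"
    unfolding G_def partition_sum_def by (rule nn_integral_vol_update_zero[OF E(1,2)]) measurable
  also have "pi / \<beta> = 4 * pi * cV * real R" using cV R0 by (simp add: \<beta>_def)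
  finally show ?thesis by (simp add: E_def)
qed

end

section \<open>Comparison of the tilted field with a shifted one\<close>

lemma le_exp_self: "t \<le> exp (t :: real)"
  using exp_ge_add_one_self[of t] by linarith

lemma abs_exp_minus_one_le: "\<bar>exp x - 1\<bar> \<le> \<bar>x\<bar> * exp \<bar>x :: real\<bar>"
proof (cases "0 \<le> x")
  case True
  have "(1 - x) * exp x \<le> exp (- x) * exp x"
    using exp_ge_add_one_self[of "- x"] by (intro mult_right_mono) auto
  then have "exp x - 1 \<le> x * exp x" by (simp add: algebra_simps flip: exp_add)
  then show ?thesis using True by simp
next
  case False
  have "1 - exp x \<le> - x" using exp_ge_add_one_self[of x] by linarith
  also have "\<dots> \<le> - x * exp (- x)" using False by simp
  finally show ?thesis using False by simp
qed

context pair_potential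
begin

text \<open>The growth bound is made for \<open>\<phi> i\<close> times a difference quotient of
  \<open>exp (h * \<phi> j)\<close> in \<open>h\<close>, with \<open>h \<le> 1\<close>.\<close>

lemma integrable_gibbs:
  assumes D: "finite D" "D \<subseteq> Defs.box N" and ij: "i \<in> D" "j \<in> D"
    and f: "f \<in> borel_measurable cfg" "\<And>\<phi>. \<bar>f \<phi>\<bar> \<le> C * exp (\<bar>\<phi> i\<bar> + 2 * \<bar>\<phi> j\<bar>)"
  shows "integrable (gibbs N D) f"
proof (rule integrableI_bounded)
  show "f \<in> borel_measurable (gibbs N D)" using f(1) by simp
  have "(\<integral>\<^sup>+\<phi>. ennreal (norm (f \<phi>)) \<partial>gibbs N D) \<le>
      (\<integral>\<^sup>+\<phi>. ennreal \<bar>C\<bar> * ennreal (exp (3 * (\<Sum>x\<in>D. \<bar>\<phi> x\<bar>))) \<partial>gibbs N D)"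
  proof (intro nn_integral_mono)
    fix \<phi> :: config
    have "\<bar>\<phi> k\<bar> \<le> (\<Sum>x\<in>D. \<bar>\<phi> x\<bar>)" if "k \<in> D" for k
      using that D(1) by (intro member_le_sum) auto
    from this[OF ij(1)] this[OF ij(2)]
    have "\<bar>f \<phi>\<bar> \<le> \<bar>C\<bar> * exp (3 * (\<Sum>x\<in>D. \<bar>\<phi> x\<bar>))"
      by (intro order_trans[OF f(2)] mult_mono) auto
    then show "ennreal (norm (f \<phi>)) \<le> ennreal \<bar>C\<bar> * ennreal (exp (3 * (\<Sum>x\<in>D. \<bar>\<phi> x\<bar>)))"
      by (simp add: ennreal_mult[symmetric] ennreal_leI)
  qed
  also have "\<dots> = ennreal \<bar>C\<bar> * (\<integral>\<^sup>+\<phi>. ennreal (exp (3 * (\<Sum>x\<in>D. \<bar>\<phi> x\<bar>))) \<partial>gibbs N D)"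
    by (intro nn_integral_cmult) measurable
  also have "\<dots> < \<infinity>"
    using nn_integral_exp_gibbs_finite[OF D] by (simp add: ennreal_mult_less_top)
  finally show "(\<integral>\<^sup>+\<phi>. ennreal (norm (f \<phi>)) \<partial>gibbs N D) < \<infinity>" .
qed

lemma integrable_gibbs_coordinate:
  assumes "finite D" "D \<subseteq> Defs.box N" "i \<in> D"
  shows "integrable (gibbs N D) (\<lambda>\<phi>. \<phi> i)"
proof (rule integrable_gibbs[OF assms assms(3), where C = 1])
  show "\<bar>\<phi> i\<bar> \<le> 1 * exp (\<bar>\<phi> i\<bar> + 2 * \<bar>\<phi> i\<bar>)" for \<phi> :: config
    using le_exp_self[of "\<bar>\<phi> i\<bar>"] by (auto intro: order_trans)
qed simp

lemma finite_measure_gibbs: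
  assumes "finite D" "D \<subseteq> Defs.box N"
  shows "finite_measure (gibbs N D)"
proof
  have "emeasure (gibbs N D) UNIV = (\<integral>\<^sup>+\<phi>. 1 \<partial>gibbs N D)" by simp
  also have "\<dots> \<le> (\<integral>\<^sup>+\<phi>. ennreal (exp (3 * (\<Sum>x\<in>D. \<bar>\<phi> x\<bar>))) \<partial>gibbs N D)"
    by (intro nn_integral_mono) (auto intro!: sum_nonneg simp flip: ennreal_1)
  also have "\<dots> < \<infinity>" by (rule nn_integral_exp_gibbs_finite[OF assms])
  finally show "emeasure (gibbs N D) (space (gibbs N D)) \<noteq> \<infinity>" by simp
qed

lemma integral_gibbs_uminus:
  fixes f :: "config \<Rightarrow> real"
  assumes "finite D" and f: "f \<in> borel_measurable cfg"
  shows "(\<integral>\<phi>. f (\<lambda>k. - \<phi> k) \<partial>gibbs N D) = (\<integral>\<phi>. f \<phi> \<partial>gibbs N D)"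
proof -
  have m: "(\<lambda>\<phi> :: config. (\<lambda>k. - \<phi> k)) \<in> cfg \<rightarrow>\<^sub>M cfg" by (rule measurable_cfgI) simp
  have "distr (gibbs N D) cfg (\<lambda>\<phi>. (\<lambda>k. - \<phi> k)) = gibbs N D"
  proof (rule measure_eqI)
    fix A assume "A \<in> sets (distr (gibbs N D) cfg (\<lambda>\<phi>. (\<lambda>k. - \<phi> k)))"
    then have A: "A \<in> sets cfg" by simp
    have "emeasure (distr (gibbs N D) cfg (\<lambda>\<phi>. (\<lambda>k. - \<phi> k))) A =
        (\<integral>\<^sup>+\<phi>. indicator A \<phi> \<partial>distr (gibbs N D) cfg (\<lambda>\<phi>. (\<lambda>k. - \<phi> k)))"
      using A by simp
    also have "\<dots> = (\<integral>\<^sup>+\<phi>. indicator A (\<lambda>k. - \<phi> k) \<partial>gibbs N D)"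
      using A m by (intro nn_integral_distr) (auto simp: measurable_cong_sets[OF sets_gibbs refl])
    also have "\<dots> = (\<integral>\<^sup>+\<phi>. weight N \<phi> * indicator A (\<lambda>k. - \<phi> k) \<partial>vol D)"
      using A by (intro nn_integral_gibbs measurable_compose[OF m]) simp
    also have "\<dots> = (\<integral>\<^sup>+\<phi>. weight N (\<lambda>k. - \<phi> k) * indicator A (\<lambda>k. - \<phi> k) \<partial>vol D)"
      by (simp add: hamiltonian_uminus)
    also have "\<dots> = (\<integral>\<^sup>+\<phi>. weight N \<phi> * indicator A \<phi> \<partial>vol D)"
      using A by (intro vol_uminus[OF assms(1), of "\<lambda>\<phi>. weight N \<phi> * indicator A \<phi>"]) simp
    also have "\<dots> = emeasure (gibbs N D) A"
      using A nn_integral_gibbs[of "indicator A" N D] by simp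
    finally show "emeasure (distr (gibbs N D) cfg (\<lambda>\<phi>. (\<lambda>k. - \<phi> k))) A = emeasure (gibbs N D) A" .
  qed simp
  moreover have "(\<integral>\<phi>. f \<phi> \<partial>distr (gibbs N D) cfg (\<lambda>\<phi>. (\<lambda>k. - \<phi> k))) = (\<integral>\<phi>. f (\<lambda>k. - \<phi> k) \<partial>gibbs N D)"
    using f m by (intro integral_distr) (auto simp: measurable_cong_sets[OF sets_gibbs refl])
  ultimately show ?thesis by simp
qed

lemma integral_gibbs_coordinate:
  assumes "finite D"
  shows "(\<integral>\<phi>. \<phi> i \<partial>gibbs N D) = 0"
  using integral_gibbs_uminus[OF assms, of "\<lambda>\<phi>. \<phi> i" N] by simp

text \<open>Translation invariance of \<open>vol\<close> moves the shift by \<open>s\<close> from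
  the test functions to the weight, so that tilted and shifted field both have densities and
  \<open>hamiltonian_holley\<close> is the lattice condition. Four test functions are kept so that
  increasing and decreasing observables can both be inserted.\<close>

lemma gibbs_holley:
  fixes g1 g2 g3 g4 :: "config \<Rightarrow> ennreal"
  assumes D: "finite D" "D \<subseteq> Defs.box N"
    and s: "\<And>k. k \<notin> D \<Longrightarrow> s k = 0"
    and super: "\<And>k c. k \<in> D \<Longrightarrow> (\<And>l. 1 / cV \<le> c l \<and> c l \<le> cV) \<Longrightarrow>
      (if k = j then h else 0) \<le> (\<Sum>l | nn k l. c l * (s k - s l))"
    and g: "g1 \<in> borel_measurable cfg" "g2 \<in> borel_measurable cfg"
      "g3 \<in> borel_measurable cfg" "g4 \<in> borel_measurable cfg"
    and le: "\<And>x y. g1 x * g2 y \<le> g3 (\<lambda>k. max (x k) (y k)) * g4 (\<lambda>k. min (x k) (y k))"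
  shows "(\<integral>\<^sup>+\<phi>. g1 \<phi> * ennreal (exp (h * \<phi> j)) \<partial>gibbs N D) * (\<integral>\<^sup>+\<phi>. g2 (\<lambda>k. \<phi> k + s k) \<partial>gibbs N D)
    \<le> (\<integral>\<^sup>+\<phi>. g3 (\<lambda>k. \<phi> k + s k) \<partial>gibbs N D) * (\<integral>\<^sup>+\<phi>. g4 \<phi> * ennreal (exp (h * \<phi> j)) \<partial>gibbs N D)"
proof -
  note g [measurable]
  have mp: "(\<lambda>\<phi> :: config. (\<lambda>k. \<phi> k + s k)) \<in> cfg \<rightarrow>\<^sub>M cfg"
    and mm [measurable]: "(\<lambda>\<phi> :: config. (\<lambda>k. \<phi> k - s k)) \<in> cfg \<rightarrow>\<^sub>M cfg"
    by (rule measurable_cfgI, simp)+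
  let ?t = "\<lambda>g \<phi>. weight N \<phi> * (g \<phi> * ennreal (exp (h * \<phi> j)))"
  let ?s = "\<lambda>g \<phi>. weight N (\<lambda>k. \<phi> k - s k) * g \<phi>"
  have shift: "(\<integral>\<^sup>+\<phi>. ?s g \<phi> \<partial>vol D) = (\<integral>\<^sup>+\<phi>. g (\<lambda>k. \<phi> k + s k) \<partial>gibbs N D)"
    if [measurable]: "g \<in> borel_measurable cfg" for g
  proof -
    have "(\<integral>\<^sup>+\<phi>. g (\<lambda>k. \<phi> k + s k) \<partial>gibbs N D) = (\<integral>\<^sup>+\<phi>. weight N \<phi> * g (\<lambda>k. \<phi> k + s k) \<partial>vol D)"
      by (intro nn_integral_gibbs measurable_compose[OF mp]) measurable
    also have "\<dots> = (\<integral>\<^sup>+\<phi>. ?s g (\<lambda>k. \<phi> k + s k) \<partial>vol D)" by simp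
    also have "\<dots> = (\<integral>\<^sup>+\<phi>. ?s g \<phi> \<partial>vol D)"
      using s by (intro vol_shift[OF D(1)]) auto
    finally show ?thesis by simp
  qed
  have tilt: "(\<integral>\<^sup>+\<phi>. ?t g \<phi> \<partial>vol D) = (\<integral>\<^sup>+\<phi>. g \<phi> * ennreal (exp (h * \<phi> j)) \<partial>gibbs N D)"
    if [measurable]: "g \<in> borel_measurable cfg" for g
    by (intro nn_integral_gibbs[symmetric]) measurable
  have "(\<integral>\<^sup>+\<phi>. ?t g1 \<phi> \<partial>vol D) * (\<integral>\<^sup>+\<phi>. ?s g2 \<phi> \<partial>vol D) \<le> (\<integral>\<^sup>+\<phi>. ?s g3 \<phi> \<partial>vol D) * (\<integral>\<^sup>+\<phi>. ?t g4 \<phi> \<partial>vol D)"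
  proof (rule four_functions_vol[OF D(1)])
    fix x y :: config
    assume x: "\<And>k. k \<notin> D \<Longrightarrow> x k = 0" and y: "\<And>k. k \<notin> D \<Longrightarrow> y k = 0"
    let ?max = "\<lambda>k. max (x k) (y k)" and ?min = "\<lambda>k. min (x k) (y k)"
    have "hamiltonian V N (\<lambda>k. ?max k - s k) + (hamiltonian V N ?min - h * ?min j) \<le>
        (hamiltonian V N x - h * x j) + hamiltonian V N (\<lambda>k. y k - s k)"
      by (rule hamiltonian_holley[OF D]; fact)
    then have "- hamiltonian V N x + h * x j + - hamiltonian V N (\<lambda>k. y k - s k) \<le>
        - hamiltonian V N (\<lambda>k. ?max k - s k) + (- hamiltonian V N ?min + h * ?min j)"
      by linarith
    then have "exp (- hamiltonian V N x) * exp (h * x j) * exp (- hamiltonian V N (\<lambda>k. y k - s k)) \<le>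
        exp (- hamiltonian V N (\<lambda>k. ?max k - s k)) * (exp (- hamiltonian V N ?min) * exp (h * ?min j))"
      by (simp flip: exp_add)
    then have "weight N x * ennreal (exp (h * x j)) * weight N (\<lambda>k. y k - s k) \<le>
        weight N (\<lambda>k. ?max k - s k) * (weight N ?min * ennreal (exp (h * ?min j)))"
      by (simp add: ennreal_mult[symmetric] ennreal_leI)
    from mult_mono[OF le[of x y] this]
    show "?t g1 x * ?s g2 y \<le> ?s g3 ?max * ?t g4 ?min"
      by (simp add: ac_simps)
  qed measurable
  then show ?thesis by (simp only: shift tilt g)
qed

text \<open>The four functions theorem needs nonnegative functions, so \<open>\<phi> i\<close> is
  split: its positive part is increasing and is inserted as \<open>g1\<close> and \<open>g3\<close>,
  its negative part is decreasing and is inserted as \<open>g2\<close> and \<open>g4\<close>. The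
  untilted mean is zero, which leaves only the shift \<open>s i\<close>.\<close>

lemma gibbs_tilted_mean_le:
  assumes D: "finite D" "D \<subseteq> Defs.box N" and ij: "i \<in> D" "j \<in> D" and h: "0 \<le> h" "h \<le> 1"
    and s: "\<And>k. k \<notin> D \<Longrightarrow> s k = 0"
    and super: "\<And>k c. k \<in> D \<Longrightarrow> (\<And>l. 1 / cV \<le> c l \<and> c l \<le> cV) \<Longrightarrow>
      (if k = j then h else 0) \<le> (\<Sum>l | nn k l. c l * (s k - s l))"
    and Z: "0 < measure (gibbs N D) UNIV"
  shows "(\<integral>\<phi>. \<phi> i * exp (h * \<phi> j) \<partial>gibbs N D) \<le> s i * (\<integral>\<phi>. exp (h * \<phi> j) \<partial>gibbs N D)"
proof -
  let ?M = "gibbs N D"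
  interpret finite_measure ?M by (rule finite_measure_gibbs[OF D])
  define P where "P \<phi> = max 0 (\<phi> i)" for \<phi> :: config
  define Q where "Q \<phi> = max 0 (- \<phi> i)" for \<phi> :: config
  have [measurable]: "P \<in> borel_measurable cfg" "Q \<in> borel_measurable cfg"
    by (auto simp: P_def[abs_def] Q_def[abs_def])
  have PQ: "0 \<le> P \<phi>" "0 \<le> Q \<phi>" "P \<phi> - Q \<phi> = \<phi> i" "P \<phi> \<le> \<bar>\<phi> i\<bar>" "Q \<phi> \<le> \<bar>\<phi> i\<bar>" for \<phi>
    by (auto simp: P_def Q_def)
  have hj: "exp (h * \<phi> j) \<le> exp (2 * \<bar>\<phi> j\<bar>)" for \<phi> :: config
  proof -
    have "h * \<phi> j \<le> h * \<bar>\<phi> j\<bar>" using h by (intro mult_left_mono) auto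
    also have "\<dots> \<le> 2 * \<bar>\<phi> j\<bar>" using h by (intro mult_right_mono) auto
    finally show ?thesis by simp
  qed
  have i1: "integrable ?M (\<lambda>\<phi>. f \<phi> * exp (h * \<phi> j))"
    if "f \<in> borel_measurable cfg" "\<And>\<phi>. \<bar>f \<phi>\<bar> \<le> exp \<bar>\<phi> i\<bar>" for f :: "config \<Rightarrow> real"
    using that mult_mono[OF that(2) hj]
    by (intro integrable_gibbs[OF D ij, where C = 1]) (auto simp: abs_mult exp_add)
  have i2: "integrable ?M (\<lambda>\<phi>. f (\<lambda>k. \<phi> k + s k))"
    if "f \<in> borel_measurable cfg" "\<And>\<phi>. \<bar>f \<phi>\<bar> \<le> exp \<bar>\<phi> i\<bar>" for f :: "config \<Rightarrow> real"
  proof (rule integrable_gibbs[OF D ij, where C = "exp \<bar>s i\<bar>"])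
    show "(\<lambda>\<phi>. f (\<lambda>k. \<phi> k + s k)) \<in> borel_measurable cfg"
      by (intro measurable_compose[OF measurable_cfgI that(1)]) simp
    show "\<bar>f (\<lambda>k. \<phi> k + s k)\<bar> \<le> exp \<bar>s i\<bar> * exp (\<bar>\<phi> i\<bar> + 2 * \<bar>\<phi> j\<bar>)" for \<phi>
      by (rule order_trans[OF that(2)]) (simp flip: exp_add)
  qed
  have le1: "\<bar>1\<bar> \<le> exp \<bar>\<phi> i\<bar>" "\<bar>P \<phi>\<bar> \<le> exp \<bar>\<phi> i\<bar>" "\<bar>Q \<phi>\<bar> \<le> exp \<bar>\<phi> i\<bar>" for \<phi> :: config
    using PQ[of \<phi>] le_exp_self[of "\<bar>\<phi> i\<bar>"] by auto
  have nn1: "(\<integral>\<^sup>+\<phi>. ennreal (f \<phi>) * ennreal (exp (h * \<phi> j)) \<partial>?M) = ennreal (\<integral>\<phi>. f \<phi> * exp (h * \<phi> j) \<partial>?M)"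
    if "f \<in> borel_measurable cfg" "\<And>\<phi>. \<bar>f \<phi>\<bar> \<le> exp \<bar>\<phi> i\<bar>" "\<And>\<phi>. 0 \<le> f \<phi>" for f :: "config \<Rightarrow> real"
    using nn_integral_eq_integral[OF i1[OF that(1,2)]] that(3) by (simp add: ennreal_mult)
  have nn2: "(\<integral>\<^sup>+\<phi>. ennreal (f (\<lambda>k. \<phi> k + s k)) \<partial>?M) = ennreal (\<integral>\<phi>. f (\<lambda>k. \<phi> k + s k) \<partial>?M)"
    if "f \<in> borel_measurable cfg" "\<And>\<phi>. \<bar>f \<phi>\<bar> \<le> exp \<bar>\<phi> i\<bar>" "\<And>\<phi>. 0 \<le> f \<phi>" for f :: "config \<Rightarrow> real"
    using nn_integral_eq_integral[OF i2[OF that(1,2)]] that(3) by simp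
  have H: "(\<integral>\<phi>. f1 \<phi> * exp (h * \<phi> j) \<partial>?M) * (\<integral>\<phi>. f2 (\<lambda>k. \<phi> k + s k) \<partial>?M) \<le>
      (\<integral>\<phi>. f3 (\<lambda>k. \<phi> k + s k) \<partial>?M) * (\<integral>\<phi>. f4 \<phi> * exp (h * \<phi> j) \<partial>?M)"
    if m: "f1 \<in> borel_measurable cfg" "f2 \<in> borel_measurable cfg" "f3 \<in> borel_measurable cfg" "f4 \<in> borel_measurable cfg"
      and b: "\<And>\<phi>. \<bar>f1 \<phi>\<bar> \<le> exp \<bar>\<phi> i\<bar>" "\<And>\<phi>. \<bar>f2 \<phi>\<bar> \<le> exp \<bar>\<phi> i\<bar>" "\<And>\<phi>. \<bar>f3 \<phi>\<bar> \<le> exp \<bar>\<phi> i\<bar>" "\<And>\<phi>. \<bar>f4 \<phi>\<bar> \<le> exp \<bar>\<phi> i\<bar>"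
      and nneg: "\<And>\<phi>. 0 \<le> f1 \<phi>" "\<And>\<phi>. 0 \<le> f2 \<phi>" "\<And>\<phi>. 0 \<le> f3 \<phi>" "\<And>\<phi>. 0 \<le> f4 \<phi>"
      and le: "\<And>x y. f1 x * f2 y \<le> f3 (\<lambda>k. max (x k) (y k)) * f4 (\<lambda>k. min (x k) (y k))"
    for f1 f2 f3 f4 :: "config \<Rightarrow> real"
  proof -
    have "(\<integral>\<^sup>+\<phi>. ennreal (f1 \<phi>) * ennreal (exp (h * \<phi> j)) \<partial>?M) * (\<integral>\<^sup>+\<phi>. ennreal (f2 (\<lambda>k. \<phi> k + s k)) \<partial>?M)
      \<le> (\<integral>\<^sup>+\<phi>. ennreal (f3 (\<lambda>k. \<phi> k + s k)) \<partial>?M) * (\<integral>\<^sup>+\<phi>. ennreal (f4 \<phi>) * ennreal (exp (h * \<phi> j)) \<partial>?M)"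
      using m le nneg
      by (intro gibbs_holley[OF D s super, of "\<lambda>\<phi>. ennreal (f1 \<phi>)" "\<lambda>\<phi>. ennreal (f2 \<phi>)"
            "\<lambda>\<phi>. ennreal (f3 \<phi>)" "\<lambda>\<phi>. ennreal (f4 \<phi>)"])
        (auto simp: ennreal_mult[symmetric] ennreal_leI)
    then show ?thesis
      unfolding nn1[OF m(1) b(1) nneg(1)] nn1[OF m(4) b(4) nneg(4)] nn2[OF m(2) b(2) nneg(2)] nn2[OF m(3) b(3) nneg(3)]
      using nneg by (simp add: ennreal_mult[symmetric])
  qed
  define Zh where "Zh = (\<integral>\<phi>. exp (h * \<phi> j) \<partial>?M)"
  define Z where "Z = measure ?M UNIV"
  have 1: "(\<integral>\<phi>. P \<phi> * exp (h * \<phi> j) \<partial>?M) * Z \<le> (\<integral>\<phi>. P (\<lambda>k. \<phi> k + s k) \<partial>?M) * Zh"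
    using H[of P "\<lambda>_. 1" P "\<lambda>_. 1"] le1 PQ by (auto simp: P_def Z_def Zh_def)
  have 2: "Zh * (\<integral>\<phi>. Q (\<lambda>k. \<phi> k + s k) \<partial>?M) \<le> Z * (\<integral>\<phi>. Q \<phi> * exp (h * \<phi> j) \<partial>?M)"
    using H[of "\<lambda>_. 1" Q "\<lambda>_. 1" Q] le1 PQ by (auto simp: Q_def Z_def Zh_def)
  have 3: "(\<integral>\<phi>. P \<phi> * exp (h * \<phi> j) \<partial>?M) - (\<integral>\<phi>. Q \<phi> * exp (h * \<phi> j) \<partial>?M) = (\<integral>\<phi>. \<phi> i * exp (h * \<phi> j) \<partial>?M)"
    using i1[of P] i1[of Q] le1 PQ(3)
    by (subst Bochner_Integration.integral_diff[symmetric]) (auto simp flip: left_diff_distrib)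
  have 4: "(\<integral>\<phi>. P (\<lambda>k. \<phi> k + s k) \<partial>?M) - (\<integral>\<phi>. Q (\<lambda>k. \<phi> k + s k) \<partial>?M) = s i * Z"
  proof -
    have "integrable ?M (\<lambda>\<phi>. \<phi> i)" by (rule integrable_gibbs_coordinate[OF D ij(1)])
    then have "(\<integral>\<phi>. \<phi> i + s i \<partial>?M) = s i * Z"
      using integral_gibbs_coordinate[OF D(1), where i = i and N = N] by (simp add: Z_def)
    moreover have "(\<integral>\<phi>. P (\<lambda>k. \<phi> k + s k) \<partial>?M) - (\<integral>\<phi>. Q (\<lambda>k. \<phi> k + s k) \<partial>?M) = (\<integral>\<phi>. \<phi> i + s i \<partial>?M)"
      using i2[of P] i2[of Q] le1 PQ(3)[of "\<lambda>k. _ k + s k"]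
      by (subst Bochner_Integration.integral_diff[symmetric]) auto
    ultimately show ?thesis by simp
  qed
  have "(\<integral>\<phi>. \<phi> i * exp (h * \<phi> j) \<partial>?M) * Z \<le> s i * Zh * Z"
  proof -
    have "(\<integral>\<phi>. P (\<lambda>k. \<phi> k + s k) \<partial>?M) = s i * Z + (\<integral>\<phi>. Q (\<lambda>k. \<phi> k + s k) \<partial>?M)" using 4 by simp
    then have "(\<integral>\<phi>. P (\<lambda>k. \<phi> k + s k) \<partial>?M) * Zh = s i * Zh * Z + Zh * (\<integral>\<phi>. Q (\<lambda>k. \<phi> k + s k) \<partial>?M)"
      by (simp add: algebra_simps)
    then have "(\<integral>\<phi>. P \<phi> * exp (h * \<phi> j) \<partial>?M) * Z - Z * (\<integral>\<phi>. Q \<phi> * exp (h * \<phi> j) \<partial>?M) \<le> s i * Zh * Z"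
      using 1 2 by linarith
    then show ?thesis unfolding 3[symmetric] by (simp only: left_diff_distrib mult.commute[of Z])
  qed
  then show ?thesis using Z by (simp add: Z_def Zh_def)
qed

text \<open>If \<open>\<psi>\<close> is a supersolution for a unit source, \<open>h * \<psi>\<close>
  is one for a source of strength \<open>h\<close>. Divide the tilted mean by \<open>h\<close> and
  let \<open>h\<close> tend to 0; subtracting 1 from the exponential is free because the mean
  vanishes.\<close>

lemma gibbs_correlation_le:
  assumes D: "finite D" "D \<subseteq> Defs.box N" and ij: "i \<in> D" "j \<in> D"
    and \<psi>: "\<And>k. k \<notin> D \<Longrightarrow> \<psi> k = 0"
    and super: "\<And>k c. k \<in> D \<Longrightarrow> (\<And>l. 1 / cV \<le> c l \<and> c l \<le> cV) \<Longrightarrow>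
      (if k = j then 1 else 0) \<le> (\<Sum>l | nn k l. c l * (\<psi> k - \<psi> l))"
  shows "(\<integral>\<phi>. \<phi> i * \<phi> j \<partial>gibbs N D) \<le> \<psi> i * measure (gibbs N D) UNIV"
proof (cases "measure (gibbs N D) UNIV = 0")
  case True
  interpret finite_measure "gibbs N D" by (rule finite_measure_gibbs[OF D])
  have "emeasure (gibbs N D) UNIV = 0" using True by (simp add: emeasure_eq_measure)
  then have "AE \<phi> in gibbs N D. \<phi> i * \<phi> j = 0" using sets.top[of "gibbs N D"] by (intro AE_I[of _ _ UNIV]) auto
  then have "(\<integral>\<phi>. \<phi> i * \<phi> j \<partial>gibbs N D) = 0" by (rule integral_eq_zero_AE)
  then show ?thesis using True by simp
next
  case False
  let ?M = "gibbs N D"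
  interpret finite_measure ?M by (rule finite_measure_gibbs[OF D])
  have Z: "0 < measure ?M UNIV" using False measure_nonneg[of ?M UNIV] by linarith
  define h where "h n = 1 / real (Suc n)" for n
  have h: "0 < h n" "h n \<le> 1" for n by (auto simp: h_def)
  have h0: "h \<longlonglongrightarrow> 0" unfolding h_def by (rule LIMSEQ_Suc[OF lim_1_over_n])
  let ?q = "\<lambda>n \<phi>. \<phi> i * ((exp (h n * \<phi> j) - 1) / h n)"
  have bound_exp: "exp (h n * t) \<le> exp \<bar>t\<bar>" for n t
  proof -
    have "h n * t \<le> h n * \<bar>t\<bar>" using h(1)[of n] by (intro mult_left_mono) auto
    also have "\<dots> \<le> 1 * \<bar>t\<bar>" using h(2)[of n] by (intro mult_right_mono) auto
    finally show ?thesis by simp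
  qed
  have bound: "\<bar>?q n \<phi>\<bar> \<le> exp (\<bar>\<phi> i\<bar> + 2 * \<bar>\<phi> j\<bar>)" for n \<phi>
  proof -
    let ?t = "\<phi> j"
    have "\<bar>exp (h n * ?t) - 1\<bar> \<le> \<bar>h n * ?t\<bar> * exp \<bar>h n * ?t\<bar>" by (rule abs_exp_minus_one_le)
    also have "\<dots> \<le> (h n * \<bar>?t\<bar>) * exp \<bar>?t\<bar>"
      using h[of n] bound_exp[of n "\<bar>?t\<bar>"] by (simp add: abs_mult mult_left_mono)
    finally have "\<bar>(exp (h n * ?t) - 1) / h n\<bar> \<le> \<bar>?t\<bar> * exp \<bar>?t\<bar>"
      using h(1)[of n] by (simp add: field_simps)
    also have "\<dots> \<le> exp \<bar>?t\<bar> * exp \<bar>?t\<bar>" by (intro mult_right_mono le_exp_self) simp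
    finally have "\<bar>?q n \<phi>\<bar> \<le> exp \<bar>\<phi> i\<bar> * (exp \<bar>?t\<bar> * exp \<bar>?t\<bar>)"
      unfolding abs_mult by (intro mult_mono le_exp_self) auto
    then show ?thesis by (simp only: exp_add mult_2)
  qed
  have dom: "integrable ?M (\<lambda>\<phi>. exp (\<bar>\<phi> i\<bar> + 2 * \<bar>\<phi> j\<bar>))"
  proof (rule integrable_gibbs[OF D ij, where C = 1])
    show "(\<lambda>\<phi>. exp (\<bar>\<phi> i\<bar> + 2 * \<bar>\<phi> j\<bar>)) \<in> borel_measurable cfg" by measurable
  qed simp
  have qlim: "(\<lambda>n. (exp (h n * t) - 1) / h n) \<longlonglongrightarrow> t" for t
  proof -
    have "((\<lambda>x. exp (x * t)) has_real_derivative t) (at 0)"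
      by (auto intro!: derivative_eq_intros)
    then have "((\<lambda>x. (exp (x * t) - 1) / x) \<longlongrightarrow> t) (at 0)"
      by (simp add: has_field_derivative_iff)
    moreover have "filterlim h (at 0) sequentially"
      using h0 h(1) by (intro filterlim_atI) (auto intro!: always_eventually simp: less_imp_neq[symmetric])
    ultimately show ?thesis by (rule filterlim_compose)
  qed
  have lim1: "(\<lambda>n. \<integral>\<phi>. ?q n \<phi> \<partial>?M) \<longlonglongrightarrow> (\<integral>\<phi>. \<phi> i * \<phi> j \<partial>?M)"
  proof (rule integral_dominated_convergence[OF _ _ dom])
    show "AE \<phi> in ?M. (\<lambda>n. ?q n \<phi>) \<longlonglongrightarrow> \<phi> i * \<phi> j"
      by (intro AE_I2 tendsto_mult tendsto_const qlim)
    show "AE \<phi> in ?M. norm (?q n \<phi>) \<le> exp (\<bar>\<phi> i\<bar> + 2 * \<bar>\<phi> j\<bar>)" for n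
      unfolding real_norm_def by (intro AE_I2 bound)
  qed measurable
  have lim2: "(\<lambda>n. \<integral>\<phi>. exp (h n * \<phi> j) \<partial>?M) \<longlonglongrightarrow> (\<integral>\<phi>. 1 \<partial>?M)"
  proof (rule integral_dominated_convergence[OF _ _ dom])
    have "(\<lambda>n. exp (h n * t)) \<longlonglongrightarrow> exp (0 * t)" for t by (intro tendsto_intros h0)
    then show "AE \<phi> in ?M. (\<lambda>n. exp (h n * \<phi> j)) \<longlonglongrightarrow> 1" by simp
    show "AE \<phi> in ?M. norm (exp (h n * \<phi> j)) \<le> exp (\<bar>\<phi> i\<bar> + 2 * \<bar>\<phi> j\<bar>)" for n
    proof (intro AE_I2)
      fix \<phi> :: config
      have "exp (h n * \<phi> j) \<le> exp \<bar>\<phi> j\<bar>" by (rule bound_exp)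
      also have "\<dots> \<le> exp (\<bar>\<phi> i\<bar> + 2 * \<bar>\<phi> j\<bar>)" by simp
      finally show "norm (exp (h n * \<phi> j)) \<le> exp (\<bar>\<phi> i\<bar> + 2 * \<bar>\<phi> j\<bar>)" by simp
    qed
  qed auto
  have step: "(\<integral>\<phi>. ?q n \<phi> \<partial>?M) \<le> \<psi> i * (\<integral>\<phi>. exp (h n * \<phi> j) \<partial>?M)" for n
  proof -
    have "(\<integral>\<phi>. \<phi> i * exp (h n * \<phi> j) \<partial>?M) \<le> (h n * \<psi> i) * (\<integral>\<phi>. exp (h n * \<phi> j) \<partial>?M)"
    proof (rule gibbs_tilted_mean_le[OF D ij _ _ _ _ Z])
      fix k :: site and c :: "site \<Rightarrow> real" assume k: "k \<in> D" and c: "\<And>l. 1 / cV \<le> c l \<and> c l \<le> cV"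
      have "(if k = j then h n else 0) = h n * (if k = j then 1 else 0)" by simp
      also have "\<dots> \<le> h n * (\<Sum>l | nn k l. c l * (\<psi> k - \<psi> l))"
        using h(1)[of n] super[OF k c] by (intro mult_left_mono) auto
      also have "\<dots> = (\<Sum>l | nn k l. c l * (h n * \<psi> k - h n * \<psi> l))"
        by (simp add: sum_distrib_left algebra_simps)
      finally show "(if k = j then h n else 0) \<le> (\<Sum>l | nn k l. c l * (h n * \<psi> k - h n * \<psi> l))" .
    qed (use h[of n] \<psi> in auto)
    moreover have "(\<integral>\<phi>. ?q n \<phi> \<partial>?M) = ((\<integral>\<phi>. \<phi> i * exp (h n * \<phi> j) \<partial>?M) - (\<integral>\<phi>. \<phi> i \<partial>?M)) / h n"
    proof -
      have "integrable ?M (\<lambda>\<phi>. \<phi> i * exp (h n * \<phi> j))"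
      proof (rule integrable_gibbs[OF D ij, where C = 1])
        show "\<bar>\<phi> i * exp (h n * \<phi> j)\<bar> \<le> 1 * exp (\<bar>\<phi> i\<bar> + 2 * \<bar>\<phi> j\<bar>)" for \<phi> :: config
        proof -
          have "\<bar>\<phi> i\<bar> * exp (h n * \<phi> j) \<le> exp \<bar>\<phi> i\<bar> * exp \<bar>\<phi> j\<bar>"
            by (intro mult_mono le_exp_self bound_exp) auto
          also have "\<dots> \<le> exp (\<bar>\<phi> i\<bar> + 2 * \<bar>\<phi> j\<bar>)" by (simp flip: exp_add)
          finally show ?thesis by (simp add: abs_mult)
        qed
      qed simp
      moreover have "integrable ?M (\<lambda>\<phi>. \<phi> i)" by (rule integrable_gibbs_coordinate[OF D ij(1)])
      ultimately show ?thesis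
        by (subst Bochner_Integration.integral_diff[symmetric]) (auto simp: algebra_simps diff_divide_distrib)
    qed
    ultimately show ?thesis
      using h(1)[of n] integral_gibbs_coordinate[OF D(1), where i = i and N = N] by (simp add: divide_le_eq mult_ac)
  qed
  have "(\<integral>\<phi>. \<phi> i * \<phi> j \<partial>?M) \<le> \<psi> i * (\<integral>\<phi>. 1 \<partial>?M)"
    by (rule LIMSEQ_le[OF lim1 tendsto_mult[OF tendsto_const lim2]]) (use step in auto)
  then show ?thesis by simp
qed

lemma gibbs_correlation_outside:
  assumes "finite D" "i \<notin> D \<or> j \<notin> D"
  shows "(\<integral>\<phi>. \<phi> i * \<phi> j \<partial>gibbs N D) = 0"
proof (rule integral_eq_zero_AE)
  show "AE \<phi> in gibbs N D. \<phi> i * \<phi> j = 0"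
    using assms(2)
  proof
    assume "i \<notin> D"
    from AE_gibbs_support[OF assms(1) this, of N] show ?thesis by eventually_elim simp
  next
    assume "j \<notin> D"
    from AE_gibbs_support[OF assms(1) this, of N] show ?thesis by eventually_elim simp
  qed
qed

end

section \<open>The pinned measure as a mixture\<close>

lemma finite_site_box [simp]: "finite (Defs.box N)"
  by (simp add: Defs.box_def)

lemma finite_subset_box: "D \<subseteq> Defs.box N \<Longrightarrow> finite D"
  by (rule finite_subset[OF _ finite_site_box])

context pair_potential
begin

abbreviation pin_factor :: "real \<Rightarrow> nat \<Rightarrow> site set \<Rightarrow> real" where
  "pin_factor J N D \<equiv> exp (J * real (card (Defs.box N - D)))"

text \<open>Divided by \<open>total_weight\<close>, this is the probability that \<open>D\<close> is
  the set of unpinned sites.\<close>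

definition pin_weight :: "real \<Rightarrow> nat \<Rightarrow> site set \<Rightarrow> real" where
  "pin_weight J N D = pin_factor J N D * measure (gibbs N D) UNIV"

definition total_weight :: "real \<Rightarrow> nat \<Rightarrow> real" where
  "total_weight J N = (\<Sum>D\<in>Pow (Defs.box N). pin_weight J N D)"

lemma pin_weight_nonneg: "0 \<le> pin_weight J N D"
  by (simp add: pin_weight_def)

lemma partition_sum_eq_measure:
  assumes "D \<subseteq> Defs.box N"
  shows "partition_sum N D = ennreal (measure (gibbs N D) UNIV)"
proof -
  interpret finite_measure "gibbs N D"
    using assms by (intro finite_measure_gibbs finite_subset_box)
  show ?thesis using emeasure_eq_measure emeasure_gibbs by metis
qed

lemma pin_weight_remove:
  assumes D: "D \<subseteq> Defs.box N" and s: "s \<in> D" and R: "exit_dist D s \<le> R"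
  shows "pin_weight J N D * (exp J / sqrt (4 * pi * cV * real R)) \<le> pin_weight J N (D - {s})"
proof -
  have fin: "finite D" using D by (rule finite_subset_box)
  have sub: "D - {s} \<subseteq> Defs.box N" using D by auto
  have "0 < R" using exit_dist_pos[OF fin s] R by simp
  then have q: "0 < sqrt (4 * pi * cV * real R)" using cV by simp
  have "ennreal (measure (gibbs N D) UNIV) \<le>
      ennreal (sqrt (4 * pi * cV * real R) * measure (gibbs N (D - {s})) UNIV)"
    using partition_sum_remove[OF fin D s R] partition_sum_eq_measure[OF D]
      partition_sum_eq_measure[OF sub] q by (auto simp: ennreal_mult)
  then have "measure (gibbs N D) UNIV \<le> sqrt (4 * pi * cV * real R) * measure (gibbs N (D - {s})) UNIV"
    using q by (simp add: mult_nonneg_nonneg)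
  then have *: "measure (gibbs N D) UNIV / sqrt (4 * pi * cV * real R) \<le> measure (gibbs N (D - {s})) UNIV"
    using q by (simp add: pos_divide_le_eq mult.commute)
  have "Defs.box N - (D - {s}) = insert s (Defs.box N - D)" using D s by auto
  then have "card (Defs.box N - (D - {s})) = Suc (card (Defs.box N - D))" using s by simp
  then have "pin_factor J N (D - {s}) = pin_factor J N D * exp J"
    by (simp add: algebra_simps flip: exp_add)
  then show ?thesis
    using mult_left_mono[OF *, of "pin_factor J N D * exp J"]
    by (simp add: pin_weight_def mult_ac)
qed

lemma nn_integral_reference_measure:
  assumes "g \<in> borel_measurable cfg"
  shows "(\<integral>\<^sup>+\<phi>. weight N \<phi> * g \<phi> \<partial>reference_measure J N) =
    (\<Sum>D\<in>Pow (Defs.box N). ennreal (pin_factor J N D) * (\<integral>\<^sup>+\<phi>. g \<phi> \<partial>gibbs N D))"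
  unfolding reference_measure_eq_zprod using assms
  by (subst nn_integral_pinned_expansion) (simp_all add: nn_integral_gibbs)

lemma partition_function_eq: "partition_function V J N = ennreal (total_weight J N)"
proof -
  have "partition_function V J N = (\<Sum>D\<in>Pow (Defs.box N). ennreal (pin_factor J N D) * partition_sum N D)"
    using nn_integral_reference_measure[where g = "\<lambda>_. 1" and N = N and J = J]
    by (simp add: partition_function_def emeasure_gibbs)
  also have "\<dots> = (\<Sum>D\<in>Pow (Defs.box N). ennreal (pin_weight J N D))"
    by (intro sum.cong) (auto simp: pin_weight_def ennreal_mult partition_sum_eq_measure)
  finally show ?thesis by (simp add: total_weight_def sum_ennreal pin_weight_nonneg)
qed

lemma total_weight_pos: "0 < total_weight J N"
proof -
  have "partition_sum N {} = weight N (\<lambda>_. 0)"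
    unfolding partition_sum_def by (rule vol_empty) measurable
  then have "0 < measure (gibbs N {}) UNIV"
    using partition_sum_eq_measure[of "{}" N] measure_nonneg[of "gibbs N {}" UNIV] by simp
  then have "0 < pin_weight J N {}" by (simp add: pin_weight_def)
  also have "\<dots> \<le> total_weight J N"
    unfolding total_weight_def by (rule member_le_sum) (auto simp: pin_weight_nonneg)
  finally show ?thesis .
qed

lemma nn_integral_pinned_measure:
  assumes [measurable]: "g \<in> borel_measurable cfg"
  shows "(\<integral>\<^sup>+\<phi>. g \<phi> \<partial>pinned_measure V J N) =
    (\<Sum>D\<in>Pow (Defs.box N). ennreal (pin_factor J N D) * (\<integral>\<^sup>+\<phi>. g \<phi> \<partial>gibbs N D))
      / ennreal (total_weight J N)"
proof -
  have [measurable_cong]: "sets (reference_measure J N) = sets cfg"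
    by (simp add: reference_measure_eq_zprod)
  have "(\<integral>\<^sup>+\<phi>. g \<phi> \<partial>pinned_measure V J N) =
      (\<integral>\<^sup>+\<phi>. weight N \<phi> / ennreal (total_weight J N) * g \<phi> \<partial>reference_measure J N)"
    unfolding pinned_measure_def partition_function_eq by (rule nn_integral_density) measurable
  also have "\<dots> = (\<integral>\<^sup>+\<phi>. (weight N \<phi> * g \<phi>) / ennreal (total_weight J N) \<partial>reference_measure J N)"
    by (simp add: divide_ennreal_def mult_ac)
  also have "\<dots> = (\<integral>\<^sup>+\<phi>. weight N \<phi> * g \<phi> \<partial>reference_measure J N) / ennreal (total_weight J N)"
    by (rule nn_integral_divide) measurable
  finally show ?thesis by (simp add: nn_integral_reference_measure)
qed

lemma has_bochner_integral_pinned_nonneg: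
  fixes f :: "config \<Rightarrow> real"
  assumes f [measurable]: "f \<in> borel_measurable cfg" and "\<And>\<phi>. 0 \<le> f \<phi>"
    and int: "\<And>D. D \<subseteq> Defs.box N \<Longrightarrow> integrable (gibbs N D) f"
  shows "has_bochner_integral (pinned_measure V J N) f
    ((\<Sum>D\<in>Pow (Defs.box N). pin_factor J N D * (\<integral>\<phi>. f \<phi> \<partial>gibbs N D)) / total_weight J N)"
proof (rule has_bochner_integral_nn_integral)
  have sets: "sets (pinned_measure V J N) = sets cfg"
    by (simp add: pinned_measure_def reference_measure_eq_zprod)
  show "f \<in> borel_measurable (pinned_measure V J N)"
    using f by (simp add: measurable_cong_sets[OF sets refl])
  have nn: "0 \<le> (\<Sum>D\<in>Pow (Defs.box N). pin_factor J N D * (\<integral>\<phi>. f \<phi> \<partial>gibbs N D))"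
    using assms(2) by (intro sum_nonneg mult_nonneg_nonneg Bochner_Integration.integral_nonneg) auto
  then show "0 \<le> (\<Sum>D\<in>Pow (Defs.box N). pin_factor J N D * (\<integral>\<phi>. f \<phi> \<partial>gibbs N D)) / total_weight J N"
    using total_weight_pos[of J N] by simp
  have "(\<integral>\<^sup>+\<phi>. ennreal (f \<phi>) \<partial>pinned_measure V J N) =
    (\<Sum>D\<in>Pow (Defs.box N). ennreal (pin_factor J N D) * (\<integral>\<^sup>+\<phi>. ennreal (f \<phi>) \<partial>gibbs N D))
      / ennreal (total_weight J N)"
    by (rule nn_integral_pinned_measure) measurable
  also have "(\<Sum>D\<in>Pow (Defs.box N). ennreal (pin_factor J N D) * (\<integral>\<^sup>+\<phi>. ennreal (f \<phi>) \<partial>gibbs N D)) =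
      (\<Sum>D\<in>Pow (Defs.box N). ennreal (pin_factor J N D * (\<integral>\<phi>. f \<phi> \<partial>gibbs N D)))"
  proof (rule sum.cong[OF refl])
    fix D assume "D \<in> Pow (Defs.box N)"
    then have "(\<integral>\<^sup>+\<phi>. ennreal (f \<phi>) \<partial>gibbs N D) = ennreal (\<integral>\<phi>. f \<phi> \<partial>gibbs N D)"
      using int assms(2) by (intro nn_integral_eq_integral) auto
    then show "ennreal (pin_factor J N D) * (\<integral>\<^sup>+\<phi>. ennreal (f \<phi>) \<partial>gibbs N D) =
        ennreal (pin_factor J N D * (\<integral>\<phi>. f \<phi> \<partial>gibbs N D))"
      by (simp add: ennreal_mult')
  qed
  also have "\<dots> = ennreal (\<Sum>D\<in>Pow (Defs.box N). pin_factor J N D * (\<integral>\<phi>. f \<phi> \<partial>gibbs N D))"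
    using assms(2) by (intro sum_ennreal mult_nonneg_nonneg Bochner_Integration.integral_nonneg) auto
  also have "\<dots> / ennreal (total_weight J N) =
      ennreal ((\<Sum>D\<in>Pow (Defs.box N). pin_factor J N D * (\<integral>\<phi>. f \<phi> \<partial>gibbs N D)) / total_weight J N)"
    using nn total_weight_pos by (rule divide_ennreal)
  finally show "(\<integral>\<^sup>+\<phi>. ennreal (f \<phi>) \<partial>pinned_measure V J N) =
      ennreal ((\<Sum>D\<in>Pow (Defs.box N). pin_factor J N D * (\<integral>\<phi>. f \<phi> \<partial>gibbs N D)) / total_weight J N)" .
qed (use assms(2) in auto)

lemma integral_pinned_measure:
  fixes f :: "config \<Rightarrow> real"
  assumes f [measurable]: "f \<in> borel_measurable cfg"
    and int: "\<And>D. D \<subseteq> Defs.box N \<Longrightarrow> integrable (gibbs N D) f"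
  shows "(\<integral>\<phi>. f \<phi> \<partial>pinned_measure V J N) =
    (\<Sum>D\<in>Pow (Defs.box N). pin_factor J N D * (\<integral>\<phi>. f \<phi> \<partial>gibbs N D)) / total_weight J N"
proof -
  let ?p = "\<lambda>\<phi>. max 0 (f \<phi>)" and ?q = "\<lambda>\<phi>. max 0 (- f \<phi>)"
  let ?I = "\<lambda>g. (\<Sum>D\<in>Pow (Defs.box N). pin_factor J N D * (\<integral>\<phi>. g \<phi> \<partial>gibbs N D)) / total_weight J N"
  have ip: "integrable (gibbs N D) ?p" "integrable (gibbs N D) ?q" if "D \<subseteq> Defs.box N" for D
    using int[OF that] by auto
  have "has_bochner_integral (pinned_measure V J N) (\<lambda>\<phi>. ?p \<phi> - ?q \<phi>) (?I ?p - ?I ?q)"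
    using ip by (intro has_bochner_integral_diff has_bochner_integral_pinned_nonneg) auto
  moreover have "(\<lambda>\<phi>. ?p \<phi> - ?q \<phi>) = f" by (auto simp: max_def)
  moreover have "?I ?p - ?I ?q = ?I f"
  proof -
    have "(\<integral>\<phi>. ?p \<phi> \<partial>gibbs N D) - (\<integral>\<phi>. ?q \<phi> \<partial>gibbs N D) = (\<integral>\<phi>. f \<phi> \<partial>gibbs N D)" if "D \<subseteq> Defs.box N" for D
    proof -
      have "(\<integral>\<phi>. ?p \<phi> \<partial>gibbs N D) - (\<integral>\<phi>. ?q \<phi> \<partial>gibbs N D) = (\<integral>\<phi>. ?p \<phi> - ?q \<phi> \<partial>gibbs N D)"
        using ip[OF that] by (rule Bochner_Integration.integral_diff[symmetric])
      also have "(\<lambda>\<phi>. ?p \<phi> - ?q \<phi>) = f" by (auto simp: max_def)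
      finally show ?thesis .
    qed
    then show ?thesis
      by (simp add: diff_divide_distrib[symmetric] sum_subtractf[symmetric] right_diff_distrib[symmetric])
  qed
  ultimately show ?thesis by (simp add: has_bochner_integral_iff)
qed

lemma integrable_gibbs_coordinates:
  assumes "D \<subseteq> Defs.box N"
  shows "integrable (gibbs N D) (\<lambda>\<phi>. \<phi> i)" "integrable (gibbs N D) (\<lambda>\<phi>. \<phi> i * \<phi> j)"
proof -
  have D: "finite D" "D \<subseteq> Defs.box N" using assms finite_subset_box by auto
  have zero: "integrable (gibbs N D) (\<lambda>\<phi>. \<phi> k * f \<phi>)"
    if k: "k \<notin> D" and f: "f \<in> borel_measurable cfg" for k and f :: "config \<Rightarrow> real"
  proof -
    have "AE \<phi> in gibbs N D. \<phi> k * f \<phi> = 0"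
      using AE_gibbs_support[OF D(1) k] by eventually_elim simp
    then show ?thesis
      using f by (subst integrable_cong_AE[where g = "\<lambda>_. 0"]) auto
  qed
  show "integrable (gibbs N D) (\<lambda>\<phi>. \<phi> i)"
  proof (cases "i \<in> D")
    case True
    then show ?thesis by (rule integrable_gibbs_coordinate[OF D])
  qed (use zero[of i "\<lambda>_. 1"] in simp)
  show "integrable (gibbs N D) (\<lambda>\<phi>. \<phi> i * \<phi> j)"
  proof (cases "i \<in> D \<and> j \<in> D")
    case True
    show ?thesis
    proof (rule integrable_gibbs[OF D, where C = 1 and i = i and j = j])
      fix \<phi> :: config
      have "\<bar>\<phi> i\<bar> * \<bar>\<phi> j\<bar> \<le> exp \<bar>\<phi> i\<bar> * exp \<bar>\<phi> j\<bar>" by (intro mult_mono le_exp_self) auto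
      also have "\<dots> \<le> exp (\<bar>\<phi> i\<bar> + 2 * \<bar>\<phi> j\<bar>)" by (simp flip: exp_add)
      finally show "\<bar>\<phi> i * \<phi> j\<bar> \<le> 1 * exp (\<bar>\<phi> i\<bar> + 2 * \<bar>\<phi> j\<bar>)" by (simp add: abs_mult)
    qed (use True in auto)
  next
    case False
    then show ?thesis
    proof (cases "i \<in> D")
      case False
      then show ?thesis by (rule zero) simp
    next
      case True
      with \<open>\<not> (i \<in> D \<and> j \<in> D)\<close> have "j \<notin> D" by simp
      then show ?thesis using zero[of j "\<lambda>\<phi>. \<phi> i"] by (simp add: mult.commute)
    qed
  qed
qed

text \<open>The conductances may be chosen adversarially at every site, without symmetry across
  bonds: they stem from the mean value theorem at arbitrary configurations, and only their bounds
  are known.\<close>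

definition supersolution :: "site set \<Rightarrow> site \<Rightarrow> (site \<Rightarrow> real) \<Rightarrow> bool" where
  "supersolution D j \<psi> \<longleftrightarrow> (\<forall>k. k \<notin> D \<longrightarrow> \<psi> k = 0) \<and>
    (\<forall>k\<in>D. \<forall>c. (\<forall>l. 1 / cV \<le> c l \<and> c l \<le> cV) \<longrightarrow>
      (if k = j then 1 else 0) \<le> (\<Sum>l | nn k l. c l * (\<psi> k - \<psi> l)))"

text \<open>Every component of the mixture has mean zero, so the covariance is the average of the
  second moments, with no contribution from fluctuating conditional means.\<close>

lemma covariance_pinned_le:
  assumes B: "\<And>D. 0 \<le> B D"
    and super: "\<And>D. D \<subseteq> Defs.box N \<Longrightarrow> i \<in> D \<Longrightarrow> j \<in> D \<Longrightarrow> \<exists>\<psi>. supersolution D j \<psi> \<and> \<psi> i \<le> B D"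
  shows "covariance (pinned_measure V J N) (\<lambda>\<phi>. \<phi> i) (\<lambda>\<phi>. \<phi> j)
    \<le> (\<Sum>D\<in>Pow (Defs.box N). pin_weight J N D * B D) / total_weight J N"
proof -
  have mean: "(\<integral>\<phi>. \<phi> k \<partial>pinned_measure V J N) = 0" for k
    using integrable_gibbs_coordinates(1)
    by (subst integral_pinned_measure) (auto simp: integral_gibbs_coordinate finite_subset_box)
  have "covariance (pinned_measure V J N) (\<lambda>\<phi>. \<phi> i) (\<lambda>\<phi>. \<phi> j) = (\<integral>\<phi>. \<phi> i * \<phi> j \<partial>pinned_measure V J N)"
    by (simp add: covariance_def mean)
  also have "\<dots> = (\<Sum>D\<in>Pow (Defs.box N). pin_factor J N D * (\<integral>\<phi>. \<phi> i * \<phi> j \<partial>gibbs N D)) / total_weight J N"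
    using integrable_gibbs_coordinates(2) by (intro integral_pinned_measure) auto
  also have "\<dots> \<le> (\<Sum>D\<in>Pow (Defs.box N). pin_weight J N D * B D) / total_weight J N"
  proof (intro divide_right_mono sum_mono)
    fix D assume "D \<in> Pow (Defs.box N)"
    then have D: "finite D" "D \<subseteq> Defs.box N" using finite_subset_box by auto
    have "(\<integral>\<phi>. \<phi> i * \<phi> j \<partial>gibbs N D) \<le> measure (gibbs N D) UNIV * B D"
    proof (cases "i \<in> D \<and> j \<in> D")
      case True
      then obtain \<psi> where \<psi>: "supersolution D j \<psi>" "\<psi> i \<le> B D" using super[OF D(2)] by blast
      have "(\<integral>\<phi>. \<phi> i * \<phi> j \<partial>gibbs N D) \<le> \<psi> i * measure (gibbs N D) UNIV"
        using True \<psi>(1) unfolding supersolution_def by (intro gibbs_correlation_le[OF D]) auto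
      also have "\<dots> \<le> B D * measure (gibbs N D) UNIV" using \<psi>(2) by (intro mult_right_mono) auto
      finally show ?thesis by (simp add: mult.commute)
    next
      case False
      then show ?thesis using gibbs_correlation_outside[OF D(1)] B by simp
    qed
    then show "pin_factor J N D * (\<integral>\<phi>. \<phi> i * \<phi> j \<partial>gibbs N D) \<le> pin_weight J N D * B D"
      by (simp add: pin_weight_def mult.assoc)
  qed (use total_weight_pos[of J N] in simp)
  finally show ?thesis .
qed

end

section \<open>The supersolution\<close>

definition cell :: "nat \<Rightarrow> site \<Rightarrow> site set" where
  "cell K q = {x. fst x div int K = fst q \<and> snd x div int K = snd q}"

definition cell_of :: "nat \<Rightarrow> site \<Rightarrow> site" where
  "cell_of K x = (fst x div int K, snd x div int K)"

text \<open>\<open>D\<close> is always the set of unpinned sites; sites outside the box count as pinned, so that a cell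
  reaching out of the box is good. Neighbouring cells are neighbours in the sense of \<open>nn\<close> again.\<close>

definition bad :: "nat \<Rightarrow> site set \<Rightarrow> site \<Rightarrow> bool" where
  "bad K D q \<longleftrightarrow> cell K q \<subseteq> D"

lemma mem_cell_of: "x \<in> cell K (cell_of K x)"
  by (simp add: cell_def cell_of_def)

lemma div_diff_bounds:
  fixes a b :: int
  assumes "0 < K"
  shows "(a div int K - b div int K) * int K - int K < a - b"
    and "a - b < (a div int K - b div int K) * int K + int K"
proof -
  have "a = a div int K * int K + a mod int K" "b = b div int K * int K + b mod int K" by simp_all
  moreover have "0 \<le> a mod int K" "a mod int K < int K" "0 \<le> b mod int K" "b mod int K < int K"
    using assms by auto
  moreover have "(a div int K - b div int K) * int K = a div int K * int K - b div int K * int K"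
    by (simp add: left_diff_distrib)
  ultimately show "(a div int K - b div int K) * int K - int K < a - b"
    "a - b < (a div int K - b div int K) * int K + int K" by linarith+
qed

lemma l1_cell_le:
  assumes "0 < K" "x \<in> cell K q" "y \<in> cell K (fst q - int r, snd q)"
  shows "l1 x y \<le> K * (r + 2)"
proof -
  have "fst x - fst y < int r * int K + int K" "int r * int K - int K < fst x - fst y"
    using div_diff_bounds[OF assms(1), of "fst x" "fst y"] assms(2,3) by (auto simp: cell_def)
  moreover have "\<bar>snd x - snd y\<bar> < int K"
    using div_diff_bounds[OF assms(1), of "snd x" "snd y"] assms(2,3) by (auto simp: cell_def)
  moreover have "0 \<le> int r * int K" by simp
  ultimately have "\<bar>fst x - fst y\<bar> + \<bar>snd x - snd y\<bar> \<le> int r * int K + 2 * int K" by linarith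
  also have "\<dots> = int (K * (r + 2))" by (simp add: algebra_simps)
  finally show ?thesis unfolding l1_def by (simp only: nat_le_iff)
qed

text \<open>Going \<open>r\<close> cells to the left costs \<open>r\<close> sides, and the positions
  within the two cells at most one more side per coordinate. The case \<open>r = 0\<close> is the
  \<open>2 * K\<close> in \<open>decay_rate\<close>; larger \<open>r\<close> serve to scan a row for
  its first good cell.\<close>

lemma exit_dist_good_cell:
  assumes "0 < K" "\<not> bad K D (fst (cell_of K x) - int r, snd (cell_of K x))"
  shows "exit_dist D x \<le> K * (r + 2)"
proof -
  obtain y where "y \<in> cell K (fst (cell_of K x) - int r, snd (cell_of K x))" "y \<notin> D"
    using assms(2) by (auto simp: bad_def)
  then show ?thesis
    using l1_cell_le[OF assms(1) mem_cell_of] exit_dist_le[of y D x] by (meson le_trans)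
qed

lemma cell_of_neighbour:
  assumes "0 < K" "nn x y"
  shows "cell_of K x = cell_of K y \<or> nn (cell_of K x) (cell_of K y)"
proof -
  have small: "\<bar>a div int K - b div int K\<bar> \<le> 1" if "\<bar>a - b\<bar> \<le> 1" for a b :: int
  proof -
    let ?d = "a div int K - b div int K"
    have "?d * int K < int K + int K \<or> int K = 1" "?d * int K > - int K - int K \<or> int K = 1"
      using div_diff_bounds[OF assms(1), of a b] that assms(1) by linarith+
    moreover have ?thesis if "int K = 1" using that \<open>\<bar>a - b\<bar> \<le> 1\<close> by simp
    moreover have "?d < 2" if "?d * int K < int K + int K"
    proof (rule ccontr)
      assume "\<not> ?d < 2"
      then have "2 * int K \<le> ?d * int K" by (intro mult_right_mono) auto
      then show False using that by linarith
    qed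
    moreover have "- 2 < ?d" if "?d * int K > - int K - int K"
    proof (rule ccontr)
      assume "\<not> - 2 < ?d"
      then have "?d * int K \<le> - 2 * int K" by (intro mult_right_mono) auto
      then show False using that by linarith
    qed
    ultimately show ?thesis by linarith
  qed
  have "\<bar>fst x - fst y\<bar> + \<bar>snd x - snd y\<bar> = 1" using assms(2) by (simp add: nn_def)
  then consider "fst x = fst y" "\<bar>snd x - snd y\<bar> \<le> 1" | "snd x = snd y" "\<bar>fst x - fst y\<bar> \<le> 1"
    by linarith
  then show ?thesis
  proof cases
    case 1
    then show ?thesis using small[of "snd x" "snd y"] by (auto simp: cell_of_def nn_def)
  next
    case 2
    then show ?thesis using small[of "fst x" "fst y"] by (auto simp: cell_of_def nn_def)
  qed
qed

section \<open>First passage through good cells\<close>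

definition good_count :: "nat \<Rightarrow> site set \<Rightarrow> site list \<Rightarrow> nat" where
  "good_count K D p = length (filter (\<lambda>q. \<not> bad K D q) p)"

definition walk :: "site \<Rightarrow> site \<Rightarrow> site list \<Rightarrow> bool" where
  "walk q q0 p \<longleftrightarrow> p \<noteq> [] \<and> hd p = q \<and> last p = q0 \<and> successively nn p"

text \<open>A first passage time in which a good cell costs 1 and a bad cell 0. Both end cells are
  counted, so the passage time from a good cell to itself is 1.\<close>

definition passage :: "nat \<Rightarrow> site set \<Rightarrow> site \<Rightarrow> site \<Rightarrow> nat" where
  "passage K D q0 q = (LEAST n. \<exists>p. walk q q0 p \<and> good_count K D p = n)"

lemma walk_Cons: "nn q l \<Longrightarrow> walk l q0 p \<Longrightarrow> walk q q0 (q # p)"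
  by (auto simp: walk_def successively_Cons)

lemma walk_exists: "\<exists>p. walk q q0 p"
proof (induction "l1 q q0" arbitrary: q rule: less_induct)
  case less
  show ?case
  proof (cases "q = q0")
    case True
    then show ?thesis by (intro exI[of _ "[q]"]) (simp add: walk_def)
  next
    case False
    obtain l where "nn q l" "Suc (l1 l q0) \<le> l1 q q0" using l1_descent[OF False] .
    then show ?thesis using less[of l] walk_Cons by (meson Suc_le_lessD)
  qed
qed

lemma passage_attained:
  obtains p where "walk q q0 p" "good_count K D p = passage K D q0 q"
proof -
  have "\<exists>n p. walk q q0 p \<and> good_count K D p = n" using walk_exists by blast
  then have "\<exists>p. walk q q0 p \<and> good_count K D p = passage K D q0 q"
    unfolding passage_def by (rule LeastI_ex)
  then show thesis using that by blast
qed

lemma passage_le: "walk q q0 p \<Longrightarrow> passage K D q0 q \<le> good_count K D p"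
  unfolding passage_def by (rule Least_le) blast

lemma passage_self: "passage K D q q \<le> 1"
  using passage_le[of q q "[q]" K D] by (simp add: walk_def good_count_def split: if_splits)

lemma passage_neighbour:
  assumes "nn q l"
  shows "passage K D q0 q \<le> passage K D q0 l + (if bad K D q then 0 else 1)"
proof -
  obtain p where p: "walk l q0 p" "good_count K D p = passage K D q0 l" using passage_attained .
  have "passage K D q0 q \<le> good_count K D (q # p)"
    by (rule passage_le[OF walk_Cons[OF assms p(1)]])
  also have "\<dots> = good_count K D p + (if bad K D q then 0 else 1)"
    by (simp add: good_count_def)
  finally show ?thesis using p(2) by simp
qed

text \<open>The supersolution is a barrier \<open>1 - \<lambda>\<^sup>-\<^sup>d\<close> in the distance \<open>d\<close> to the pinned sites, multiplied by
  an exponential weight in the number of good cells separating a site from \<open>j\<close>. Going downhill towards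
  the pinned sites gains a factor \<open>\<lambda>\<close> over any step uphill, so that unfavourable conductances cannot
  compensate; the slack of order \<open>\<lambda>\<^sup>-\<^sup>d\<close> absorbs the variation of the weight, which only varies
  where \<open>d\<close> is at most \<open>2 K\<close>.\<close>

context pair_potential
begin

text \<open>In units of the barrier slack \<open>?w\<close>, the downhill bond contributes at least
  \<open>(barrier_ratio - 2) / cV = 7 * cV\<close>, and each of the three others loses at most
  \<open>2 * cV\<close>. What remains is \<open>cV\<close>, which is at least 1.\<close>

definition barrier_ratio :: real where
  "barrier_ratio = 2 + 7 * cV\<^sup>2"

text \<open>Half of the smallest slack in a good cell, so that \<open>exp r \<le> 1 + 2 * r\<close>
  makes the weight change by no more than this slack.\<close>

definition decay_rate :: "nat \<Rightarrow> real" where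
  "decay_rate K = (1 / barrier_ratio) ^ (2 * K) / 2"

lemma barrier_ratio: "9 \<le> barrier_ratio"
  using cV power_mono[of 1 cV 2] by (simp add: barrier_ratio_def)

lemma decay_rate: "0 < decay_rate K" "decay_rate K \<le> 1 / 2"
  using barrier_ratio by (auto simp: decay_rate_def intro!: power_le_one divide_right_mono)

lemma supersolution_exists:
  assumes D: "finite D" and j: "j \<in> D" and K: "0 < K"
  obtains \<psi> where "supersolution D j \<psi>"
    "\<And>i. \<psi> i \<le> 2 * barrier_ratio ^ exit_dist D j *
      exp (- (decay_rate K * real (passage K D (cell_of K j) (cell_of K i))))"
proof -
  let ?b = barrier_ratio
  define v where "v n = (1 / ?b) ^ n" for n :: nat
  have v: "0 < v n" "v n \<le> 1" for n
    using barrier_ratio by (auto simp: v_def intro!: power_le_one)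
  have v_mono: "v n \<le> v m" if "m \<le> n" for m n
    unfolding v_def using barrier_ratio that by (intro power_decreasing) auto
  let ?d = "exit_dist D"
  define T where "T x = real (passage K D (cell_of K j) (cell_of K x))" for x
  define u where "u x = exp (- (decay_rate K * T x))" for x
  have u: "0 < u x" for x by (simp add: u_def)
  \<comment> \<open>At \<open>j\<close> the power of the ratio cancels \<open>v (?d j)\<close>, and
    the 2 makes up for \<open>u j \<ge> 1 / 2\<close>.\<close>
  define B where "B = 2 * ?b ^ ?d j"
  have B: "0 < B" using barrier_ratio by (simp add: B_def)
  define \<psi> where "\<psi> x = B * u x * (1 - v (?d x))" for x
  \<comment> \<open>The weight grows from \<open>k\<close> to \<open>l\<close> only if the passage
    time drops, hence only if \<open>k\<close> lies in a good cell. Then \<open>k\<close> is within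
    \<open>2 * K\<close> of the pinned sites and \<open>v (?d k)\<close> is at least
    \<open>2 * decay_rate K\<close>.\<close>
  have u_nbr: "u l \<le> u k * (1 + v (?d k))" if "nn k l" for k l
  proof (cases "T l < T k")
    case True
    then have good: "\<not> bad K D (cell_of K k)" and T: "T k \<le> T l + 1"
      using cell_of_neighbour[OF K that] passage_neighbour[of "cell_of K k" "cell_of K l" K D "cell_of K j"]
      by (auto simp: T_def split: if_splits)
    have "?d k \<le> 2 * K"
      using exit_dist_good_cell[OF K, of D k 0] good by simp
    have r: "0 \<le> decay_rate K" "decay_rate K \<le> 1" using decay_rate[of K] by auto
    have "u l = u k * exp (decay_rate K * (T k - T l))"
      by (simp add: u_def algebra_simps flip: exp_add)
    also have "\<dots> \<le> u k * exp (decay_rate K)"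
      using r T u[of k] by (intro mult_left_mono) (auto simp: mult_left_le)
    also have "exp (decay_rate K) \<le> 1 + 2 * decay_rate K"
    proof -
      have "exp (decay_rate K) \<le> 1 + decay_rate K + (decay_rate K)\<^sup>2" by (rule exp_bound[OF r])
      also have "(decay_rate K)\<^sup>2 \<le> decay_rate K" using r by (simp add: power2_eq_square mult_left_le)
      finally show ?thesis by simp
    qed
    also have "2 * decay_rate K = v (2 * K)" by (simp add: decay_rate_def v_def)
    also have "v (2 * K) \<le> v (?d k)" by (rule v_mono) fact
    finally show ?thesis using u[of k] by simp
  next
    case False
    then have "u l \<le> u k" using decay_rate(1)[of K] by (simp add: u_def)
    also have "\<dots> \<le> u k * (1 + v (?d k))" using u[of k] v(1)[of "?d k"] by simp
    finally show ?thesis .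
  qed
  have diff: "B * u k * (v (?d l) - 2 * v (?d k)) \<le> \<psi> k - \<psi> l" if "nn k l" for k l
  proof -
    have "u l * (1 - v (?d l)) \<le> u k * (1 + v (?d k)) * (1 - v (?d l))"
      using u_nbr[OF that] v(2)[of "?d l"] by (intro mult_right_mono) auto
    also have "\<dots> \<le> u k * (1 + v (?d k) - v (?d l))"
      using u[of k] v(1)[of "?d k"] v(1)[of "?d l"] by (simp add: algebra_simps)
    finally have "u k * (v (?d l) - 2 * v (?d k)) \<le> u k * (1 - v (?d k)) - u l * (1 - v (?d l))"
      by (simp add: algebra_simps)
    then have "B * (u k * (v (?d l) - 2 * v (?d k))) \<le> B * (u k * (1 - v (?d k)) - u l * (1 - v (?d l)))"
      using B by (intro mult_left_mono) auto
    then show ?thesis by (simp add: \<psi>_def algebra_simps)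
  qed
  have main: "B * u k * v (?d k) \<le> (\<Sum>l | nn k l. c l * (\<psi> k - \<psi> l))"
    if k: "k \<in> D" and c: "\<And>l. 1 / cV \<le> c l \<and> c l \<le> cV" for k c
  proof -
    let ?w = "B * u k * v (?d k)"
    have w: "0 \<le> ?w" using B u[of k] v(1)[of "?d k"] by simp
    have c0: "0 \<le> c l" for l
    proof -
      have "0 < 1 / cV" using cV by simp
      then show ?thesis using c[of l] by linarith
    qed
    have each: "- (2 * cV * ?w) \<le> c l * (\<psi> k - \<psi> l)" if "nn k l" for l
    proof -
      have "B * u k * (0 - 2 * v (?d k)) \<le> B * u k * (v (?d l) - 2 * v (?d k))"
        using B u[of k] v(1)[of "?d l"] by (intro mult_left_mono) auto
      then have "- (2 * ?w) \<le> \<psi> k - \<psi> l" using diff[OF that] by simp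
      then have "c l * (- (2 * ?w)) \<le> c l * (\<psi> k - \<psi> l)" using c0 by (intro mult_left_mono)
      moreover have "c l * (2 * ?w) \<le> cV * (2 * ?w)" using c[of l] w by (intro mult_right_mono) auto
      ultimately show ?thesis by (simp add: mult_ac)
    qed
    obtain l0 where l0: "nn k l0" "Suc (?d l0) \<le> ?d k" using exit_dist_descent[OF D k] .
    have "?b * v (?d k) \<le> v (?d l0)"
    proof -
      have "v (?d k) \<le> v (Suc (?d l0))" by (rule v_mono) fact
      then show ?thesis using barrier_ratio by (simp add: v_def field_simps)
    qed
    then have "B * u k * (?b * v (?d k) - 2 * v (?d k)) \<le> B * u k * (v (?d l0) - 2 * v (?d k))"
      using B u[of k] by (intro mult_left_mono) auto
    then have "(?b - 2) * ?w \<le> \<psi> k - \<psi> l0" using diff[OF l0(1)] by (simp add: algebra_simps)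
    then have "7 * cV\<^sup>2 * ?w \<le> \<psi> k - \<psi> l0" by (simp add: barrier_ratio_def)
    then have "1 / cV * (7 * cV\<^sup>2 * ?w) \<le> c l0 * (\<psi> k - \<psi> l0)"
      using c[of l0] c0 w by (intro mult_mono) auto
    then have first: "7 * cV * ?w \<le> c l0 * (\<psi> k - \<psi> l0)"
      using cV by (simp add: power2_eq_square)
    have "(\<Sum>l | nn k l. c l * (\<psi> k - \<psi> l)) =
        c l0 * (\<psi> k - \<psi> l0) + (\<Sum>l\<in>{l. nn k l} - {l0}. c l * (\<psi> k - \<psi> l))"
      using l0(1) by (intro sum.remove) auto
    moreover have "(\<Sum>l\<in>{l. nn k l} - {l0}. - (2 * cV * ?w)) \<le> (\<Sum>l\<in>{l. nn k l} - {l0}. c l * (\<psi> k - \<psi> l))"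
      using each by (intro sum_mono) auto
    moreover have "(\<Sum>l\<in>{l. nn k l} - {l0}. - (2 * cV * ?w)) = - (3 * (2 * cV * ?w))"
    proof -
      have "card ({l. nn k l} - {l0}) = 3"
        using l0(1) card_neighbours by (subst card_Diff_singleton) auto
      then show ?thesis by simp
    qed
    ultimately have "7 * cV * ?w - 3 * (2 * cV * ?w) \<le> (\<Sum>l | nn k l. c l * (\<psi> k - \<psi> l))"
      using first by linarith
    moreover have "?w \<le> cV * ?w" using mult_right_mono[OF cV(1) w] by simp
    ultimately show ?thesis by linarith
  qed
  have "supersolution D j \<psi>"
    unfolding supersolution_def
  proof (intro conjI allI impI ballI)
    fix k assume "k \<notin> D"
    then have "?d k = 0" using exit_dist_le[of k D k] by (simp add: l1_def)
    then show "\<psi> k = 0" by (simp add: \<psi>_def v_def)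
  next
    fix k :: site and c :: "site \<Rightarrow> real"
    assume k: "k \<in> D" and "\<forall>l. 1 / cV \<le> c l \<and> c l \<le> cV"
    then have ge: "B * u k * v (?d k) \<le> (\<Sum>l | nn k l. c l * (\<psi> k - \<psi> l))" by (intro main) auto
    show "(if k = j then 1 else 0) \<le> (\<Sum>l | nn k l. c l * (\<psi> k - \<psi> l))"
    proof (cases "k = j")
      case True
      have "T j \<le> 1" using passage_self[of K D "cell_of K j"] by (simp add: T_def)
      then have "decay_rate K * T j \<le> decay_rate K * 1" using decay_rate(1)[of K] by (intro mult_left_mono) auto
      then have "1 / 2 \<le> 1 + - (decay_rate K * T j)" using decay_rate(2)[of K] by simp
      also have "\<dots> \<le> u j" unfolding u_def by (rule exp_ge_add_one_self)
      finally have "1 \<le> 2 * u j" by simp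
      also have "\<dots> = B * u j * v (?d j)"
        using barrier_ratio by (simp add: B_def v_def power_divide)
      finally show ?thesis using ge True by simp
    next
      case False
      have "0 \<le> B * u k * v (?d k)" using B u[of k] v(1)[of "?d k"] by simp
      then show ?thesis using ge False by simp
    qed
  qed
  moreover have "\<psi> i \<le> B * u i" for i
    using B u[of i] v[of "?d i"] by (simp add: \<psi>_def mult_left_le)
  ultimately show thesis by (intro that[of \<psi>]) (auto simp: B_def u_def T_def)
qed

end

section \<open>Cells without pinned sites\<close>

lemma finite_cell:
  assumes "0 < K"
  shows "finite (cell K q)" "card (cell K q) = K * K"
proof -
  have "cell K q = {fst q * int K..<fst q * int K + int K} \<times> {snd q * int K..<snd q * int K + int K}"
  proof -
    have "a div int K = b \<longleftrightarrow> a \<in> {b * int K..<b * int K + int K}" for a b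
    proof
      assume "a div int K = b"
      moreover have "a = a div int K * int K + a mod int K" "0 \<le> a mod int K" "a mod int K < int K"
        using assms by auto
      ultimately show "a \<in> {b * int K..<b * int K + int K}" by (metis atLeastLessThan_iff add_left_mono add.right_neutral add_strict_left_mono)
    next
      assume "a \<in> {b * int K..<b * int K + int K}"
      then have "0 \<le> a - b * int K" "a - b * int K < int K" by auto
      then have "(a - b * int K + b * int K) div int K = b" by (subst div_mult_self1) auto
      then show "a div int K = b" by simp
    qed
    then show ?thesis unfolding cell_def by auto
  qed
  then show "finite (cell K q)" "card (cell K q) = K * K" by (simp_all add: card_cartesian_product)
qed

lemma cell_nonempty: "0 < K \<Longrightarrow> cell K q \<noteq> {}"
  using finite_cell(2)[of K q] by (metis card.empty mult_is_0 not_less_zero)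

lemma cell_disjoint: "q \<noteq> q' \<Longrightarrow> cell K q \<inter> cell K q' = {}"
  by (auto simp: cell_def prod_eq_iff)

text \<open>Dividing twice by \<open>L\<close> is dividing by \<open>L * L\<close>: the indices of
  the subcells form themselves a cell of side \<open>L\<close>.\<close>

lemma cell_mult: "cell (L * L) q = (\<Union>r\<in>cell L q. cell L r)"
proof -
  have "a div int (L * L) = a div int L div int L" for a :: int
    by (simp add: zdiv_zmult2_eq)
  then show ?thesis by (auto simp: cell_def)
qed

abbreviation left :: "site \<Rightarrow> site" where
  "left q \<equiv> (fst q - 1, snd q)"

text \<open>All that the estimates on cells and the Peierls sum use of the field: nonnegative
  weights, and the price of pinning one more site at bounded distance from the pinned ones.\<close>

locale pin_family =
  fixes \<Lambda> :: "site set" and w :: "site set \<Rightarrow> real" and a :: real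
  assumes finite_\<Lambda>: "finite \<Lambda>" and w_nonneg: "0 \<le> w D" and a_pos: "0 < a"
    and remove: "D \<subseteq> \<Lambda> \<Longrightarrow> s \<in> D \<Longrightarrow> exit_dist D s \<le> R \<Longrightarrow> w D * (a / sqrt (real R)) \<le> w (D - {s})"
begin

definition Z :: real where
  "Z = sum w (Pow \<Lambda>)"

lemma Z_nonneg: "0 \<le> Z"
  by (simp add: Z_def sum_nonneg w_nonneg)

lemma sum_le_Z: "F \<subseteq> Pow \<Lambda> \<Longrightarrow> sum w F \<le> Z"
  unfolding Z_def using finite_\<Lambda> by (intro sum_mono2) (auto simp: w_nonneg)

text \<open>Pinning one site of \<open>c\<close> in every configuration of a family: since \<open>c\<close> was free of pinned sites,
  the original configuration and the new pinned site can both be recovered from the result.\<close>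

lemma pin_one:
  assumes F: "F \<subseteq> Pow \<Lambda>" and c: "finite c" "\<And>D. D \<in> F \<Longrightarrow> c \<subseteq> D"
    and near: "\<And>D. D \<in> F \<Longrightarrow> \<exists>y. y \<notin> D \<and> (\<forall>x\<in>c. l1 x y \<le> R)"
  shows "(real (card c) * a / sqrt (real R)) * sum w F \<le> sum w ((\<lambda>(D, s). D - {s}) ` (F \<times> c))"
proof -
  have finF: "finite F" using F finite_\<Lambda> by (meson finite_Pow_iff finite_subset)
  have inj: "inj_on (\<lambda>(D, s). D - {s}) (F \<times> c)"
  proof (rule inj_onI, clarify)
    fix D s D' s'
    assume *: "D \<in> F" "s \<in> c" "D' \<in> F" "s' \<in> c" "D - {s} = D' - {s'}"
    then have "c \<subseteq> D" "c \<subseteq> D'" using c(2) by auto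
    then have "{s} = c - (D - {s})" "{s'} = c - (D' - {s'})" using *(2,4) by auto
    then have "s = s'" using *(5) by auto
    moreover have "D = insert s (D - {s})" "D' = insert s' (D' - {s'})" using * \<open>c \<subseteq> D\<close> \<open>c \<subseteq> D'\<close> by auto
    ultimately show "D = D' \<and> s = s'" using *(5) by metis
  qed
  have "(real (card c) * a / sqrt (real R)) * sum w F = (\<Sum>D\<in>F. \<Sum>s\<in>c. w D * (a / sqrt (real R)))"
    by (simp add: sum_distrib_left sum_distrib_right sum_divide_distrib mult_ac)
  also have "\<dots> \<le> (\<Sum>D\<in>F. \<Sum>s\<in>c. w (D - {s}))"
  proof (intro sum_mono remove)
    fix D s assume D: "D \<in> F" "s \<in> c"
    then show "D \<subseteq> \<Lambda>" "s \<in> D" using F c(2) by auto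
    obtain y where "y \<notin> D" "l1 s y \<le> R" using near D by blast
    then show "exit_dist D s \<le> R" using exit_dist_le le_trans by blast
  qed
  also have "\<dots> = (\<Sum>(D, s)\<in>F \<times> c. w (D - {s}))"
    using finF c(1) by (simp add: sum.cartesian_product)
  also have "\<dots> = sum w ((\<lambda>(D, s). D - {s}) ` (F \<times> c))"
    using sum.reindex[OF inj, of w] by (simp add: split_beta o_def)
  finally show ?thesis .
qed

text \<open>The relation between \<open>D\<close> and \<open>D'\<close> keeps the induction going:
  the cells not yet treated are still free of pinned sites, and the nearby pinned site of
  \<open>D\<close> is still pinned in \<open>D'\<close>. So each further cell can be treated by
  \<open>pin_one\<close> with the same \<open>R\<close>.\<close>

lemma pin_many:
  assumes "finite Q" and F: "F \<subseteq> Pow \<Lambda>"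
    and c: "\<And>q. q \<in> Q \<Longrightarrow> finite (c q) \<and> card (c q) = M"
    and disj: "\<And>q q'. q \<in> Q \<Longrightarrow> q' \<in> Q \<Longrightarrow> q \<noteq> q' \<Longrightarrow> c q \<inter> c q' = {}"
    and sub: "\<And>D q. D \<in> F \<Longrightarrow> q \<in> Q \<Longrightarrow> c q \<subseteq> D"
    and near: "\<And>D. D \<in> F \<Longrightarrow> \<exists>y. y \<notin> D \<and> (\<forall>q\<in>Q. \<forall>x\<in>c q. l1 x y \<le> R)"
  shows "\<exists>F'\<subseteq>Pow \<Lambda>. (real M * a / sqrt (real R)) ^ card Q * sum w F \<le> sum w F' \<and>
    (\<forall>D'\<in>F'. \<exists>D\<in>F. D - (\<Union>q\<in>Q. c q) \<subseteq> D' \<and> D' \<subseteq> D \<and> (\<forall>q\<in>Q. \<not> c q \<subseteq> D'))"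
  using assms(1) c disj sub near
proof (induction Q rule: finite_induct)
  case empty
  then show ?case using F by (intro exI[of _ F]) auto
next
  case (insert q Q)
  let ?g = "real M * a / sqrt (real R)"
  have ex: "\<exists>F'\<subseteq>Pow \<Lambda>. ?g ^ card Q * sum w F \<le> sum w F' \<and>
      (\<forall>D'\<in>F'. \<exists>D\<in>F. D - (\<Union>q\<in>Q. c q) \<subseteq> D' \<and> D' \<subseteq> D \<and> (\<forall>q\<in>Q. \<not> c q \<subseteq> D'))"
  proof (rule insert.IH)
    show "\<exists>y. y \<notin> D \<and> (\<forall>q\<in>Q. \<forall>x\<in>c q. l1 x y \<le> R)" if "D \<in> F" for D
      using insert.prems(4)[OF that] by blast
  qed (use insert.prems in auto)
  obtain F' where "F' \<subseteq> Pow \<Lambda> \<and> ?g ^ card Q * sum w F \<le> sum w F' \<and>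
      (\<forall>D'\<in>F'. \<exists>D\<in>F. D - (\<Union>q\<in>Q. c q) \<subseteq> D' \<and> D' \<subseteq> D \<and> (\<forall>q\<in>Q. \<not> c q \<subseteq> D'))"
    using ex by (elim exE) (rule that)
  note F' = this[THEN conjunct1] this[THEN conjunct2, THEN conjunct1]
    this[THEN conjunct2, THEN conjunct2, rule_format]
  let ?G = "(\<lambda>(D, s). D - {s}) ` (F' \<times> c q)"
  have dq: "c q \<inter> (\<Union>q\<in>Q. c q) = {}" using insert.prems(2)[of q] insert.hyps(2) by auto
  have "(real (card (c q)) * a / sqrt (real R)) * sum w F' \<le> sum w ?G"
  proof (rule pin_one[OF F'(1)])
    show "finite (c q)" using insert.prems(1) by simp
    fix D' assume "D' \<in> F'"
    then obtain D where D: "D \<in> F" "D - (\<Union>q\<in>Q. c q) \<subseteq> D'" "D' \<subseteq> D" using F'(3) by blast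
    then show "c q \<subseteq> D'" using insert.prems(3)[OF D(1), of q] dq by blast
    show "\<exists>y. y \<notin> D' \<and> (\<forall>x\<in>c q. l1 x y \<le> R)" using insert.prems(4)[OF D(1)] D(3) by auto
  qed
  then have "?g * sum w F' \<le> sum w ?G" using insert.prems(1) by simp
  moreover have "?g * (?g ^ card Q * sum w F) \<le> ?g * sum w F'"
    using F'(2) a_pos by (intro mult_left_mono) auto
  ultimately have "?g ^ card (insert q Q) * sum w F \<le> sum w ?G"
    using insert.hyps by (simp add: mult.assoc)
  moreover have "?G \<subseteq> Pow \<Lambda>" using F'(1) by auto
  moreover have "\<exists>D\<in>F. D - (\<Union>q\<in>insert q Q. c q) \<subseteq> D'' \<and> D'' \<subseteq> D \<and> (\<forall>q'\<in>insert q Q. \<not> c q' \<subseteq> D'')"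
    if D'': "D'' \<in> ?G" for D''
  proof -
    obtain D' s where D': "D' \<in> F'" "s \<in> c q" "D'' = D' - {s}" using D'' by auto
    then obtain D where "D \<in> F" "D - (\<Union>q\<in>Q. c q) \<subseteq> D'" "D' \<subseteq> D" "\<forall>q\<in>Q. \<not> c q \<subseteq> D'" using F'(3) by blast
    then show ?thesis using D' by (intro bexI[of _ D]) auto
  qed
  ultimately show ?case by (intro exI[of _ ?G]) auto
qed

text \<open>A cell of side \<open>L\<^sup>2\<close> consists of \<open>L\<^sup>2\<close> cells of side \<open>L\<close>, each of which offers \<open>L\<^sup>2\<close> sites for a new
  pinned site, at the price of a factor of order \<open>1 / L\<close>. Hence the gain is of order \<open>L ^ L\<^sup>2\<close>, which beats
  any exponential of the side.\<close>

definition gain :: "nat \<Rightarrow> real" where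
  "gain L = (real (L * L) * a / sqrt (real (3 * (L * L)))) ^ (L * L)"

lemma gain_pos: "0 < L \<Longrightarrow> 0 < gain L"
  using a_pos by (simp add: gain_def)

text \<open>Work from left to right: the left neighbour of a leftmost cell of \<open>C\<close> is
  not in \<open>C\<close>, hence good, and supplies a nearby pinned site. Once treated, the cell is
  good itself and serves its right neighbour in turn.\<close>

lemma pin_cells:
  assumes L: "0 < L" and "finite C" "F \<subseteq> Pow \<Lambda>"
    and "\<And>D q. D \<in> F \<Longrightarrow> q \<in> C \<Longrightarrow> bad (L * L) D q"
    and "\<And>D q. D \<in> F \<Longrightarrow> q \<in> C \<Longrightarrow> left q \<in> C \<or> \<not> bad (L * L) D (left q)"
  shows "gain L ^ card C * sum w F \<le> Z"
  using assms(2-)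
proof (induction "card C" arbitrary: C F)
  case 0
  then show ?case using sum_le_Z by simp
next
  case (Suc n)
  let ?K = "L * L"
  have C: "finite C" "C \<noteq> {}" using Suc by auto
  define x where "x = Min (fst ` C)"
  have "x \<in> fst ` C" unfolding x_def using C by (intro Min_in) auto
  then obtain q where q: "q \<in> C" "fst q = x" by auto
  have "left q \<notin> C"
  proof
    assume "left q \<in> C"
    then have "x - 1 \<in> fst ` C" using q(2) by force
    then have "x \<le> x - 1" unfolding x_def using C(1) by (intro Min_le) auto
    then show False by simp
  qed
  have "\<exists>F'\<subseteq>Pow \<Lambda>. (real ?K * a / sqrt (real (3 * ?K))) ^ card (cell L q) * sum w F \<le> sum w F' \<and>
      (\<forall>D'\<in>F'. \<exists>D\<in>F. D - (\<Union>r\<in>cell L q. cell L r) \<subseteq> D' \<and> D' \<subseteq> D \<and> (\<forall>r\<in>cell L q. \<not> cell L r \<subseteq> D'))"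
  proof (rule pin_many[OF finite_cell(1)[OF L] Suc.prems(2)])
    show "finite (cell L r) \<and> card (cell L r) = ?K" for r using finite_cell[OF L] by auto
    show "cell L r \<inter> cell L r' = {}" if "r \<noteq> r'" for r r' using that by (rule cell_disjoint)
    show "cell L r \<subseteq> D" if "D \<in> F" "r \<in> cell L q" for D r
      using Suc.prems(3)[OF that(1) q(1)] that(2) unfolding bad_def cell_mult by blast
    fix D assume D: "D \<in> F"
    obtain y where y: "y \<in> cell ?K (left q)" "y \<notin> D"
      using Suc.prems(4)[OF D q(1)] \<open>left q \<notin> C\<close> unfolding bad_def by blast
    \<comment> \<open>Adjacent cells are the case \<open>r = 1\<close> of \<open>l1_cell_le\<close>;
      this is the 3 in \<open>gain\<close>.\<close>
    have "l1 z y \<le> 3 * ?K" if "z \<in> cell ?K q" for z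
      using l1_cell_le[of ?K z q y 1] that y(1) L by simp
    then show "\<exists>y. y \<notin> D \<and> (\<forall>r\<in>cell L q. \<forall>x\<in>cell L r. l1 x y \<le> 3 * ?K)"
      using y(2) unfolding cell_mult by blast
  qed
  then obtain F' where F': "F' \<subseteq> Pow \<Lambda>" "gain L * sum w F \<le> sum w F'"
    "\<And>D'. D' \<in> F' \<Longrightarrow> \<exists>D\<in>F. D - cell ?K q \<subseteq> D' \<and> D' \<subseteq> D \<and> \<not> bad ?K D' q"
  proof -
    assume *: "\<And>F'. F' \<subseteq> Pow \<Lambda> \<Longrightarrow> gain L * sum w F \<le> sum w F' \<Longrightarrow>
      (\<And>D'. D' \<in> F' \<Longrightarrow> \<exists>D\<in>F. D - cell ?K q \<subseteq> D' \<and> D' \<subseteq> D \<and> \<not> bad ?K D' q) \<Longrightarrow> thesis"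
    assume "\<exists>F'\<subseteq>Pow \<Lambda>. (real ?K * a / sqrt (real (3 * ?K))) ^ card (cell L q) * sum w F \<le> sum w F' \<and>
      (\<forall>D'\<in>F'. \<exists>D\<in>F. D - (\<Union>r\<in>cell L q. cell L r) \<subseteq> D' \<and> D' \<subseteq> D \<and> (\<forall>r\<in>cell L q. \<not> cell L r \<subseteq> D'))"
    then obtain F' where F': "F' \<subseteq> Pow \<Lambda>" "gain L * sum w F \<le> sum w F'"
      "\<forall>D'\<in>F'. \<exists>D\<in>F. D - cell ?K q \<subseteq> D' \<and> D' \<subseteq> D \<and> (\<forall>r\<in>cell L q. \<not> cell L r \<subseteq> D')"
      unfolding gain_def finite_cell(2)[OF L] cell_mult by blast
    show thesis
    proof (rule *[OF F'(1,2)])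
      fix D' assume "D' \<in> F'"
      then obtain D where D: "D \<in> F" "D - cell ?K q \<subseteq> D'" "D' \<subseteq> D" "\<forall>r\<in>cell L q. \<not> cell L r \<subseteq> D'"
        using F'(3) by blast
      obtain r where "r \<in> cell L q" using cell_nonempty[OF L, of q] by blast
      then have "\<not> bad ?K D' q" using D(4) unfolding bad_def cell_mult by blast
      then show "\<exists>D\<in>F. D - cell ?K q \<subseteq> D' \<and> D' \<subseteq> D \<and> \<not> bad ?K D' q" using D by blast
    qed
  qed
  have "gain L ^ card (C - {q}) * sum w F' \<le> Z"
  proof (rule Suc.hyps(1))
    show "n = card (C - {q})" using Suc.hyps(2) q(1) C(1) by simp
    show "finite (C - {q})" "F' \<subseteq> Pow \<Lambda>" using C F' by auto
    fix D' q' assume D': "D' \<in> F'" and q': "q' \<in> C - {q}"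
    obtain D where D: "D \<in> F" "D - cell ?K q \<subseteq> D'" "D' \<subseteq> D" "\<not> bad ?K D' q" using F'(3)[OF D'] by blast
    show "bad ?K D' q'"
      using Suc.prems(3)[OF D(1), of q'] q' D(2) cell_disjoint[of q q' ?K] unfolding bad_def by blast
    show "left q' \<in> C - {q} \<or> \<not> bad ?K D' (left q')"
    proof (cases "left q' = q")
      case True
      then show ?thesis using D(4) by simp
    next
      case False
      moreover have "left q' \<in> C \<or> \<not> bad ?K D (left q')" using Suc.prems(4)[OF D(1)] q' by blast
      moreover have "\<not> bad ?K D (left q') \<Longrightarrow> \<not> bad ?K D' (left q')" using D(3) unfolding bad_def by blast
      ultimately show ?thesis by blast
    qed
  qed
  moreover have "gain L ^ card C * sum w F = gain L ^ card (C - {q}) * (gain L * sum w F)"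
    using card.remove[OF C(1) q(1)] by simp
  moreover have "\<dots> \<le> gain L ^ card (C - {q}) * sum w F'"
    using F'(2) gain_pos[OF L] by (intro mult_left_mono) auto
  ultimately show ?case by linarith
qed

text \<open>The cells of \<open>B\<close> are moved to \<open>C\<close> one after the other; whenever the left neighbour of such a cell is
  bad as well, it joins \<open>B\<close>.\<close>

lemma bad_cells_aux:
  assumes L: "0 < L" and g: "2 \<le> gain L" and "finite B" "finite C" "B \<inter> C = {}"
  shows "sum w {D \<in> Pow \<Lambda>. (\<forall>q\<in>B \<union> C. bad (L * L) D q) \<and>
      (\<forall>q\<in>C. left q \<in> B \<union> C \<or> \<not> bad (L * L) D (left q))}
    \<le> (2 / gain L) ^ card B * (1 / gain L) ^ card C * Z"
  using assms(3-)
\<comment> \<open>Every step moves a cell meeting \<open>\<Lambda>\<close> into \<open>C\<close>, so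
  this number drops even when \<open>B\<close> does not shrink. A cell of \<open>B\<close> that
  misses \<open>\<Lambda>\<close> cannot be bad and makes the family empty.\<close>
proof (induction "card (cell_of (L * L) ` \<Lambda> - C)" arbitrary: B C rule: less_induct)
  case less
  let ?K = "L * L" and ?g = "gain L"
  have K: "0 < ?K" using L by simp
  define S where "S B C = {D \<in> Pow \<Lambda>. (\<forall>q\<in>B \<union> C. bad ?K D q) \<and>
      (\<forall>q\<in>C. left q \<in> B \<union> C \<or> \<not> bad ?K D (left q))}" for B C
  have finS: "finite (S B C)" for B C
    using finite_\<Lambda> by (intro finite_subset[of "S B C" "Pow \<Lambda>"]) (auto simp: S_def)
  have g0: "0 < ?g" using gain_pos[OF L] .
  have "sum w (S B C) \<le> (2 / ?g) ^ card B * (1 / ?g) ^ card C * Z"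
  proof (cases "B = {}")
    case True
    have "?g ^ card C * sum w (S B C) \<le> Z"
      using less.prems(2) True by (intro pin_cells[OF L]) (auto simp: S_def)
    then show ?thesis using g0 True by (simp add: field_simps)
  next
    case False
    then obtain q where q: "q \<in> B" by blast
    show ?thesis
    proof (cases "q \<in> cell_of ?K ` \<Lambda>")
      case False
      have "S B C = {}"
      proof (rule ccontr)
        assume "S B C \<noteq> {}"
        then obtain D where "D \<subseteq> \<Lambda>" "bad ?K D q" using q by (auto simp: S_def)
        then obtain y where "y \<in> cell ?K q" "y \<in> \<Lambda>"
          using cell_nonempty[OF K, of q] by (auto simp: bad_def)
        then show False using False by (auto simp: cell_def cell_of_def image_iff prod_eq_iff)
      qed
      then show ?thesis using g0 Z_nonneg by simp
    next
      case True
      have smaller: "card (cell_of ?K ` \<Lambda> - insert q C) < card (cell_of ?K ` \<Lambda> - C)"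
        using True q less.prems(3) finite_\<Lambda> by (intro psubset_card_mono) auto
      have fin: "finite (B - {q})" "finite (insert q C)" "finite (insert (left q) (B - {q}))"
        using less.prems by auto
      have "q \<notin> C" using less.prems(3) q by blast
      then have cC: "card (insert q C) = Suc (card C)" using less.prems(2) by simp
      obtain b where b: "card B = Suc b" "card (B - {q}) = b"
        using card.remove[OF less.prems(1) q] by simp
      have 1: "sum w (S (B - {q}) (insert q C)) \<le> (2 / ?g) ^ b * (1 / ?g) ^ Suc (card C) * Z"
        using less.hyps[OF smaller fin(1,2)] less.prems(3) unfolding S_def b(2) cC by auto
      have pos: "0 \<le> (2 / ?g) ^ b * (1 / ?g) ^ Suc (card C) * Z" using g0 Z_nonneg by simp
      have S1: "D \<in> S (B - {q}) (insert q C)"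
        if "D \<in> S B C" "left q \<in> B \<union> C \<or> \<not> bad ?K D (left q)" for D
        using that q by (auto simp: S_def)
      have le: "sum w (S B C) \<le> (2 / ?g) ^ b * (1 / ?g) ^ Suc (card C) * Z +
          (2 / ?g) ^ Suc b * (1 / ?g) ^ Suc (card C) * Z"
      proof (cases "left q \<in> B \<union> C")
        case True
        then have "S B C \<subseteq> S (B - {q}) (insert q C)" using S1 by blast
        then have "sum w (S B C) \<le> sum w (S (B - {q}) (insert q C))"
          using finS w_nonneg by (intro sum_mono2) auto
        moreover have "0 \<le> (2 / ?g) ^ Suc b * (1 / ?g) ^ Suc (card C) * Z" using g0 Z_nonneg by simp
        ultimately show ?thesis using 1 by linarith
      next
        case False
        have "card (insert (left q) (B - {q})) = Suc b" using False less.prems(1) b(2) by simp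
        moreover have "insert (left q) (B - {q}) \<inter> insert q C = {}"
          using False less.prems(3) by (cases q) auto
        ultimately have 2: "sum w (S (insert (left q) (B - {q})) (insert q C)) \<le>
            (2 / ?g) ^ Suc b * (1 / ?g) ^ Suc (card C) * Z"
          using less.hyps[OF smaller fin(3,2)] unfolding S_def cC by simp
        have "S B C \<subseteq> S (B - {q}) (insert q C) \<union> S (insert (left q) (B - {q})) (insert q C)"
        proof
          fix D assume D: "D \<in> S B C"
          show "D \<in> S (B - {q}) (insert q C) \<union> S (insert (left q) (B - {q})) (insert q C)"
          proof (cases "bad ?K D (left q)")
            case True
            then have "D \<in> S (insert (left q) (B - {q})) (insert q C)"
              using D q by (auto simp: S_def)
            then show ?thesis by simp
          next
            case False
            then show ?thesis using S1[OF D] by simp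
          qed
        qed
        then have "sum w (S B C) \<le> sum w (S (B - {q}) (insert q C) \<union> S (insert (left q) (B - {q})) (insert q C))"
          using finS w_nonneg by (intro sum_mono2) auto
        also have "\<dots> \<le> sum w (S (B - {q}) (insert q C)) + sum w (S (insert (left q) (B - {q})) (insert q C))"
          using finS w_nonneg by (subst sum_Un) (auto intro!: sum_nonneg)
        finally show ?thesis using 1 2 by linarith
      qed
      \<comment> \<open>The 2 per cell of \<open>B\<close> pays for the two alternatives: a good
        left neighbour leaves the share 1/2, a bad one the share \<open>1 / ?g\<close>, and
        \<open>?g \<ge> 2\<close> makes them add up to at most 1.\<close>
      also have "\<dots> = ((2 / ?g) ^ Suc b * (1 / ?g) ^ card C * Z) * (1 / 2 + 1 / ?g)"
        using g0 by (simp add: field_simps)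
      also have "\<dots> \<le> ((2 / ?g) ^ Suc b * (1 / ?g) ^ card C * Z) * 1"
        using g g0 Z_nonneg by (intro mult_left_mono) (auto simp: field_simps)
      finally show ?thesis by (simp add: b(1))
    qed
  qed
  then show ?case by (simp only: S_def)
qed

lemma bad_cells:
  assumes "0 < L" "2 \<le> gain L" "finite B"
  shows "sum w {D \<in> Pow \<Lambda>. \<forall>q\<in>B. bad (L * L) D q} \<le> (2 / gain L) ^ card B * Z"
  using bad_cells_aux[OF assms, of "{}"] by simp

end

section \<open>Peierls estimate\<close>

definition walks :: "nat \<Rightarrow> site \<Rightarrow> site list set" where
  "walks n q = {p. length p = Suc n \<and> hd p = q \<and> successively nn p}"

lemma finite_walks: "finite (walks n q) \<and> card (walks n q) \<le> 4 ^ n"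
proof (induction n arbitrary: q)
  case 0
  have "walks 0 q = {[q]}" by (auto simp: walks_def length_Suc_conv)
  then show ?case by simp
next
  case (Suc n)
  have sub: "walks (Suc n) q \<subseteq> (\<Union>l\<in>{l. nn q l}. (#) q ` walks n l)"
  proof
    fix p assume "p \<in> walks (Suc n) q"
    then obtain l p' where "p = q # l # p'" "length p' = n" "nn q l" "successively nn (l # p')"
      by (auto simp: walks_def length_Suc_conv)
    moreover from this have "l # p' \<in> walks n l" by (simp add: walks_def)
    ultimately show "p \<in> (\<Union>l\<in>{l. nn q l}. (#) q ` walks n l)" by blast
  qed
  have fin: "finite (\<Union>l\<in>{l. nn q l}. (#) q ` walks n l)" using Suc by auto
  have "card (walks (Suc n) q) \<le> card (\<Union>l\<in>{l. nn q l}. (#) q ` walks n l)"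
    by (rule card_mono[OF fin sub])
  also have "\<dots> \<le> (\<Sum>l | nn q l. card ((#) q ` walks n l))"
    by (rule card_UN_le) simp
  also have "\<dots> \<le> (\<Sum>l | nn q l. 4 ^ n)"
    using Suc by (intro sum_mono order_trans[OF card_image_le]) auto
  also have "\<dots> = 4 ^ Suc n" by (simp add: card_neighbours)
  finally show ?case using finite_subset[OF sub fin] by simp
qed

lemma length_walk:
  "walk q q0 p \<Longrightarrow> l1 q q0 < length p"
proof (induction p arbitrary: q)
  case (Cons x p)
  then have x: "x = q" by (simp add: walk_def)
  show ?case
  proof (cases "p = []")
    case True
    then show ?thesis using Cons.prems x by (simp add: walk_def l1_def)
  next
    case False
    then have "nn q (hd p)" "walk (hd p) q0 p"
      using Cons.prems x by (auto simp: walk_def successively_Cons)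
    moreover have "l1 q q0 \<le> Suc (l1 (hd p) q0)"
      using \<open>nn q (hd p)\<close> by (auto simp: nn_def l1_def)
    ultimately show ?thesis using Cons.IH by fastforce
  qed
qed (simp add: walk_def)

lemma walk_loop_erasure:
  assumes "walk q q0 (xs @ [y] @ ys @ [y] @ zs)"
  shows "walk q q0 (xs @ [y] @ zs)"
proof -
  have "hd (xs @ [y] @ zs) = q" using assms by (cases xs) (auto simp: walk_def)
  moreover have "last (xs @ [y] @ zs) = q0" using assms by (auto simp: walk_def)
  moreover have "successively nn (xs @ [y] @ zs)"
    using assms by (auto simp: walk_def successively_append_iff successively_Cons split: if_splits)
  ultimately show ?thesis by (simp add: walk_def)
qed

text \<open>A shortest walk among those meeting the fewest good cells does not repeat a cell.\<close>

lemma passage_distinct: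
  obtains p where "walk q q0 p" "distinct p" "good_count K D p \<le> passage K D q0 q"
proof -
  let ?P = "\<lambda>p. walk q q0 p \<and> good_count K D p \<le> passage K D q0 q"
  obtain p0 where "?P p0" using passage_attained[of q q0 K D] by (metis order_refl)
  then obtain p where p: "?P p" "\<And>p'. ?P p' \<Longrightarrow> length p \<le> length p'"
    using ex_has_least_nat[of ?P p0 length] by blast
  have "distinct p"
  proof (rule ccontr)
    assume "\<not> distinct p"
    then obtain xs y ys zs where d: "p = xs @ [y] @ ys @ [y] @ zs" using not_distinct_decomp by blast
    have "walk q q0 (xs @ [y] @ zs)" using p(1) walk_loop_erasure unfolding d by blast
    moreover have "good_count K D (xs @ [y] @ zs) \<le> good_count K D p"
      by (simp add: d good_count_def)
    ultimately have "length p \<le> length (xs @ [y] @ zs)" using p by (meson order_trans)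
    then show False by (simp add: d)
  qed
  then show thesis using that p(1) by blast
qed

text \<open>Cutting a loop-free optimal walk after \<open>n + 1\<close> cells fixes the length for
  counting; at most half of these cells are good. As they are distinct, the number of bad ones is a
  cardinality to which \<open>bad_cells\<close> applies.\<close>

lemma few_good_cells:
  assumes "n \<le> l1 q q0" "2 * passage K D q0 q \<le> n + 1"
  obtains p B where "p \<in> walks n q" "B \<subseteq> set p" "n + 1 \<le> 2 * card B" "\<forall>x\<in>B. bad K D x"
proof -
  obtain p0 where p0: "walk q q0 p0" "distinct p0" "good_count K D p0 \<le> passage K D q0 q"
    using passage_distinct .
  have len: "Suc n \<le> length p0" using length_walk[OF p0(1)] assms(1) by simp
  define p where "p = take (Suc n) p0"
  have p: "length p = Suc n" "distinct p" using len p0(2) by (auto simp: p_def)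
  have split: "p0 = p @ drop (Suc n) p0" by (simp add: p_def)
  have "successively nn p" using p0(1) split unfolding walk_def by (metis successively_append_iff)
  moreover have "hd p = q" using p0(1) p(1) by (cases p0) (auto simp: p_def walk_def)
  ultimately have "p \<in> walks n q" using p(1) by (simp add: walks_def)
  define B where "B = set (filter (bad K D) p)"
  have "good_count K D p \<le> good_count K D p0"
  proof -
    have "good_count K D (p @ drop (Suc n) p0) = good_count K D p + good_count K D (drop (Suc n) p0)"
      by (simp add: good_count_def)
    then show ?thesis using split by simp
  qed
  moreover have "card B = length (filter (bad K D) p)"
    unfolding B_def using p(2) by (intro distinct_card distinct_filter)
  moreover have "length (filter (bad K D) p) + good_count K D p = Suc n"
    unfolding good_count_def using sum_length_filter_compl[of "bad K D" p] p(1) by simp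
  ultimately have "n + 1 \<le> 2 * card B" using p0(3) assms(2) by linarith
  then show thesis
    using \<open>p \<in> walks n q\<close> by (intro that[of p B]) (auto simp: B_def)
qed

context pin_family
begin

text \<open>At most \<open>4 ^ n\<close> walks and \<open>2 ^ (n + 1)\<close> choices of the bad
  cells on each. With \<open>512 \<le> gain L\<close> a bad cell costs at most
  \<open>1 / 256 = (1 / 16)\<^sup>2\<close>, and at least half of the \<open>n + 1\<close> cells are
  bad, so the ratio is \<open>8 / 16\<close>.\<close>

lemma peierls:
  assumes L: "0 < L" and g: "512 \<le> gain L" and n: "n \<le> l1 q q0"
  shows "sum w {D \<in> Pow \<Lambda>. 2 * passage (L * L) D q0 q \<le> n + 1} \<le> (1 / 2) ^ (n + 1) * Z"
proof -
  let ?K = "L * L"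
  let ?I = "SIGMA p:walks n q. {B. B \<subseteq> set p \<and> n + 1 \<le> 2 * card B}"
  let ?S = "\<lambda>B. {D \<in> Pow \<Lambda>. \<forall>x\<in>B. bad ?K D x}"
  have finI: "finite ?I" using finite_walks by (intro finite_SigmaI) auto
  have finS: "finite (?S B)" for B using finite_\<Lambda> by simp
  have "{D \<in> Pow \<Lambda>. 2 * passage ?K D q0 q \<le> n + 1} \<subseteq> (\<Union>(p, B)\<in>?I. ?S B)"
  proof
    fix D assume D: "D \<in> {D \<in> Pow \<Lambda>. 2 * passage ?K D q0 q \<le> n + 1}"
    then obtain p B where "p \<in> walks n q" "B \<subseteq> set p" "n + 1 \<le> 2 * card B" "\<forall>x\<in>B. bad ?K D x"
      using few_good_cells[OF n, of ?K D] by blast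
    then show "D \<in> (\<Union>(p, B)\<in>?I. ?S B)" using D by auto
  qed
  then have "sum w {D \<in> Pow \<Lambda>. 2 * passage ?K D q0 q \<le> n + 1} \<le> sum w (\<Union>(p, B)\<in>?I. ?S B)"
    using finI finite_\<Lambda> by (intro sum_mono2 w_nonneg) auto
  also have "\<dots> \<le> (\<Sum>(p, B)\<in>?I. sum w (?S B))"
  proof -
    have "sum w (\<Union>i\<in>?I. ?S (snd i)) \<le> (\<Sum>i\<in>?I. sum w (?S (snd i)))"
      using finI
    proof (induction rule: finite_induct)
      case (insert i I)
      have "sum w (?S (snd i) \<union> (\<Union>i\<in>I. ?S (snd i))) \<le> sum w (?S (snd i)) + sum w (\<Union>i\<in>I. ?S (snd i))"
        using finS insert.hyps(1) w_nonneg by (subst sum_Un) (auto intro!: sum_nonneg)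
      then show ?case using insert by simp
    qed simp
    then show ?thesis by (simp add: split_beta)
  qed
  also have "\<dots> \<le> (\<Sum>(p, B)\<in>?I. (1 / 16) ^ (n + 1) * Z)"
  proof (intro sum_mono, clarify)
    fix p B assume "p \<in> walks n q" "B \<subseteq> set p" and B: "n + 1 \<le> 2 * card B"
    then have "finite B" using finite_subset by blast
    then have "sum w (?S B) \<le> (2 / gain L) ^ card B * Z" using g by (intro bad_cells[OF L]) auto
    also have "\<dots> \<le> (1 / 256) ^ card B * Z"
      using g Z_nonneg by (intro mult_right_mono power_mono) (auto simp: field_simps)
    also have "(1 / 256 :: real) ^ card B = (1 / 16) ^ (2 * card B)"
      by (simp add: power_mult power2_eq_square)
    also have "\<dots> * Z \<le> (1 / 16) ^ (n + 1) * Z"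
      using B Z_nonneg by (intro mult_right_mono power_decreasing) auto
    finally show "sum w (?S B) \<le> (1 / 16) ^ (n + 1) * Z" .
  qed
  also have "\<dots> = real (card ?I) * ((1 / 16) ^ (n + 1) * Z)" by (simp add: split_beta)
  also have "\<dots> \<le> 8 ^ (n + 1) * ((1 / 16) ^ (n + 1) * Z)"
  proof (rule mult_right_mono)
    have "card ?I = (\<Sum>p\<in>walks n q. card {B. B \<subseteq> set p \<and> n + 1 \<le> 2 * card B})"
      using finite_walks by (intro card_SigmaI) auto
    also have "\<dots> \<le> (\<Sum>p\<in>walks n q. 2 ^ (n + 1))"
    proof (rule sum_mono)
      fix p assume p: "p \<in> walks n q"
      have "card {B. B \<subseteq> set p \<and> n + 1 \<le> 2 * card B} \<le> card (Pow (set p))"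
        by (intro card_mono) auto
      also have "\<dots> = 2 ^ card (set p)" by (simp add: card_Pow)
      also have "\<dots> \<le> 2 ^ (n + 1)"
        using card_length[of p] p by (intro power_increasing) (auto simp: walks_def)
      finally show "card {B. B \<subseteq> set p \<and> n + 1 \<le> 2 * card B} \<le> 2 ^ (n + 1)" .
    qed
    also have "\<dots> = card (walks n q) * 2 ^ (n + 1)" by simp
    also have "\<dots> \<le> 4 ^ n * 2 ^ (n + 1)" using finite_walks by (intro mult_right_mono) auto
    also have "\<dots> \<le> 4 ^ (n + 1) * 2 ^ (n + 1)" by simp
    also have "\<dots> = 8 ^ (n + 1)" by (simp flip: power_mult_distrib)
    finally have "real (card ?I) \<le> real (8 ^ (n + 1))" by (rule of_nat_mono)
    then show "real (card ?I) \<le> 8 ^ (n + 1)" by simp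
  qed (use Z_nonneg in simp)
  also have "\<dots> = (8 * (1 / 16)) ^ (n + 1) * Z" by (simp only: power_mult_distrib mult.assoc)
  finally show ?thesis by simp
qed

text \<open>Scan the row of \<open>j\<close> to the left for the first good cell, at offset
  \<open>r\<close>. The \<open>r\<close> cells before it are all bad, at price
  \<open>(2 / gain L) ^ r\<close>, against a gain of \<open>\<beta> ^ (L * L)\<close> per cell; the
  condition on \<open>\<beta>\<close> makes the series geometric with ratio 1/2.\<close>

lemma exponential_exit_dist:
  assumes L: "0 < L" and g: "2 \<le> gain L" and \<beta>: "1 \<le> \<beta>" "4 * \<beta> ^ (L * L) \<le> gain L"
  shows "(\<Sum>D\<in>Pow \<Lambda>. w D * \<beta> ^ exit_dist D j) \<le> 2 * \<beta> ^ (2 * (L * L)) * Z"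
proof -
  let ?K = "L * L"
  have K: "0 < ?K" using L by simp
  let ?q = "\<lambda>k::nat. (fst (cell_of ?K j) - int k, snd (cell_of ?K j))"
  let ?B = "\<lambda>r. ?q ` {..<r}"
  let ?U = "cell_of ?K ` \<Lambda>"
  have cB: "card (?B r) = r" for r by (subst card_image) (auto simp: inj_on_def)
  have bad_U: "q \<in> ?U" if "D \<subseteq> \<Lambda>" "bad ?K D q" for D q
  proof -
    obtain y where "y \<in> cell ?K q" using cell_nonempty[OF K] by blast
    then have "y \<in> \<Lambda>" "q = cell_of ?K y" using that by (auto simp: bad_def cell_def cell_of_def)
    then show ?thesis by blast
  qed
  let ?ind = "\<lambda>D r. if \<forall>q\<in>?B r. bad ?K D q then 1 else 0 :: real"
  \<comment> \<open>A bad cell lies in \<open>\<Lambda>\<close>, so the scan ends after at most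
    \<open>card ?U\<close> bad cells and the sum over \<open>r\<close> can be finite.\<close>
  have each: "\<beta> ^ exit_dist D j \<le> (\<Sum>r\<le>card ?U. ?ind D r * \<beta> ^ (?K * (r + 2)))" if D: "D \<subseteq> \<Lambda>" for D
  proof -
    have small: "r \<le> card ?U" if "\<forall>q\<in>?B r. bad ?K D q" for r
    proof -
      have "?B r \<subseteq> ?U" using that bad_U[OF D] by blast
      then have "card (?B r) \<le> card ?U" using finite_\<Lambda> by (intro card_mono) auto
      then show ?thesis by (simp only: cB)
    qed
    have "\<exists>r. \<not> bad ?K D (?q r)"
    proof (rule ccontr)
      assume "\<not> ?thesis"
      then have "Suc (card ?U) \<le> card ?U" by (intro small) auto
      then show False by simp
    qed
    then obtain r where r: "\<not> bad ?K D (?q r)" "\<And>k. k < r \<Longrightarrow> bad ?K D (?q k)"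
      using exists_least_iff[of "\<lambda>r. \<not> bad ?K D (?q r)"] by blast
    have all: "\<forall>q\<in>?B r. bad ?K D q" using r(2) by auto
    have "\<beta> ^ exit_dist D j \<le> \<beta> ^ (?K * (r + 2))"
      using \<beta>(1) exit_dist_good_cell[OF K r(1)] by (intro power_increasing) auto
    also have "\<dots> = ?ind D r * \<beta> ^ (?K * (r + 2))" using all by simp
    also have "\<dots> \<le> (\<Sum>r\<le>card ?U. ?ind D r * \<beta> ^ (?K * (r + 2)))"
      using \<beta>(1) small[OF all]
      by (intro member_le_sum[where f = "\<lambda>r. ?ind D r * \<beta> ^ (?K * (r + 2))"]) auto
    finally show ?thesis .
  qed
  have g0: "0 < gain L" using gain_pos[OF L] .
  have "(\<Sum>D\<in>Pow \<Lambda>. w D * \<beta> ^ exit_dist D j) \<le>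
      (\<Sum>D\<in>Pow \<Lambda>. w D * (\<Sum>r\<le>card ?U. ?ind D r * \<beta> ^ (?K * (r + 2))))"
    using each by (intro sum_mono mult_left_mono) (auto simp: w_nonneg)
  also have "\<dots> = (\<Sum>D\<in>Pow \<Lambda>. \<Sum>r\<le>card ?U. \<beta> ^ (?K * (r + 2)) * (w D * ?ind D r))"
    by (simp only: sum_distrib_left mult_ac)
  also have "\<dots> = (\<Sum>r\<le>card ?U. \<Sum>D\<in>Pow \<Lambda>. \<beta> ^ (?K * (r + 2)) * (w D * ?ind D r))"
    by (rule sum.swap)
  also have "\<dots> \<le> (\<Sum>r\<le>card ?U. \<beta> ^ (2 * ?K) * Z * (1 / 2) ^ r)"
  proof (rule sum_mono)
    fix r
    have "(\<Sum>D\<in>Pow \<Lambda>. w D * ?ind D r) = sum w {D \<in> Pow \<Lambda>. \<forall>q\<in>?B r. bad ?K D q}"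
      using finite_\<Lambda> by (subst sum.inter_filter) (auto intro!: sum.cong)
    also have "\<dots> \<le> (2 / gain L) ^ card (?B r) * Z" by (rule bad_cells[OF L g]) simp
    also have "card (?B r) = r" by (rule cB)
    finally have "(\<Sum>D\<in>Pow \<Lambda>. \<beta> ^ (?K * (r + 2)) * (w D * ?ind D r)) \<le> \<beta> ^ (?K * (r + 2)) * ((2 / gain L) ^ r * Z)"
      using \<beta>(1) by (simp only: sum_distrib_left[symmetric]) (intro mult_left_mono, auto)
    also have "\<beta> ^ (?K * (r + 2)) * ((2 / gain L) ^ r * Z) = \<beta> ^ (2 * ?K) * Z * (\<beta> ^ ?K * (2 / gain L)) ^ r"
    proof -
      have "?K * (r + 2) = 2 * ?K + ?K * r" by (simp add: algebra_simps)
      then have "\<beta> ^ (?K * (r + 2)) = \<beta> ^ (2 * ?K) * (\<beta> ^ ?K) ^ r"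
        by (simp only: power_add power_mult)
      then show ?thesis by (simp only: power_mult_distrib mult_ac)
    qed
    also have "\<dots> \<le> \<beta> ^ (2 * ?K) * Z * (1 / 2) ^ r"
      using \<beta> g0 Z_nonneg by (intro mult_left_mono power_mono) (auto simp: field_simps)
    finally show "(\<Sum>D\<in>Pow \<Lambda>. \<beta> ^ (?K * (r + 2)) * (w D * ?ind D r)) \<le> \<beta> ^ (2 * ?K) * Z * (1 / 2) ^ r" .
  qed
  also have "\<dots> = \<beta> ^ (2 * ?K) * Z * (\<Sum>r\<le>card ?U. (1 / 2) ^ r)" by (simp add: sum_distrib_left)
  also have "\<dots> \<le> \<beta> ^ (2 * ?K) * Z * 2"
  proof (rule mult_left_mono)
    have "(\<Sum>r\<le>m. (1 / 2 :: real) ^ r) \<le> 2 - (1 / 2) ^ m" for m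
      by (induction m) auto
    then show "(\<Sum>r\<le>card ?U. (1 / 2 :: real) ^ r) \<le> 2"
      by (rule order_trans) simp
  qed (use \<beta>(1) Z_nonneg in simp)
  finally show ?thesis by simp
qed

end

section \<open>Exponential decay of the covariance\<close>

context pair_potential
begin

lemma pin_family: "pin_family (Defs.box N) (pin_weight J N) (exp J / sqrt (4 * pi * cV))"
proof
  fix D s R assume "D \<subseteq> Defs.box N" "s \<in> D" "exit_dist D s \<le> R"
  from pin_weight_remove[OF this, of J]
  show "pin_weight J N D * (exp J / sqrt (4 * pi * cV) / sqrt (real R)) \<le> pin_weight J N (D - {s})"
    by (simp add: real_sqrt_mult)
qed (use cV in \<open>auto simp: pin_weight_nonneg\<close>)

text \<open>Hypothesis \<open>g\<close> serves two purposes: \<open>512 \<le> gain L\<close> for the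
  Peierls sum, and \<open>4 * (barrier_ratio\<^sup>2) ^ (L * L) \<le> gain L\<close> for the second
  moment of the prefactor.\<close>

lemma covariance_decay:
  assumes L: "0 < L"
    and g: "512 * barrier_ratio ^ (2 * (L * L)) \<le> (real (L * L) * (exp J / sqrt (4 * pi * cV)) / sqrt (real (3 * (L * L)))) ^ (L * L)"
  shows "covariance (pinned_measure V J N) (\<lambda>\<phi>. \<phi> i) (\<lambda>\<phi>. \<phi> j) \<le>
    (4 * barrier_ratio ^ (4 * (L * L)) + 4) *
      exp (- (decay_rate (L * L) / (2 * real (L * L))) * real_of_int (sup_norm (i - j)))"
proof -
  interpret pin_family "Defs.box N" "pin_weight J N" "exp J / sqrt (4 * pi * cV)" by (rule pin_family)
  let ?K = "L * L" and ?b = barrier_ratio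
  let ?e = "decay_rate ?K"
  have K: "0 < ?K" using L by simp
  have b: "1 \<le> ?b" using barrier_ratio by simp
  have e: "0 < ?e" "?e \<le> 1 / 2" using decay_rate by auto
  have g': "512 * ?b ^ (2 * ?K) \<le> gain L" using g by (simp add: gain_def)
  have b1: "1 \<le> ?b ^ (2 * ?K)" using b by (rule one_le_power)
  let ?q = "cell_of ?K i" and ?o = "cell_of ?K j"
  define n where "n = l1 ?q ?o"
  let ?T = "\<lambda>D. passage ?K D ?o ?q"
  \<comment> \<open>The weight in the arithmetic-geometric mean inequality. It is the root of the
    bound on the mean of \<open>(Y D)\<^sup>2\<close>, so both terms come out of order
    \<open>\<alpha>\<close>.\<close>
  define \<alpha> where "\<alpha> = exp (- (?e * real (n + 1)) / 2)"
  have \<alpha>: "0 < \<alpha>" "\<alpha> * \<alpha> = exp (- (?e * real (n + 1)))" by (auto simp: \<alpha>_def simp flip: exp_add)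
  define X where "X D = ?b ^ exit_dist D j" for D
  define Y where "Y D = exp (- (?e * real (?T D)))" for D
  have Z: "Z = total_weight J N" by (simp add: Z_def total_weight_def)
  have Z0: "0 < Z" unfolding Z by (rule total_weight_pos)
  have "covariance (pinned_measure V J N) (\<lambda>\<phi>. \<phi> i) (\<lambda>\<phi>. \<phi> j)
      \<le> (\<Sum>D\<in>Pow (Defs.box N). pin_weight J N D * (2 * X D * Y D)) / Z"
    unfolding Z
  proof (rule covariance_pinned_le)
    show "0 \<le> 2 * X D * Y D" for D using b by (simp add: X_def Y_def)
    fix D assume "D \<subseteq> Defs.box N" "j \<in> D"
    then obtain \<psi> where "supersolution D j \<psi>" "\<And>i. \<psi> i \<le> 2 * ?b ^ exit_dist D j *
        exp (- (?e * real (passage ?K D ?o (cell_of ?K i))))"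
      using supersolution_exists[OF finite_subset_box _ K] by blast
    then show "\<exists>\<psi>. supersolution D j \<psi> \<and> \<psi> i \<le> 2 * X D * Y D"
      unfolding X_def Y_def by blast
  qed
  also have "\<dots> \<le> (\<Sum>D\<in>Pow (Defs.box N). pin_weight J N D * (\<alpha> * (X D)\<^sup>2 + (Y D)\<^sup>2 / \<alpha>)) / Z"
  proof (intro divide_right_mono sum_mono mult_left_mono pin_weight_nonneg)
    fix D
    have "0 \<le> (\<alpha> * X D - Y D)\<^sup>2 / \<alpha>" using \<alpha> by simp
    also have "\<dots> = \<alpha> * (X D)\<^sup>2 + (Y D)\<^sup>2 / \<alpha> - 2 * X D * Y D"
      using \<alpha>(1) by (simp add: power2_eq_square field_simps)
    finally show "2 * X D * Y D \<le> \<alpha> * (X D)\<^sup>2 + (Y D)\<^sup>2 / \<alpha>" by simp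
  qed (use Z0 in simp)
  also have "\<dots> = (\<alpha> * (\<Sum>D\<in>Pow (Defs.box N). pin_weight J N D * (X D)\<^sup>2) +
      (\<Sum>D\<in>Pow (Defs.box N). pin_weight J N D * (Y D)\<^sup>2) / \<alpha>) / Z"
    by (simp add: distrib_left sum.distrib sum_distrib_left sum_divide_distrib mult_ac)
  also have "\<dots> \<le> (\<alpha> * (2 * (?b\<^sup>2) ^ (2 * ?K) * Z) + (2 * (\<alpha> * \<alpha>) * Z) / \<alpha>) / Z"
  proof (intro divide_right_mono add_mono mult_left_mono)
    have "(\<Sum>D\<in>Pow (Defs.box N). pin_weight J N D * (?b\<^sup>2) ^ exit_dist D j) \<le> 2 * (?b\<^sup>2) ^ (2 * ?K) * Z"
    proof (rule exponential_exit_dist[OF L])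
      show "2 \<le> gain L" using g' b1 by linarith
      show "1 \<le> ?b\<^sup>2" using b by (rule one_le_power)
      have "4 * (?b\<^sup>2) ^ ?K = 4 * ?b ^ (2 * ?K)" by (simp add: power_mult)
      then show "4 * (?b\<^sup>2) ^ ?K \<le> gain L" using g' b1 by linarith
    qed
    moreover have "(X D)\<^sup>2 = (?b\<^sup>2) ^ exit_dist D j" for D
      by (simp add: X_def mult.commute flip: power_mult)
    ultimately show "(\<Sum>D\<in>Pow (Defs.box N). pin_weight J N D * (X D)\<^sup>2) \<le> 2 * (?b\<^sup>2) ^ (2 * ?K) * Z" by simp
  next
    \<comment> \<open>The exceptional sets, with few good cells between \<open>i\<close> and
      \<open>j\<close>: there \<open>Y D\<close> is only bounded by 1, elsewhere its square is at
      most \<open>\<alpha> * \<alpha>\<close>.\<close>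
    let ?F = "{D \<in> Pow (Defs.box N). 2 * ?T D \<le> n + 1}"
    have "(\<Sum>D\<in>Pow (Defs.box N). pin_weight J N D * (Y D)\<^sup>2) \<le>
        (\<Sum>D\<in>Pow (Defs.box N). pin_weight J N D * (\<alpha> * \<alpha>) + (if D \<in> ?F then pin_weight J N D else 0))"
    proof (rule sum_mono)
      fix D assume D: "D \<in> Pow (Defs.box N)"
      have Y2: "(Y D)\<^sup>2 = exp (- (?e * real (2 * ?T D)))"
        by (simp add: Y_def power2_eq_square flip: exp_add)
      show "pin_weight J N D * (Y D)\<^sup>2 \<le> pin_weight J N D * (\<alpha> * \<alpha>) + (if D \<in> ?F then pin_weight J N D else 0)"
      proof (cases "D \<in> ?F")
        case True
        have "pin_weight J N D * (Y D)\<^sup>2 \<le> pin_weight J N D * 1"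
          unfolding Y2 using e(1) by (intro mult_left_mono pin_weight_nonneg) simp
        moreover have "0 \<le> pin_weight J N D * (\<alpha> * \<alpha>)" using \<alpha>(1) pin_weight_nonneg by simp
        ultimately show ?thesis using True by simp
      next
        case False
        then have "real (n + 1) \<le> real (2 * ?T D)" using D by simp
        then have "(Y D)\<^sup>2 \<le> \<alpha> * \<alpha>" unfolding Y2 \<alpha>(2) using e(1) by simp
        then have "pin_weight J N D * (Y D)\<^sup>2 \<le> pin_weight J N D * (\<alpha> * \<alpha>)"
          by (intro mult_left_mono pin_weight_nonneg)
        then show ?thesis unfolding if_not_P[OF False] by simp
      qed
    qed
    also have "\<dots> = \<alpha> * \<alpha> * Z + sum (pin_weight J N) ?F"
      by (simp add: sum.distrib sum_distrib_left[symmetric] sum_distrib_right[symmetric] Z_def mult.commute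
          sum.If_cases Int_def)
    also have "sum (pin_weight J N) ?F \<le> (1 / 2) ^ (n + 1) * Z"
    proof (rule peierls[OF L])
      show "512 \<le> gain L" using g' b1 by linarith
    qed (simp add: n_def)
    also have "(1 / 2) ^ (n + 1) * Z \<le> \<alpha> * \<alpha> * Z"
    proof (rule mult_right_mono)
      \<comment> \<open>The decay rate is at most 1/2, so the Peierls bound does not exceed
        \<open>\<alpha> * \<alpha>\<close>.\<close>
      have "1 / 2 \<le> 1 + - ?e" using e(2) by simp
      also have "\<dots> \<le> exp (- ?e)" by (rule exp_ge_add_one_self)
      finally have "(1 / 2) ^ (n + 1) \<le> exp (- ?e) ^ (n + 1)" by (intro power_mono) auto
      also have "\<dots> = \<alpha> * \<alpha>" unfolding \<alpha>(2) by (simp only: exp_of_nat_mult[symmetric]) (simp add: mult.commute)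
      finally show "(1 / 2) ^ (n + 1) \<le> \<alpha> * \<alpha>" .
    qed (use Z0 in simp)
    finally show "(\<Sum>D\<in>Pow (Defs.box N). pin_weight J N D * (Y D)\<^sup>2) \<le> 2 * (\<alpha> * \<alpha>) * Z" by simp
  qed (use \<alpha> Z0 in auto)
  also have "\<dots> = (2 * ?b ^ (4 * ?K) + 2) * \<alpha>"
    using \<alpha>(1) Z0 by (simp add: field_simps flip: power_mult)
  also have "\<dots> \<le> (4 * ?b ^ (4 * ?K) + 4) * \<alpha>"
    using \<alpha>(1) b by (intro mult_right_mono) auto
  also have "\<alpha> \<le> exp (- (?e / (2 * real ?K)) * real_of_int (sup_norm (i - j)))"
  proof -
    \<comment> \<open>Indices that differ by at most \<open>n\<close> mean coordinates within
      \<open>n + 1\<close> sides, which matches the \<open>n + 1\<close> in \<open>\<alpha>\<close>;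
      the root in \<open>\<alpha>\<close> is the 2 in the rate.\<close>
    have coord: "\<bar>x - y\<bar> \<le> (int n + 1) * int ?K" if "\<bar>x div int ?K - y div int ?K\<bar> \<le> int n" for x y :: int
    proof -
      have "(x div int ?K - y div int ?K) * int ?K \<le> int n * int ?K"
        "- int n * int ?K \<le> (x div int ?K - y div int ?K) * int ?K"
        using that by (intro mult_right_mono; linarith)+
      then show ?thesis
        using div_diff_bounds[OF K, of x y] by (simp only: distrib_right)
    qed
    have "sup_norm (i - j) \<le> (int n + 1) * int ?K"
      unfolding sup_norm_def fst_diff snd_diff
      by (intro max.boundedI coord) (auto simp: n_def l1_def cell_of_def)
    then have "real_of_int (sup_norm (i - j)) \<le> real_of_int ((int n + 1) * int ?K)" by (simp only: of_int_le_iff)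
    then have "real_of_int (sup_norm (i - j)) \<le> real (n + 1) * real ?K" by (simp add: algebra_simps)
    then have "?e / (2 * real ?K) * real_of_int (sup_norm (i - j)) \<le> ?e / (2 * real ?K) * (real (n + 1) * real ?K)"
      using e(1) by (intro mult_left_mono) auto
    also have "\<dots> = ?e * real (n + 1) / 2" using L by (simp add: field_simps)
    finally show ?thesis unfolding \<alpha>_def by simp
  qed
  finally show ?thesis using b by (simp add: mult_left_mono)
qed

end

theorem lemma2:
  fixes cV J :: real
  assumes "1 \<le> cV"
  shows "\<exists>m>0. \<exists>c1::real. \<forall>V. interaction_potential cV V \<longrightarrow>
    (\<forall>(N::nat) (i::site) (j::site).
      covariance (pinned_measure V J N) (\<lambda>\<phi>. \<phi> i) (\<lambda>\<phi>. \<phi> j)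
        \<le> c1 * exp (- m * real_of_int (sup_norm (i - j))))"
proof -
  \<comment> \<open>\<open>b\<close> and \<open>a\<close> depend on \<open>cV\<close> and
    \<open>J\<close> only: rate and prefactor have to be fixed before \<open>V\<close> is.\<close>
  define b where "b = 2 + 7 * cV\<^sup>2"
  have b: "1 \<le> b" by (simp add: b_def)
  define a where "a = exp J / sqrt (4 * pi * cV)"
  have a: "0 < a" using assms by (simp add: a_def)
  \<comment> \<open>The base of the gain grows linearly in \<open>L\<close> and its exponent is the
    side \<open>L * L\<close>, so a large \<open>L\<close> beats \<open>b ^ (2 * (L * L))\<close>
    however large \<open>b\<close> is.\<close>
  obtain L :: nat where L: "512 * b\<^sup>2 * sqrt 3 / a < real L" using reals_Archimedean2 by blast
  moreover have "0 \<le> 512 * b\<^sup>2 * sqrt 3 / a" using a by simp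
  ultimately have L0: "0 < L" by (metis of_nat_0_less_iff order_le_less_trans)
  have "512 * b\<^sup>2 \<le> real L * a / sqrt 3" using L a by (simp add: field_simps)
  also have "real L * a / sqrt 3 = real (L * L) * a / sqrt (real (3 * (L * L)))"
    using L0 by (simp add: real_sqrt_mult field_simps)
  finally have base: "512 * b\<^sup>2 \<le> real (L * L) * a / sqrt (real (3 * (L * L)))" .
  have "512 * b ^ (2 * (L * L)) \<le> 512 ^ (L * L) * (b\<^sup>2) ^ (L * L)"
    using L0 b self_le_power[of "512 :: real" "L * L"] by (simp add: power_mult mult_right_mono)
  also have "\<dots> = (512 * b\<^sup>2) ^ (L * L)" by (simp add: power_mult_distrib)
  also have "\<dots> \<le> (real (L * L) * a / sqrt (real (3 * (L * L)))) ^ (L * L)"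
    using base b by (intro power_mono) auto
  finally have gain: "512 * b ^ (2 * (L * L)) \<le> (real (L * L) * a / sqrt (real (3 * (L * L)))) ^ (L * L)" .
  define m where "m = (1 / b) ^ (2 * (L * L)) / 2 / (2 * real (L * L))"
  have "0 < m" using b L0 by (simp add: m_def)
  moreover have "covariance (pinned_measure V J N) (\<lambda>\<phi>. \<phi> i) (\<lambda>\<phi>. \<phi> j)
      \<le> (4 * b ^ (4 * (L * L)) + 4) * exp (- m * real_of_int (sup_norm (i - j)))"
    if "interaction_potential cV V" for V N i j
  proof -
    interpret pair_potential cV V using that by unfold_locales
    have "barrier_ratio = b" by (simp add: barrier_ratio_def b_def)
    then show ?thesis
      using covariance_decay[OF L0, of J N i j] gain by (simp add: decay_rate_def m_def a_def)
  qed
  ultimately show ?thesis by blast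
qed

end
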